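(* The only regular dominant weight of the representation $V_\rho$ of highest weight $\rho$ is $\rho$. Thus the numerator in the untwisted case, $N(\mathbf{x})=N(\mathbf{x};(0,\ldots,0))$, is uniquely determined by the functional equations (FE) (stated in the context) after setting $a_0=1$; that is, $N(\mathbf{x})$ is the only polynomial $\sum_{\lambda\in\Lambda}a_\lambda\mathbf{x}^\lambda\in\mathbb{C}[x_1,\ldots,x_r]$ with $a_0=1$ whose coefficients satisfy (FE).
   Context: Let $\Phi$ be a simply-laced reduced root system of rank $r$ with Weyl group $W$, a fixed decomposition $\Phi=\Phi^+\cup\Phi^-$ into positive and negative roots, simple roots $\alpha_1,\ldots,\alpha_r$ and corresponding simple reflections $\sigma_1,\ldots,\sigma_r\in W$. Indices $i\ne j$ are adjacent (written $i\sim j$) if the corresponding nodes of the Dynkin diagram are adjacent. Let $\rho=\frac12\sum_{\alpha\in\Phi^+}\alpha$ (the sum of the fundamental weights). $V_\rho$ is the irreducible representation of highest weight $\rho$ of the complex semisimple Lie algebra with root system $\Phi$. A weight is regular if its stabilizer in $W$ is trivial. Let $\Lambda$ be the root lattice, and for $\lambda=\sum_i k_i\alpha_i\in\Lambda$ put $d(\lambda)=\sum_i k_i$ and $\mathbf{x}^\lambda=x_1^{k_1}\cdots x_r^{k_r}$. For weights, $\mu\ge\lambda$ means $\mu-\lambda$ is a nonnegative integral combination of simple roots. Fix a prime power $q$, with $\sqrt q>0$, and let $F=\mathbb{C}(x_1,\ldots,x_r)$, $\mathbf{x}=(x_1,\ldots,x_r)$. Definition of $N(\mathbf{x})$. Define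 $\sigma_i\mathbf{x}=\mathbf{x}'$ by $x_j'=x_ix_j\sqrt q$ if $i$ and $j$ are adjacent, $x_j'=1/(qx_j)$ if $j=i$, and $x_j'=x_j$ otherwise; this extends to an action of $W$ on $\mathbf{x}$, written $w\mathbf{x}$. Define $\epsilon_i\mathbf{x}=\mathbf{x}'$ by $x_j'=-x_j$ if $i$ and $j$ are adjacent and $x_j'=x_j$ otherwise. For $f\in F$ set $f^{\pm}_{i}(\mathbf{x})=\frac12(f(\mathbf{x})\pm f(\epsilon_i\mathbf{x}))$ and $$(f|\sigma_i)(\mathbf{x})=-\frac{1-qx_i}{qx_i(1-x_i)}f^+_{i}(\sigma_i\mathbf{x})+\frac{1}{x_i\sqrt q}f^-_{i}(\sigma_i\mathbf{x}).$$ This extends to a (right) action $f\mapsto f|w$ of $W$ on $F$, i.e. $f|(ww')=(f|w)|w'$. Define $\Delta(\mathbf{x})=\prod_{\alpha\in\Phi^+}(1-q^{d(\alpha)}\mathbf{x}^{2\alpha})$, $j(w,\mathbf{x})=\Delta(\mathbf{x})/\Delta(w\mathbf{x})$, $f(\mathbf{x})=\Delta(\mathbf{x})^{-1}\sum_{w\in W}j(w,\mathbf{x})(1|w)(\mathbf{x})$, $D(\mathbf{x})=\prod_{\alpha\in\Phi^+}(1-q^{d(\alpha)-1}\mathbf{x}^{2\alpha})$, and $N(\mathbf{x})=D(\mathbf{x})f(\mathbf{x})$, which is a polynomial in $x_1,\ldots,x_r$ with constant term $1$. Functional equations (FE), in the untwisted case. For $\mu=\sum_j k_j\alpha_j\in\Lambda$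 put $\varphi_k(\mu)=\sum_{j\sim k}k_j$. (FE) is the following system: for every $k\in\{1,\ldots,r\}$ and all $\lambda,\mu\in\Lambda$ with $\mu=\sigma_k\lambda+\alpha_k$ and $\mu\ge\lambda$, setting $\beta=\lambda-\mu+\alpha_k$, $$qa_{\lambda-\alpha_k}+a_\lambda=q^{d(\beta)/2}\bigl(a_\mu+a_{\mu+\alpha_k}/q\bigr)\quad\text{if }\varphi_k(\mu)\text{ is even},$$ $$q^2a_{\lambda-2\alpha_k}-a_\lambda=\sqrt q\cdot q^{d(\beta)/2}\bigl(a_\mu-a_{\mu+2\alpha_k}/q^2\bigr)\quad\text{if }\varphi_k(\mu)\text{ is odd}.$$ (Coefficients $a_\nu$ of monomials not occurring in the polynomial are $0$.) *)

theory Defs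
  imports
    "HOL-Analysis.Analysis"
    "HOL-Library.Poly_Mapping"
    "HOL-Computational_Algebra.Fraction_Field"
    "HOL-Number_Theory.Prime_Powers"
begin

section \<open>Root systems\<close>

definition reflect :: "'v::euclidean_space \<Rightarrow> 'v \<Rightarrow> 'v" where
  "reflect \<beta> v = v - (2 * (v \<bullet> \<beta>) / (\<beta> \<bullet> \<beta>)) *\<^sub>R \<beta>"

definition root_system :: "'v::euclidean_space set \<Rightarrow> bool" where
  "root_system \<Phi> \<longleftrightarrow> finite \<Phi> \<and> span \<Phi> = UNIV \<and> 0 \<notin> \<Phi> \<and>
     (\<forall>\<beta>\<in>\<Phi>. \<forall>\<gamma>\<in>\<Phi>. reflect \<beta> \<gamma> \<in> \<Phi> \<and> 2 * (\<gamma> \<bullet> \<beta>) / (\<beta> \<bullet> \<beta>) \<in> \<int>)"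

definition reduced_root_system :: "'v::euclidean_space set \<Rightarrow> bool" where
  "reduced_root_system \<Phi> \<longleftrightarrow> root_system \<Phi> \<and>
     (\<forall>\<beta>\<in>\<Phi>. \<forall>c::real. c *\<^sub>R \<beta> \<in> \<Phi> \<longrightarrow> c = 1 \<or> c = - 1)"

text \<open>The simple roots are a family \<open>\<alpha>\<close> indexed by a finite type of cardinality the rank.\<close>

definition positive_roots :: "'v::euclidean_space set \<Rightarrow> ('i::finite \<Rightarrow> 'v) \<Rightarrow> 'v set" where
  "positive_roots \<Phi> \<alpha> = {\<beta> \<in> \<Phi>. \<exists>k :: 'i \<Rightarrow> nat. \<beta> = (\<Sum>i\<in>UNIV. real (k i) *\<^sub>R \<alpha> i)}"

definition simple_roots :: "'v::euclidean_space set \<Rightarrow> ('i::finite \<Rightarrow> 'v) \<Rightarrow> bool" where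
  "simple_roots \<Phi> \<alpha> \<longleftrightarrow> inj \<alpha> \<and> independent (range \<alpha>) \<and> range \<alpha> \<subseteq> \<Phi> \<and>
     (\<forall>\<beta>\<in>\<Phi>. \<beta> \<in> positive_roots \<Phi> \<alpha> \<or> - \<beta> \<in> positive_roots \<Phi> \<alpha>)"

text \<open>The number of edges of the Dynkin diagram joining distinct nodes \<open>i\<close> and \<open>j\<close>.\<close>

definition dynkin_edges :: "('i \<Rightarrow> 'v::euclidean_space) \<Rightarrow> 'i \<Rightarrow> 'i \<Rightarrow> real" where
  "dynkin_edges \<alpha> i j =
     (2 * (\<alpha> i \<bullet> \<alpha> j) / (\<alpha> j \<bullet> \<alpha> j)) * (2 * (\<alpha> j \<bullet> \<alpha> i) / (\<alpha> i \<bullet> \<alpha> i))"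

definition simply_laced :: "('i \<Rightarrow> 'v::euclidean_space) \<Rightarrow> bool" where
  "simply_laced \<alpha> \<longleftrightarrow> (\<forall>i j. i \<noteq> j \<longrightarrow> dynkin_edges \<alpha> i j \<le> 1)"

definition adjacent :: "('i \<Rightarrow> 'v::euclidean_space) \<Rightarrow> 'i \<Rightarrow> 'i \<Rightarrow> bool" where
  "adjacent \<alpha> i j \<longleftrightarrow> i \<noteq> j \<and> dynkin_edges \<alpha> i j \<noteq> 0"

inductive_set weyl_group :: "('v::euclidean_space) set \<Rightarrow> ('v \<Rightarrow> 'v) set"
  for \<Phi> :: "'v set" where
  weyl_id: "id \<in> weyl_group \<Phi>"
| weyl_reflect: "\<beta> \<in> \<Phi> \<Longrightarrow> w \<in> weyl_group \<Phi> \<Longrightarrow> reflect \<beta> \<circ> w \<in> weyl_group \<Phi>"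

definition rho :: "'v::euclidean_space set \<Rightarrow> ('i::finite \<Rightarrow> 'v) \<Rightarrow> 'v" where
  "rho \<Phi> \<alpha> = (1/2) *\<^sub>R (\<Sum>\<beta>\<in>positive_roots \<Phi> \<alpha>. \<beta>)"

definition dominant :: "('i \<Rightarrow> 'v::euclidean_space) \<Rightarrow> 'v \<Rightarrow> bool" where
  "dominant \<alpha> \<mu> \<longleftrightarrow> (\<forall>i. 2 * (\<mu> \<bullet> \<alpha> i) / (\<alpha> i \<bullet> \<alpha> i) \<ge> 0)"

definition regular :: "'v::euclidean_space set \<Rightarrow> 'v \<Rightarrow> bool" where
  "regular \<Phi> \<mu> \<longleftrightarrow> {w \<in> weyl_group \<Phi>. w \<mu> = \<mu>} = {id}"

definition root_lattice :: "('i::finite \<Rightarrow> 'v::euclidean_space) \<Rightarrow> 'v set" where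
  "root_lattice \<alpha> = range (\<lambda>k :: 'i \<Rightarrow> int. \<Sum>i\<in>UNIV. of_int (k i) *\<^sub>R \<alpha> i)"

definition root_coord :: "('i::finite \<Rightarrow> 'v::euclidean_space) \<Rightarrow> 'v \<Rightarrow> 'i \<Rightarrow> int" where
  "root_coord \<alpha> \<mu> = (THE k. \<mu> = (\<Sum>i\<in>UNIV. of_int (k i) *\<^sub>R \<alpha> i))"

definition height :: "('i::finite \<Rightarrow> 'v::euclidean_space) \<Rightarrow> 'v \<Rightarrow> int" where
  "height \<alpha> \<mu> = (\<Sum>i\<in>UNIV. root_coord \<alpha> \<mu> i)"

definition weight_ge :: "('i::finite \<Rightarrow> 'v::euclidean_space) \<Rightarrow> 'v \<Rightarrow> 'v \<Rightarrow> bool" where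
  "weight_ge \<alpha> \<mu> \<nu> \<longleftrightarrow> (\<exists>k :: 'i \<Rightarrow> nat. \<mu> - \<nu> = (\<Sum>i\<in>UNIV. real (k i) *\<^sub>R \<alpha> i))"


section \<open>Complex semisimple Lie algebras and their representations\<close>

locale complex_lie_algebra = vector_space scale
  for scale :: "complex \<Rightarrow> 'g::ab_group_add \<Rightarrow> 'g" +
  fixes bracket :: "'g \<Rightarrow> 'g \<Rightarrow> 'g"
  assumes finite_dim: "\<exists>B. finite B \<and> span B = UNIV"
    and linear_bracket_left: "Vector_Spaces.linear scale scale (\<lambda>x. bracket x y)"
    and linear_bracket_right: "Vector_Spaces.linear scale scale (\<lambda>y. bracket x y)"
    and bracket_self: "bracket x x = 0"
    and jacobi: "bracket x (bracket y z) + bracket y (bracket z x) + bracket z (bracket x y) = 0"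
begin

definition ideal :: "'g set \<Rightarrow> bool" where
  "ideal I \<longleftrightarrow> subspace I \<and> (\<forall>x. \<forall>y\<in>I. bracket x y \<in> I)"

definition derived :: "'g set \<Rightarrow> 'g set" where
  "derived A = span {bracket x y | x y. x \<in> A \<and> y \<in> A}"

definition solvable :: "'g set \<Rightarrow> bool" where
  "solvable A \<longleftrightarrow> (\<exists>n. (derived ^^ n) A = {0})"

definition abelian_subalgebra :: "'g set \<Rightarrow> bool" where
  "abelian_subalgebra H \<longleftrightarrow> subspace H \<and> (\<forall>x\<in>H. \<forall>y\<in>H. bracket x y = 0)"

text \<open>Over the complex numbers, an endomorphism is semisimple iff its eigenvectors span.\<close>

definition ad_semisimple :: "'g \<Rightarrow> bool" where
  "ad_semisimple x \<longleftrightarrow> span {y. \<exists>c. bracket x y = scale c y} = UNIV"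

text \<open>The usual definition for a semisimple algebra: a maximal abelian subalgebra
  all of whose elements are ad-semisimple.\<close>

definition cartan_subalgebra :: "'g set \<Rightarrow> bool" where
  "cartan_subalgebra H \<longleftrightarrow> abelian_subalgebra H \<and>
     (\<forall>H'. abelian_subalgebra H' \<and> H \<subseteq> H' \<longrightarrow> H' = H) \<and> (\<forall>x\<in>H. ad_semisimple x)"

text \<open>A functional on \<open>H\<close> is represented by a function on the whole algebra of which
  only the values on \<open>H\<close> matter.\<close>

definition root_space :: "'g set \<Rightarrow> ('g \<Rightarrow> complex) \<Rightarrow> 'g set" where
  "root_space H l = {y. \<forall>x\<in>H. bracket x y = scale (l x) y}"

definition is_root :: "'g set \<Rightarrow> ('g \<Rightarrow> complex) \<Rightarrow> bool" where
  "is_root H l \<longleftrightarrow> (\<exists>x\<in>H. l x \<noteq> 0) \<and> (\<exists>y\<in>root_space H l. y \<noteq> 0)"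

text \<open>The roots with respect to \<open>H\<close> form the root system \<open>\<Phi>\<close>, where \<open>\<iota>\<close> identifies the ambient
  Euclidean space of \<open>\<Phi>\<close> with a real subspace of the dual of \<open>H\<close>.\<close>

definition has_root_system ::
  "'g set \<Rightarrow> 'v::euclidean_space set \<Rightarrow> ('v \<Rightarrow> 'g \<Rightarrow> complex) \<Rightarrow> bool" where
  "has_root_system H \<Phi> \<iota> \<longleftrightarrow>
     (\<forall>x\<in>H. Real_Vector_Spaces.linear (\<lambda>v. \<iota> v x)) \<and>
     (\<forall>v. (\<forall>x\<in>H. \<iota> v x = 0) \<longrightarrow> v = 0) \<and>
     (\<forall>\<beta>\<in>\<Phi>. is_root H (\<iota> \<beta>)) \<and>
     (\<forall>l. is_root H l \<longrightarrow> (\<exists>\<beta>\<in>\<Phi>. \<forall>x\<in>H. l x = \<iota> \<beta> x))"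

end

locale semisimple_lie_algebra = complex_lie_algebra +
  assumes semisimple: "ideal I \<Longrightarrow> solvable I \<Longrightarrow> I = {0}"

locale lie_representation =
  complex_lie_algebra scale bracket + V: vector_space vscale
  for scale :: "complex \<Rightarrow> 'g::ab_group_add \<Rightarrow> 'g"
    and bracket :: "'g \<Rightarrow> 'g \<Rightarrow> 'g"
    and vscale :: "complex \<Rightarrow> 'm::ab_group_add \<Rightarrow> 'm" +
  fixes act :: "'g \<Rightarrow> 'm \<Rightarrow> 'm"
  assumes linear_act_left: "Vector_Spaces.linear scale vscale (\<lambda>x. act x v)"
    and linear_act_right: "Vector_Spaces.linear vscale vscale (\<lambda>v. act x v)"
    and act_bracket: "act (bracket x y) v = act x (act y v) - act y (act x v)"
begin

definition irreducible_rep :: bool where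
  "irreducible_rep \<longleftrightarrow> (UNIV :: 'm set) \<noteq> {0} \<and>
     (\<forall>U. V.subspace U \<and> (\<forall>x. \<forall>v\<in>U. act x v \<in> U) \<longrightarrow> U = {0} \<or> U = UNIV)"

definition weight_space :: "'g set \<Rightarrow> ('g \<Rightarrow> complex) \<Rightarrow> 'm set" where
  "weight_space H l = {v. \<forall>x\<in>H. act x v = vscale (l x) v}"

definition is_weight :: "'g set \<Rightarrow> ('g \<Rightarrow> complex) \<Rightarrow> bool" where
  "is_weight H l \<longleftrightarrow> (\<exists>v\<in>weight_space H l. v \<noteq> 0)"

text \<open>\<open>P\<close> is the set of positive roots. Finite-dimensionality is not imposed: it is automatic for an
  irreducible representation whose highest weight is dominant integral.\<close>

definition is_highest_weight ::
  "'g set \<Rightarrow> ('g \<Rightarrow> complex) set \<Rightarrow> ('g \<Rightarrow> complex) \<Rightarrow> bool" where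
  "is_highest_weight H P l \<longleftrightarrow>
     (\<exists>v\<in>weight_space H l. v \<noteq> 0 \<and> (\<forall>\<beta>\<in>P. \<forall>x\<in>root_space H \<beta>. act x v = 0))"

end


section \<open>The field of rational functions and the Weyl group action\<close>

type_synonym 'i mpoly = "('i \<Rightarrow>\<^sub>0 nat) \<Rightarrow>\<^sub>0 complex"

type_synonym 'i ratfun = "'i mpoly fract"

definition of_poly :: "'i::{finite,linorder} mpoly \<Rightarrow> 'i ratfun" where
  "of_poly p = Fract p 1"

definition const_fun :: "complex \<Rightarrow> 'i::{finite,linorder} ratfun" where
  "const_fun c = of_poly (Poly_Mapping.single 0 c)"

definition Xvar :: "'i::{finite,linorder} \<Rightarrow> 'i ratfun" where
  "Xvar i = of_poly (Poly_Mapping.single (Poly_Mapping.single i 1) 1)"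

definition eval_poly :: "('i \<Rightarrow> 'i ratfun) \<Rightarrow> 'i::{finite,linorder} mpoly \<Rightarrow> 'i ratfun" where
  "eval_poly y p = (\<Sum>m\<in>Poly_Mapping.keys p.
     const_fun (Poly_Mapping.lookup p m) * (\<Prod>i\<in>UNIV. y i ^ Poly_Mapping.lookup m i))"

text \<open>Substitution \<open>f(y)\<close> of a tuple \<open>y\<close> of rational functions into a rational function \<open>f\<close>.
  The value does not depend on the chosen fraction as soon as \<open>eval_poly y\<close> is injective; this
  holds for the tuples of scalar multiples of Laurent monomials used below, each of which defines an
  automorphism of the field.\<close>

definition subst :: "('i \<Rightarrow> 'i ratfun) \<Rightarrow> 'i::{finite,linorder} ratfun \<Rightarrow> 'i ratfun" where
  "subst y f = (let (a, b) = (SOME (a, b). b \<noteq> 0 \<and> f = Fract a b)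
                in eval_poly y a / eval_poly y b)"

definition sqrt_const :: "nat \<Rightarrow> 'i::{finite,linorder} ratfun" where
  "sqrt_const q = const_fun (complex_of_real (sqrt (real q)))"

text \<open>\<open>sigma_pt\<close> and \<open>eps_pt\<close> are the maps \<open>\<sigma>\<^sub>i\<close> and \<open>\<epsilon>\<^sub>i\<close> on tuples.\<close>

definition sigma_pt :: "('i \<Rightarrow> 'v::euclidean_space) \<Rightarrow> nat \<Rightarrow> 'i \<Rightarrow>
    ('i::{finite,linorder} \<Rightarrow> 'i ratfun) \<Rightarrow> 'i \<Rightarrow> 'i ratfun" where
  "sigma_pt \<alpha> q i y = (\<lambda>j. if adjacent \<alpha> i j then y i * y j * sqrt_const q
                            else if j = i then 1 / (of_nat q * y j) else y j)"

definition eps_pt :: "('i \<Rightarrow> 'v::euclidean_space) \<Rightarrow> 'i \<Rightarrow>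
    ('i::{finite,linorder} \<Rightarrow> 'i ratfun) \<Rightarrow> 'i \<Rightarrow> 'i ratfun" where
  "eps_pt \<alpha> i y = (\<lambda>j. if adjacent \<alpha> i j then - y j else y j)"

definition even_part :: "('i \<Rightarrow> 'v::euclidean_space) \<Rightarrow> 'i \<Rightarrow>
    'i::{finite,linorder} ratfun \<Rightarrow> 'i ratfun" where
  "even_part \<alpha> i f = (f + subst (eps_pt \<alpha> i Xvar) f) / 2"

definition odd_part :: "('i \<Rightarrow> 'v::euclidean_space) \<Rightarrow> 'i \<Rightarrow>
    'i::{finite,linorder} ratfun \<Rightarrow> 'i ratfun" where
  "odd_part \<alpha> i f = (f - subst (eps_pt \<alpha> i Xvar) f) / 2"

definition slash_simple :: "('i \<Rightarrow> 'v::euclidean_space) \<Rightarrow> nat \<Rightarrow> 'i \<Rightarrow>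
    'i::{finite,linorder} ratfun \<Rightarrow> 'i ratfun" where
  "slash_simple \<alpha> q i f =
     - ((1 - of_nat q * Xvar i) / (of_nat q * Xvar i * (1 - Xvar i)))
         * subst (sigma_pt \<alpha> q i Xvar) (even_part \<alpha> i f)
     + 1 / (Xvar i * sqrt_const q) * subst (sigma_pt \<alpha> q i Xvar) (odd_part \<alpha> i f)"

definition word_prod :: "('i \<Rightarrow> 'v::euclidean_space) \<Rightarrow> 'i list \<Rightarrow> 'v \<Rightarrow> 'v" where
  "word_prod \<alpha> is = foldr (\<lambda>i w. reflect (\<alpha> i) \<circ> w) is id"

text \<open>The actions of \<open>w = \<sigma>\<^bsub>i1\<^esub> \<cdots> \<sigma>\<^bsub>in\<^esub>\<close> are obtained by composing those of the simple
  reflections along an expression of \<open>w\<close>. Since they extend to a left action on tuples and a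
  right action on functions, the choice of the expression is immaterial.\<close>

definition word_of :: "('i \<Rightarrow> 'v::euclidean_space) \<Rightarrow> ('v \<Rightarrow> 'v) \<Rightarrow> 'i list" where
  "word_of \<alpha> w = (SOME is. word_prod \<alpha> is = w)"

definition weyl_pt :: "('i \<Rightarrow> 'v::euclidean_space) \<Rightarrow> nat \<Rightarrow> ('v \<Rightarrow> 'v) \<Rightarrow>
    ('i::{finite,linorder} \<Rightarrow> 'i ratfun) \<Rightarrow> 'i \<Rightarrow> 'i ratfun" where
  "weyl_pt \<alpha> q w y = foldr (sigma_pt \<alpha> q) (word_of \<alpha> w) y"

definition slash :: "('i \<Rightarrow> 'v::euclidean_space) \<Rightarrow> nat \<Rightarrow>
    'i::{finite,linorder} ratfun \<Rightarrow> ('v \<Rightarrow> 'v) \<Rightarrow> 'i ratfun" where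
  "slash \<alpha> q f w = foldl (\<lambda>g i. slash_simple \<alpha> q i g) f (word_of \<alpha> w)"

definition monomial :: "('i \<Rightarrow> 'v::euclidean_space) \<Rightarrow> 'v \<Rightarrow> 'i::{finite,linorder} ratfun" where
  "monomial \<alpha> \<mu> = (\<Prod>i\<in>UNIV. Xvar i powi root_coord \<alpha> \<mu> i)"

definition Delta :: "'v::euclidean_space set \<Rightarrow> ('i \<Rightarrow> 'v) \<Rightarrow> nat \<Rightarrow>
    'i::{finite,linorder} ratfun" where
  "Delta \<Phi> \<alpha> q = (\<Prod>\<beta>\<in>positive_roots \<Phi> \<alpha>.
     1 - of_nat q powi height \<alpha> \<beta> * monomial \<alpha> (2 *\<^sub>R \<beta>))"

definition cocycle :: "'v::euclidean_space set \<Rightarrow> ('i \<Rightarrow> 'v) \<Rightarrow> nat \<Rightarrow> ('v \<Rightarrow> 'v) \<Rightarrow>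
    'i::{finite,linorder} ratfun" where
  "cocycle \<Phi> \<alpha> q w = Delta \<Phi> \<alpha> q / subst (weyl_pt \<alpha> q w Xvar) (Delta \<Phi> \<alpha> q)"

definition averaged :: "'v::euclidean_space set \<Rightarrow> ('i \<Rightarrow> 'v) \<Rightarrow> nat \<Rightarrow>
    'i::{finite,linorder} ratfun" where
  "averaged \<Phi> \<alpha> q =
     inverse (Delta \<Phi> \<alpha> q) * (\<Sum>w\<in>weyl_group \<Phi>. cocycle \<Phi> \<alpha> q w * slash \<alpha> q 1 w)"

definition Dprod :: "'v::euclidean_space set \<Rightarrow> ('i \<Rightarrow> 'v) \<Rightarrow> nat \<Rightarrow>
    'i::{finite,linorder} ratfun" where
  "Dprod \<Phi> \<alpha> q = (\<Prod>\<beta>\<in>positive_roots \<Phi> \<alpha>.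
     1 - of_nat q powi (height \<alpha> \<beta> - 1) * monomial \<alpha> (2 *\<^sub>R \<beta>))"

definition numerator :: "'v::euclidean_space set \<Rightarrow> ('i \<Rightarrow> 'v) \<Rightarrow> nat \<Rightarrow>
    'i::{finite,linorder} ratfun" where
  "numerator \<Phi> \<alpha> q = Dprod \<Phi> \<alpha> q * averaged \<Phi> \<alpha> q"


section \<open>The functional equations\<close>

text \<open>The coefficient \<open>a\<^sub>\<mu>\<close> of a polynomial, for \<open>\<mu>\<close> in the root lattice.\<close>

definition pcoeff :: "('i \<Rightarrow> 'v::euclidean_space) \<Rightarrow> 'i::{finite,linorder} mpoly \<Rightarrow>
    'v \<Rightarrow> complex" where
  "pcoeff \<alpha> p \<mu> = (if \<forall>i. root_coord \<alpha> \<mu> i \<ge> 0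
     then Poly_Mapping.lookup p (Poly_Mapping.Abs_poly_mapping (\<lambda>i. nat (root_coord \<alpha> \<mu> i)))
     else 0)"

definition phi :: "('i::finite \<Rightarrow> 'v::euclidean_space) \<Rightarrow> 'i \<Rightarrow> 'v \<Rightarrow> int" where
  "phi \<alpha> k \<mu> = (\<Sum>j | adjacent \<alpha> j k. root_coord \<alpha> \<mu> j)"

text \<open>The weight usually called \<open>\<lambda>\<close> is written \<open>\<nu>\<close>, since the former is reserved syntax.\<close>

definition functional_equations :: "('i \<Rightarrow> 'v::euclidean_space) \<Rightarrow> nat \<Rightarrow>
    'i::{finite,linorder} mpoly \<Rightarrow> bool" where
  "functional_equations \<alpha> q p \<longleftrightarrow>
     (\<forall>k. \<forall>\<nu>\<in>root_lattice \<alpha>. \<forall>\<mu>\<in>root_lattice \<alpha>.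
        \<mu> = reflect (\<alpha> k) \<nu> + \<alpha> k \<and> weight_ge \<alpha> \<mu> \<nu> \<longrightarrow>
        (let a = pcoeff \<alpha> p;
             \<beta> = \<nu> - \<mu> + \<alpha> k;
             q' = complex_of_nat q;
             c = complex_of_real (real q powr (real_of_int (height \<alpha> \<beta>) / 2))
         in (even (phi \<alpha> k \<mu>) \<longrightarrow>
               q' * a (\<nu> - \<alpha> k) + a \<nu> = c * (a \<mu> + a (\<mu> + \<alpha> k) / q')) \<and>
            (odd (phi \<alpha> k \<mu>) \<longrightarrow>
               q'^2 * a (\<nu> - 2 *\<^sub>R \<alpha> k) - a \<nu> =
                 complex_of_real (sqrt (real q)) * c * (a \<mu> - a (\<mu> + 2 *\<^sub>R \<alpha> k) / q'^2))))"

end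

theory Submission
  imports Defs
begin

text \<open>
  Let \<open>s\<close> be the positive square root of \<open>q\<close>, and rescale the monomials to
  \<open>y\<^sup>\<nu> = s\<^sup>d x\<^sup>\<nu>\<close>, where \<open>d\<close> is the height of \<open>\<nu>\<close>. Then \<open>\<sigma>\<^sub>k\<close> sends \<open>y\<^sup>\<nu>\<close> to the
  monomial with the reflected exponent, \<open>\<epsilon>\<^sub>k\<close> multiplies it by the sign \<open>(-1)\<close> to the power
  \<open>\<phi>\<^sub>k(\<nu>)\<close>, and a functional equation compares coefficients along one string
  \<open>\<nu> + \<int> \<alpha>\<^sub>k\<close>, in a way that is symmetric under \<open>\<rho> - \<nu> \<mapsto> \<sigma>\<^sub>k(\<rho> - \<nu>)\<close>.

  Uniqueness. Let \<open>a\<close> be a nonzero finitely supported solution of the functional equations and let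
  \<open>\<xi>\<close> be strictly dominant. Suppose that \<open>\<xi>\<close> is minimal on the support at \<open>\<nu>\<close>. If \<open>\<rho> - \<nu>\<close> paired
  nonpositively with some coroot, then the equation at the far end of the \<open>\<alpha>\<^sub>k\<close>-string through
  \<open>\<nu>\<close> would force either a support point with a smaller value of \<open>\<xi>\<close> or an equation
  \<open>-a = q a\<close> for a nonzero number \<open>a\<close> (\<open>FE_extremal\<close>). So \<open>\<rho> - \<nu>\<close> is regular dominant, that is,
  \<open>-\<nu>\<close> is dominant; if moreover \<open>\<nu>\<close> has nonnegative coordinates, then \<open>\<nu> = 0\<close>. Applied to the
  difference of two solutions with the same constant term this gives \<open>FE_unique\<close>. The same
  observation, with weights of \<open>V\<^sub>\<rho>\<close> in place of support points, shows that \<open>\<rho>\<close> is the only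
  regular dominant weight: all weights lie below \<open>\<rho>\<close>, because \<open>V\<^sub>\<rho>\<close> is generated from its
  highest weight vector by lowering operators (\<open>weights_below_highest\<close>).

  Existence. The operators \<open>f \<mapsto> f|\<sigma>\<^sub>k\<close> satisfy the relations of the Weyl group (an identity
  between explicit rational functions in two variables), hence by Matsumoto's theorem \<open>f|w\<close> depends
  only on \<open>w\<close>. As \<open>\<Delta>\<close> is invariant under all \<open>\<epsilon>\<^sub>k\<close>, the averaged function is the sum of
  \<open>(1/\<Delta>)|w\<close> over the group, and so it is invariant under every \<open>\<sigma>\<^sub>k\<close> (\<open>T_averaged\<close>). For
  \<open>N = D f\<close> the invariance is the system of functional equations, once \<open>N\<close> is known to be a
  Laurent polynomial. The denominator of \<open>f\<close> divides \<open>D \<Delta>\<close>, because the denominator of \<open>1|w\<close>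
  only involves the inversions of \<open>w\<close> (\<open>reduced_denominator\<close>). The factor of \<open>\<Delta>\<close> that belongs to
  a simple root cancels because \<open>u/(1 - y\<^sub>k\<^sup>2) + (u/(1 - y\<^sub>k\<^sup>2))|\<sigma>\<^sub>k\<close> has no pole along
  \<open>y\<^sub>k\<^sup>2 = 1\<close>, as for Demazure operators (\<open>Demazure\<close>); the invariance carries this to all roots
  (\<open>wall_regular_word\<close>), and \<open>N\<close> is a Laurent polynomial (\<open>Num_R\<close>). Finally, comparing leading terms in
  the direction \<open>\<rho>\<close>, every summand with \<open>w \<noteq> 1\<close> has positive order and the summand with \<open>w = 1\<close>
  starts with \<open>1\<close> (\<open>Num_leading\<close>). Hence any support point \<open>\<nu>\<close> of \<open>N\<close> with \<open>-\<nu>\<close> dominant is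
  \<open>0\<close>, and by the extremal argument every strictly dominant \<open>\<xi>\<close> is nonnegative on the
  support: \<open>N\<close> is a polynomial with constant term \<open>1\<close> (\<open>numerator_polynomial\<close>).
\<close>

section \<open>Reflections and coordinates\<close>

lemma reflect_add: "reflect \<beta> (x + y) = reflect \<beta> x + reflect \<beta> y"
  by (simp add: reflect_def inner_add_left add_divide_distrib distrib_left scaleR_add_left)

lemma reflect_scale: "reflect \<beta> (c *\<^sub>R x) = c *\<^sub>R reflect \<beta> x"
  by (simp add: reflect_def algebra_simps)

lemma linear_reflect: "linear (reflect \<beta>)"
  by (rule linearI) (simp_all add: reflect_add reflect_scale)

lemma reflect_self: "\<beta> \<noteq> 0 \<Longrightarrow> reflect \<beta> \<beta> = - \<beta>"
  by (simp add: reflect_def algebra_simps scaleR_2)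

lemma reflect_reflect: "\<beta> \<noteq> 0 \<Longrightarrow> reflect \<beta> (reflect \<beta> x) = x"
  by (simp add: reflect_def inner_diff_left algebra_simps)

lemma reflect_inner: "\<beta> \<noteq> 0 \<Longrightarrow> reflect \<beta> x \<bullet> reflect \<beta> y = x \<bullet> y"
  by (simp add: reflect_def inner_diff_left inner_diff_right field_simps inner_commute)

lemma reflect_uminus: "reflect (- \<beta>) = reflect \<beta>"
  by (rule ext) (simp add: reflect_def)

lemma reflect_conjugate:
  assumes "linear w" "\<And>x y. w x \<bullet> w y = x \<bullet> y"
  shows "reflect (w \<beta>) (w x) = w (reflect \<beta> x)"
  using assms(2) by (simp add: reflect_def linear_diff[OF assms(1)] linear_scale[OF assms(1)])

locale simply_laced_system =
  fixes \<Phi> :: "'v::euclidean_space set" and \<alpha> :: "'i::finite \<Rightarrow> 'v"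
  assumes red: "reduced_root_system \<Phi>" and simple: "simple_roots \<Phi> \<alpha>"
    and laced: "simply_laced \<alpha>"
begin

text \<open>Throughout, \<open>s k\<close> is the simple reflection, \<open>L\<close> the root lattice and \<open>W\<close> the Weyl
  group.\<close>

abbreviation "Pos \<equiv> positive_roots \<Phi> \<alpha>"
abbreviation "L \<equiv> root_lattice \<alpha>"
abbreviation "W \<equiv> weyl_group \<Phi>"
abbreviation "s k \<equiv> reflect (\<alpha> k)"

text \<open>The real coordinates with respect to the simple roots extend \<open>root_coord\<close>, which is only
  meaningful on the lattice, to a linear function on the whole space.\<close>

definition crd :: "'v \<Rightarrow> 'i \<Rightarrow> real" where
  "crd v i = representation (range \<alpha>) v (\<alpha> i)"

text \<open>The value of \<open>v\<close> on the coroot of \<open>\<alpha> k\<close>.\<close>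

definition pair :: "'v \<Rightarrow> 'i \<Rightarrow> real" where
  "pair v k = 2 * (v \<bullet> \<alpha> k) / (\<alpha> k \<bullet> \<alpha> k)"

lemma s_eq: "s k v = v - pair v k *\<^sub>R \<alpha> k"
  by (simp add: reflect_def pair_def)

lemma finite_roots: "finite \<Phi>" and zero_notin: "0 \<notin> \<Phi>"
  and root_reflect: "\<beta> \<in> \<Phi> \<Longrightarrow> \<gamma> \<in> \<Phi> \<Longrightarrow> reflect \<beta> \<gamma> \<in> \<Phi>"
  and root_int: "\<beta> \<in> \<Phi> \<Longrightarrow> \<gamma> \<in> \<Phi> \<Longrightarrow> 2 * (\<gamma> \<bullet> \<beta>) / (\<beta> \<bullet> \<beta>) \<in> \<int>"
  and span_roots: "span \<Phi> = UNIV"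
  and reducedD: "\<beta> \<in> \<Phi> \<Longrightarrow> c *\<^sub>R \<beta> \<in> \<Phi> \<Longrightarrow> c = 1 \<or> c = - 1"
  using red unfolding reduced_root_system_def root_system_def by auto

lemma inj_simple: "inj \<alpha>" and indep_simple: "independent (range \<alpha>)"
  and simple_root: "\<alpha> k \<in> \<Phi>"
  and pos_or_neg: "\<beta> \<in> \<Phi> \<Longrightarrow> \<beta> \<in> Pos \<or> - \<beta> \<in> Pos"
  using simple unfolding simple_roots_def by auto

lemma simple_nonzero: "\<alpha> k \<noteq> 0" using simple_root zero_notin by metis

lemma uminus_root: "\<beta> \<in> \<Phi> \<Longrightarrow> - \<beta> \<in> \<Phi>"
  using root_reflect[of \<beta> \<beta>] reflect_self[of \<beta>] zero_notin by metis

lemma pos_root: "\<beta> \<in> Pos \<Longrightarrow> \<beta> \<in> \<Phi>"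
  by (simp add: positive_roots_def)

lemma finite_Pos: "finite Pos"
  using finite_roots by (rule rev_finite_subset) (auto simp: pos_root)

lemma span_simple: "span (range \<alpha>) = UNIV"
proof -
  have "\<beta> \<in> span (range \<alpha>)" if "\<beta> \<in> Pos" for \<beta>
    using that unfolding positive_roots_def by (auto intro: span_sum span_scale span_base)
  then have "\<Phi> \<subseteq> span (range \<alpha>)"
    using pos_or_neg span_neg by (metis subsetI minus_minus)
  then show ?thesis
    using span_roots span_mono[of \<Phi> "span (range \<alpha>)"] by (auto simp: span_span)
qed

lemma crd_add: "crd (x + y) i = crd x i + crd y i"
  and crd_scale: "crd (c *\<^sub>R x) i = c * crd x i"
  and crd_diff: "crd (x - y) i = crd x i - crd y i"
  and crd_minus: "crd (- x) i = - crd x i"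
  unfolding crd_def using indep_simple span_simple
  by (simp_all add: representation_add representation_scale representation_diff representation_neg)

lemma crd_zero: "crd 0 i = 0" using crd_scale[of 0 0 i] by simp

lemma crd_sum: "crd (sum f A) i = (\<Sum>a\<in>A. crd (f a) i)"
  by (induction A rule: infinite_finite_induct) (auto simp: crd_zero crd_add)

lemma crd_simple: "crd (\<alpha> j) i = (if i = j then 1 else 0)"
  unfolding crd_def using indep_simple inj_simple
  by (auto simp: representation_basis inj_eq)

lemma crd_comb: "crd (\<Sum>i\<in>UNIV. c i *\<^sub>R \<alpha> i) j = c j"
  by (simp add: crd_sum crd_scale crd_simple if_distrib cong: if_cong)

lemma crd_expand: "v = (\<Sum>i\<in>UNIV. crd v i *\<^sub>R \<alpha> i)"
proof -
  have "(\<Sum>b\<in>range \<alpha>. representation (range \<alpha>) v b *\<^sub>R b) = v"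
    using indep_simple span_simple by (intro sum_representation_eq) auto
  then show ?thesis
    unfolding crd_def by (simp add: sum.reindex[OF inj_simple] o_def)
qed

lemma crd_eqI: "(\<And>i. crd v i = crd w i) \<Longrightarrow> v = w"
  by (metis (no_types, lifting) crd_expand sum.cong)

lemma lattice_iff: "v \<in> L \<longleftrightarrow> (\<forall>i. crd v i \<in> \<int>)"
proof
  assume "v \<in> L" then show "\<forall>i. crd v i \<in> \<int>"
    by (auto simp: root_lattice_def crd_comb)
next
  assume *: "\<forall>i. crd v i \<in> \<int>"
  have "v = (\<Sum>i\<in>UNIV. of_int \<lfloor>crd v i\<rfloor> *\<^sub>R \<alpha> i)"
    using crd_expand[of v] * by (simp add: Ints_def) 
  then show "v \<in> L" unfolding root_lattice_def by (intro image_eqI[of _ _ "\<lambda>i. \<lfloor>crd v i\<rfloor>"]) auto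
qed

lemma root_coord_eq: "v \<in> L \<Longrightarrow> of_int (root_coord \<alpha> v i) = crd v i"
proof -
  assume "v \<in> L"
  then obtain k :: "'i \<Rightarrow> int" where v: "v = (\<Sum>i\<in>UNIV. of_int (k i) *\<^sub>R \<alpha> i)"
    by (auto simp: root_lattice_def)
  have "root_coord \<alpha> v = k"
    unfolding root_coord_def
  proof (rule the_equality)
    fix k' :: "'i \<Rightarrow> int" assume "v = (\<Sum>i\<in>UNIV. of_int (k' i) *\<^sub>R \<alpha> i)"
    then have "crd v i = of_int (k' i)" for i by (simp add: crd_comb)
    moreover have "crd v i = of_int (k i)" for i using v by (simp add: crd_comb)
    ultimately show "k' = k" by (metis ext of_int_eq_iff)
  qed (rule v)
  then show ?thesis using v by (simp add: crd_comb)
qed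

lemma lattice_add: "x \<in> L \<Longrightarrow> y \<in> L \<Longrightarrow> x + y \<in> L"
  and lattice_diff: "x \<in> L \<Longrightarrow> y \<in> L \<Longrightarrow> x - y \<in> L"
  and lattice_minus: "x \<in> L \<Longrightarrow> - x \<in> L"
  and lattice_zero: "0 \<in> L"
  and lattice_scale: "x \<in> L \<Longrightarrow> c \<in> \<int> \<Longrightarrow> c *\<^sub>R x \<in> L"
  and lattice_simple: "\<alpha> k \<in> L"
  by (auto simp: lattice_iff crd_add crd_diff crd_minus crd_zero crd_scale crd_simple)

lemma lattice_sum: "(\<And>a. a \<in> A \<Longrightarrow> f a \<in> L) \<Longrightarrow> sum f A \<in> L"
  by (induction A rule: infinite_finite_induct) (auto simp: lattice_zero lattice_add)

lemma Pos_iff: "\<beta> \<in> Pos \<longleftrightarrow> \<beta> \<in> \<Phi> \<and> (\<forall>i. crd \<beta> i \<ge> 0)"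
proof -
  have *: "(\<forall>i. crd \<beta> i \<in> \<int> \<and> 0 \<le> crd \<beta> i)" if "\<beta> \<in> Pos" for \<beta>
    using that by (auto simp: positive_roots_def crd_comb)
  show ?thesis
  proof
    assume "\<beta> \<in> Pos" then show "\<beta> \<in> \<Phi> \<and> (\<forall>i. crd \<beta> i \<ge> 0)" using * pos_root by blast
  next
    assume b: "\<beta> \<in> \<Phi> \<and> (\<forall>i. crd \<beta> i \<ge> 0)"
    show "\<beta> \<in> Pos"
    proof (rule ccontr)
      assume n: "\<beta> \<notin> Pos"
      then have "- \<beta> \<in> Pos" using b pos_or_neg by blast
      from *[OF this] b have "crd \<beta> i = 0" for i
        by (metis crd_minus neg_0_le_iff_le order_antisym)
      then have "\<beta> = 0" by (intro crd_eqI) (simp add: crd_zero)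
      then show False using b zero_notin by auto
    qed
  qed
qed

lemma root_lattice_root: "\<beta> \<in> \<Phi> \<Longrightarrow> \<beta> \<in> L"
proof -
  have "\<beta> \<in> L" if "\<beta> \<in> Pos" for \<beta>
    using that by (auto simp: positive_roots_def lattice_iff crd_comb)
  then show "\<beta> \<in> \<Phi> \<Longrightarrow> \<beta> \<in> L" using pos_or_neg lattice_minus by (metis minus_minus)
qed

lemma nonpos_root: "\<beta> \<in> \<Phi> \<Longrightarrow> \<beta> \<notin> Pos \<Longrightarrow> crd \<beta> i \<le> 0"
  using pos_or_neg[of \<beta>] Pos_iff[of "- \<beta>"] by (auto simp: crd_minus)

lemma simple_Pos: "\<alpha> k \<in> Pos"
  by (simp add: Pos_iff simple_root crd_simple)

lemma minus_simple_not_Pos: "- \<alpha> k \<notin> Pos"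
  by (auto simp: Pos_iff crd_minus crd_simple)

lemma pos_not_minus: "\<beta> \<in> Pos \<Longrightarrow> - \<beta> \<notin> Pos"
proof
  assume "\<beta> \<in> Pos" "- \<beta> \<in> Pos"
  then have "crd \<beta> i = 0" for i by (auto simp: Pos_iff crd_minus intro: order_antisym)
  then have "\<beta> = 0" by (intro crd_eqI) (simp add: crd_zero)
  then show False using \<open>\<beta> \<in> Pos\<close> pos_root zero_notin by blast
qed

lemma pair_add: "pair (x + y) k = pair x k + pair y k"
  and pair_diff: "pair (x - y) k = pair x k - pair y k"
  and pair_scale: "pair (c *\<^sub>R x) k = c * pair x k"
  and pair_self: "pair (\<alpha> k) k = 2"
  and pair_zero: "pair 0 k = 0"
  using simple_nonzero[of k]
  by (simp_all add: pair_def inner_add_left inner_diff_left add_divide_distrib diff_divide_distrib distrib_left right_diff_distrib)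

lemma pair_sum: "pair (sum f A) k = (\<Sum>a\<in>A. pair (f a) k)"
  by (induction A rule: infinite_finite_induct) (auto simp: pair_zero pair_add)

lemma s_s: "s k (s k v) = v" by (rule reflect_reflect[OF simple_nonzero])

lemma s_comp_s: "s k \<circ> s k = id" by (rule ext) (simp add: s_s)

lemma s_self: "s k (\<alpha> k) = - \<alpha> k" by (rule reflect_self[OF simple_nonzero])

lemma s_add: "s k (x + y) = s k x + s k y" by (rule reflect_add)
lemma s_scale: "s k (c *\<^sub>R x) = c *\<^sub>R s k x" by (rule reflect_scale)
lemma s_diff: "s k (x - y) = s k x - s k y" by (rule linear_diff[OF linear_reflect])
lemma s_minus: "s k (- x) = - s k x" by (rule linear_neg[OF linear_reflect])
lemma inner_pair: "v \<bullet> \<alpha> k = pair v k * (\<alpha> k \<bullet> \<alpha> k) / 2"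
  using simple_nonzero[of k] by (simp add: pair_def)

text \<open>Two distinct simple roots never make an acute angle, since a reflected simple root \<open>\<alpha> b - c \<alpha> a\<close> has
  the positive coordinate \<open>1\<close> and is therefore a positive root. So both Cartan integers are
  nonpositive, and their product is at most \<open>1\<close> in the simply-laced case.\<close>

lemma pair_simple:
  assumes "j \<noteq> k"
  shows "pair (\<alpha> j) k = (if adjacent \<alpha> j k then - 1 else 0)"
proof -
  have np: "pair (\<alpha> b) a \<le> 0" if "a \<noteq> b" for a b
  proof -
    have r: "s a (\<alpha> b) \<in> \<Phi>" using simple_root root_reflect by blast
    have "crd (s a (\<alpha> b)) b = 1" using that by (simp add: s_eq crd_diff crd_scale crd_simple)
    then have "s a (\<alpha> b) \<in> Pos" using nonpos_root[OF r, of b] by fastforce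
    then have "0 \<le> crd (s a (\<alpha> b)) a" by (simp add: Pos_iff)
    then show ?thesis using that by (simp add: s_eq crd_diff crd_scale crd_simple)
  qed
  have int: "pair (\<alpha> b) a \<in> \<int>" for a b
    using root_int[OF simple_root simple_root] by (simp add: pair_def)
  have e: "dynkin_edges \<alpha> j k = pair (\<alpha> j) k * pair (\<alpha> k) j"
    by (simp add: dynkin_edges_def pair_def)
  have le: "dynkin_edges \<alpha> j k \<le> 1" using laced assms by (auto simp: simply_laced_def)
  obtain a b :: int where ab: "pair (\<alpha> j) k = of_int a" "pair (\<alpha> k) j = of_int b"
    using int by (metis Ints_cases)
  have ab0: "a \<le> 0" "b \<le> 0" using np[OF assms] np[OF assms[symmetric]] ab by auto
  have "a = 0 \<longleftrightarrow> b = 0"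
  proof -
    have "pair (\<alpha> j) k = 0 \<longleftrightarrow> pair (\<alpha> k) j = 0"
      using simple_nonzero by (auto simp: pair_def inner_commute)
    then show ?thesis using ab by simp
  qed
  moreover have "a * b \<le> 1" using le e ab by (metis of_int_1_less_iff of_int_mult not_le)
  moreover have "a = - 1" if "a < 0" "b < 0" "a * b \<le> 1"
  proof (rule ccontr)
    assume "a \<noteq> - 1" then have "2 \<le> - a" "1 \<le> - b" using that by auto
    then have "2 * 1 \<le> (- a) * (- b)" by (intro mult_mono) auto
    then show False using that by simp
  qed
  ultimately have "a = 0 \<and> b = 0 \<or> a = - 1 \<and> b < 0" using ab0 by fastforce
  then show ?thesis
    using e ab assms by (auto simp: adjacent_def)
qed

lemma adjacent_sym: "adjacent \<alpha> i j \<longleftrightarrow> adjacent \<alpha> j i"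
  by (auto simp: adjacent_def dynkin_edges_def mult.commute)

lemma adjacent_irrefl: "\<not> adjacent \<alpha> i i"
  by (simp add: adjacent_def)

lemma s_simple:
  "s k (\<alpha> j) = (if adjacent \<alpha> k j then \<alpha> j + \<alpha> k else if j = k then - \<alpha> k else \<alpha> j)"
  using pair_simple[of j k] pair_self[of k] adjacent_irrefl adjacent_sym[of k j]
  by (auto simp: s_eq scaleR_2)

text \<open>On the lattice the coroot of \<open>\<alpha> k\<close> and \<open>\<phi>\<^sub>k\<close> have the same parity. This is what
  links the two types of functional equation to reflections.\<close>

lemma pair_eq: "v \<in> L \<Longrightarrow> pair v k = of_int (2 * root_coord \<alpha> v k - phi \<alpha> k v)"
proof -
  assume v: "v \<in> L"
  have "pair v k = (\<Sum>i\<in>UNIV. crd v i * pair (\<alpha> i) k)"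
    using arg_cong[OF crd_expand[of v], of "\<lambda>v. pair v k"] by (simp only: pair_sum pair_scale)
  also have "\<dots> = crd v k * 2 + (\<Sum>i\<in>UNIV - {k}. crd v i * pair (\<alpha> i) k)"
    by (simp add: sum.remove[of _ k] pair_self)
  also have "(\<Sum>i\<in>UNIV - {k}. crd v i * pair (\<alpha> i) k) = (\<Sum>i\<in>UNIV - {k}. if adjacent \<alpha> i k then - crd v i else 0)"
    by (rule sum.cong) (auto simp: pair_simple)
  also have "\<dots> = (\<Sum>i | adjacent \<alpha> i k. - crd v i)"
    by (rule sum.mono_neutral_cong_right) (auto simp: adjacent_irrefl)
  also have "\<dots> = - of_int (phi \<alpha> k v)"
    by (simp add: phi_def sum_negf root_coord_eq[OF v])
  finally show ?thesis by (simp add: root_coord_eq[OF v])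
qed

lemma pair_Ints: "v \<in> L \<Longrightarrow> pair v k \<in> \<int>" by (simp add: pair_eq)

lemma s_lattice: "v \<in> L \<Longrightarrow> s k v \<in> L"
  by (simp add: s_eq lattice_diff lattice_scale pair_Ints lattice_simple)

lemma crd_s: "i \<noteq> k \<Longrightarrow> crd (s k v) i = crd v i"
  by (simp add: s_eq crd_diff crd_scale crd_simple)

lemma s_root: "\<beta> \<in> \<Phi> \<Longrightarrow> s k \<beta> \<in> \<Phi>" by (simp add: root_reflect simple_root)

text \<open>A positive root other than \<open>\<alpha> k\<close> has a positive coordinate away from \<open>k\<close>, because the root
  system is reduced; the reflection \<open>s k\<close> leaves that coordinate unchanged.\<close>

lemma s_Pos:
  assumes "\<beta> \<in> Pos" "\<beta> \<noteq> \<alpha> k" shows "s k \<beta> \<in> Pos"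
proof -
  have "\<exists>i. i \<noteq> k \<and> crd \<beta> i \<noteq> 0"
  proof (rule ccontr)
    assume "\<not> ?thesis"
    then have "\<beta> = crd \<beta> k *\<^sub>R \<alpha> k" by (intro crd_eqI) (auto simp: crd_scale crd_simple)
    then have "crd \<beta> k = 1 \<or> crd \<beta> k = - 1"
      using reducedD[OF simple_root] pos_root[OF assms(1)] by metis
    then show False using \<open>\<beta> = _\<close> assms Pos_iff by (metis pos_not_minus scaleR_minus1_left scaleR_one simple_Pos)
  qed
  then obtain i where "i \<noteq> k" "crd \<beta> i > 0"
    using assms(1) unfolding Pos_iff by (metis order_le_less)
  then show ?thesis
    using nonpos_root[of "s k \<beta>" i] crd_s[of i k \<beta>] s_root[OF pos_root[OF assms(1)]] by fastforce
qed

lemma s_Pos_image: "s k ` (Pos - {\<alpha> k}) = Pos - {\<alpha> k}"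
proof -
  have st: "s k \<beta> \<in> Pos - {\<alpha> k}" if "\<beta> \<in> Pos - {\<alpha> k}" for \<beta>
  proof -
    have "s k \<beta> \<noteq> \<alpha> k"
    proof
      assume "s k \<beta> = \<alpha> k"
      then have "\<beta> = - \<alpha> k" using s_s[of k \<beta>] s_self by simp
      then show False using that minus_simple_not_Pos by simp
    qed
    then show ?thesis using s_Pos that by simp
  qed
  have "\<beta> \<in> s k ` (Pos - {\<alpha> k})" if "\<beta> \<in> Pos - {\<alpha> k}" for \<beta>
    using st[OF that] by (intro image_eqI[of _ _ "s k \<beta>"]) (simp_all only: s_s)
  then show ?thesis using st by (intro equalityI image_subsetI subsetI) simp_all
qed

lemma inj_s: "inj_on (s k) A" by (rule inj_on_inverseI[of _ "s k"]) (rule s_s)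

lemma s_rho: "s k (rho \<Phi> \<alpha>) = rho \<Phi> \<alpha> - \<alpha> k"
proof -
  have d: "sum (\<lambda>x. x) Pos = \<alpha> k + sum (\<lambda>x. x) (Pos - {\<alpha> k})"
    by (rule sum.remove[OF finite_Pos simple_Pos])
  have "s k (sum (\<lambda>x. x) (Pos - {\<alpha> k})) = sum (s k) (Pos - {\<alpha> k})"
    using linear_sum[OF linear_reflect, of "\<alpha> k" "\<lambda>x. x" "Pos - {\<alpha> k}"] by simp
  also have "\<dots> = sum (\<lambda>x. x) (s k ` (Pos - {\<alpha> k}))" by (simp add: sum.reindex[OF inj_s])
  finally show ?thesis
    unfolding rho_def d s_Pos_image
    by (simp add: s_scale s_add s_self algebra_simps scaleR_2[symmetric] flip: scaleR_add_left)
qed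

lemma pair_rho: "pair (rho \<Phi> \<alpha>) k = 1"
proof -
  have "pair (rho \<Phi> \<alpha>) k *\<^sub>R \<alpha> k = 1 *\<^sub>R \<alpha> k" using s_rho[of k] by (simp add: s_eq)
  then show ?thesis using simple_nonzero by (metis scaleR_right_imp_eq)
qed

lemma inner_expand: "v \<bullet> w = (\<Sum>i\<in>UNIV. crd w i * (v \<bullet> \<alpha> i))"
proof -
  have "v \<bullet> w = v \<bullet> (\<Sum>i\<in>UNIV. crd w i *\<^sub>R \<alpha> i)" using crd_expand by simp
  then show ?thesis by (simp add: inner_sum_right)
qed

lemma inner_rho_Pos: "\<beta> \<in> Pos \<Longrightarrow> rho \<Phi> \<alpha> \<bullet> \<beta> > 0"
proof -
  assume b: "\<beta> \<in> Pos"
  have nn: "0 < rho \<Phi> \<alpha> \<bullet> \<alpha> i" for i 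
  proof -
    have "\<alpha> i \<bullet> \<alpha> i > 0" using simple_nonzero[of i] by simp
    then show ?thesis using inner_pair[of "rho \<Phi> \<alpha>" i] unfolding pair_rho by linarith
  qed
  have "\<beta> \<noteq> 0" using b pos_root zero_notin by metis
  then have "\<exists>i. crd \<beta> i \<noteq> 0" using crd_eqI[of \<beta> 0] by (metis crd_zero)
  then obtain i where i: "crd \<beta> i > 0" using b unfolding Pos_iff by (metis order_le_less)
  have "crd \<beta> j * (rho \<Phi> \<alpha> \<bullet> \<alpha> j) \<ge> 0" for j using b nn[of j] by (simp add: Pos_iff)
  moreover have "crd \<beta> i * (rho \<Phi> \<alpha> \<bullet> \<alpha> i) > 0" using i nn by simp
  ultimately show ?thesis
    unfolding inner_expand[of _ \<beta>] by (intro sum_pos2[where i = i]) simp_all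
qed

section \<open>The Weyl group, inversions and reduced words\<close>

abbreviation "wp \<equiv> word_prod \<alpha>"

lemma wp_Nil: "wp [] = id" and wp_Cons: "wp (i # is) = s i \<circ> wp is"
  by (simp_all add: word_prod_def)

lemma wp_append: "wp (is @ js) = wp is \<circ> wp js"
  by (induction "is") (auto simp: wp_Nil wp_Cons)

lemma wp_snoc: "wp (is @ [k]) = wp is \<circ> s k" by (simp add: wp_append wp_Cons wp_Nil)

lemma wp_linear: "linear (wp is)"
  by (induction "is") (simp_all only: wp_Nil wp_Cons linear_compose linear_reflect linear_id)

lemma wp_inner: "wp is x \<bullet> wp is y = x \<bullet> y"
  by (induction "is") (auto simp: wp_Nil wp_Cons reflect_inner simple_nonzero)

lemma wp_root: "\<beta> \<in> \<Phi> \<Longrightarrow> wp is \<beta> \<in> \<Phi>"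
  by (induction "is") (auto simp: wp_Nil wp_Cons s_root)

lemma wp_rev: "wp (rev is) (wp is v) = v"
  by (induction "is" arbitrary: v) (auto simp: wp_Nil wp_Cons wp_append s_s)

lemma wp_rev': "wp is (wp (rev is) v) = v" using wp_rev[of "rev is"] by simp

text \<open>Induction on the height: a positive root has a positive inner product with some simple root, and
  reflecting in that root lowers the height.\<close>

lemma Pos_conjugate_simple:
  assumes "\<beta> \<in> Pos" shows "\<exists>is i. \<beta> = wp is (\<alpha> i)"
proof -
  have "\<And>\<beta>. \<beta> \<in> Pos \<Longrightarrow> (\<Sum>i\<in>UNIV. crd \<beta> i) \<le> real n \<Longrightarrow> \<exists>is i. \<beta> = wp is (\<alpha> i)" for n
  proof (induction n)
    case (0 \<beta>)
    then have "(\<Sum>i\<in>UNIV. crd \<beta> i) = 0" by (intro order_antisym) (auto simp: Pos_iff intro: sum_nonneg)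
    then have "crd \<beta> i = 0" for i
      using "0"(1) by (subst (asm) sum_nonneg_eq_0_iff) (auto simp: Pos_iff)
    then have "\<beta> = 0" by (intro crd_eqI) (simp add: crd_zero)
    then show ?case using "0"(1) pos_root zero_notin by blast
  next
    case (Suc n \<beta>)
    show ?case
    proof (cases "\<exists>i. \<beta> = \<alpha> i")
      case True then show ?thesis by (metis wp_Nil id_apply)
    next
      case False
      have "\<beta> \<noteq> 0" using Suc(2) pos_root zero_notin by blast
      then have "0 < \<beta> \<bullet> \<beta>" by simp
      then have "\<exists>i. crd \<beta> i * (\<beta> \<bullet> \<alpha> i) > 0"
        unfolding inner_expand[of \<beta> \<beta>] by (meson not_less sum_nonpos)
      then obtain i where i: "\<beta> \<bullet> \<alpha> i > 0" using Suc(2) by (metis Pos_iff zero_less_mult_pos mult_nonneg_nonpos not_less)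
      then have "pair \<beta> i > 0" using simple_nonzero[of i] by (simp add: pair_def)
      then have p1: "pair \<beta> i \<ge> 1"
        using pair_Ints[OF root_lattice_root[OF pos_root[OF Suc(2)]], of i] by (auto elim!: Ints_cases)
      have P: "s i \<beta> \<in> Pos" using s_Pos Suc(2) False by blast
      have "(\<Sum>j\<in>UNIV. crd (s i \<beta>) j) = (\<Sum>j\<in>UNIV. crd \<beta> j) - pair \<beta> i"
      proof -
        have "crd (s i \<beta>) j = crd \<beta> j - (if j = i then pair \<beta> i else 0)" for j
          by (simp add: s_eq crd_diff crd_scale crd_simple)
        then show ?thesis by (simp add: sum_subtractf del: if_split)
      qed
      then have "(\<Sum>j\<in>UNIV. crd (s i \<beta>) j) \<le> real n" using Suc(3) p1 by simp
      from Suc.IH[OF P this] obtain "is" j where "s i \<beta> = wp is (\<alpha> j)" by blast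
      then have "\<beta> = wp (i # is) (\<alpha> j)" by (metis wp_Cons o_apply s_s)
      then show ?thesis by blast
    qed
  qed
  then show ?thesis using assms real_arch_simple by blast
qed

lemma Weyl_iff: "w \<in> W \<longleftrightarrow> (\<exists>is. w = wp is)"
proof
  have refl: "\<exists>is. reflect \<beta> = wp is" if "\<beta> \<in> \<Phi>" for \<beta>
  proof -
    have "\<exists>is. reflect \<beta> = wp is" if b: "\<beta> \<in> Pos" for \<beta>
    proof -
      obtain "is" i where b: "\<beta> = wp is (\<alpha> i)" using Pos_conjugate_simple[OF b] by blast
      have "reflect \<beta> x = wp (is @ [i] @ rev is) x" for x
        using reflect_conjugate[OF wp_linear wp_inner, of "is" "\<alpha> i" "wp (rev is) x"]
        by (simp add: b wp_rev' wp_append wp_Cons wp_Nil)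
      then show ?thesis by blast
    qed
    then show ?thesis using pos_or_neg[OF that] reflect_uminus by metis
  qed
  show "\<exists>is. w = wp is" if "w \<in> W"
    using that
  proof induction
    case weyl_id then show ?case by (metis wp_Nil)
  next
    case (weyl_reflect \<beta> w) then show ?case using refl by (metis wp_append)
  qed
next
  have "wp is \<in> W" for "is"
    by (induction "is") (simp_all only: wp_Nil wp_Cons simple_root weyl_group.intros)
  then show "\<exists>is. w = wp is \<Longrightarrow> w \<in> W" by blast
qed

lemma word_of: "w \<in> W \<Longrightarrow> wp (word_of \<alpha> w) = w"
  unfolding word_of_def using Weyl_iff by (metis (mono_tags, lifting) someI_ex)

definition inversions :: "('v \<Rightarrow> 'v) \<Rightarrow> 'v set" where
  "inversions w = {\<beta> \<in> Pos. w \<beta> \<notin> Pos}"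

lemma finite_inv: "finite (inversions w)" using finite_Pos by (simp add: inversions_def)

lemma inversions_id: "inversions id = {}" by (simp add: inversions_def)

text \<open>The reflection \<open>s k\<close> only exchanges \<open>\<alpha> k\<close> with its negative and permutes the other positive roots,
  so right multiplication by it changes the number of inversions by exactly one.\<close>

lemma inv_up:
  assumes "wp is (\<alpha> k) \<in> Pos"
  shows "inversions (wp is \<circ> s k) = insert (\<alpha> k) (s k ` inversions (wp is))" "\<alpha> k \<notin> s k ` inversions (wp is)"
proof -
  have "\<alpha> k \<notin> inversions (wp is)" using assms by (simp add: inversions_def)
  then have sub: "inversions (wp is) \<subseteq> Pos - {\<alpha> k}" by (auto simp: inversions_def)
  have "wp is (s k (\<alpha> k)) \<notin> Pos"
    using assms pos_not_minus by (simp add: s_self linear_neg[OF wp_linear])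
  moreover have eq: "\<beta> \<in> inversions (wp is \<circ> s k) \<longleftrightarrow> \<beta> \<in> s k ` inversions (wp is)" if "\<beta> \<noteq> \<alpha> k" for \<beta>
  proof
    assume "\<beta> \<in> inversions (wp is \<circ> s k)"
    then have "s k \<beta> \<in> inversions (wp is)" using that s_Pos by (auto simp: inversions_def)
    then show "\<beta> \<in> s k ` inversions (wp is)" by (metis image_eqI s_s)
  next
    assume "\<beta> \<in> s k ` inversions (wp is)"
    then obtain \<gamma> where g: "\<gamma> \<in> inversions (wp is)" "\<beta> = s k \<gamma>" by blast
    then have "\<beta> \<in> Pos" using sub s_Pos by blast
    then show "\<beta> \<in> inversions (wp is \<circ> s k)" using g by (auto simp: inversions_def s_s)
  qed
  moreover show "\<alpha> k \<notin> s k ` inversions (wp is)"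
    using sub s_Pos_image[of k] by (metis Diff_iff image_mono insertI1 subsetD)
  ultimately have "\<alpha> k \<in> inversions (wp is \<circ> s k)" by (simp add: inversions_def simple_Pos)
  show "inversions (wp is \<circ> s k) = insert (\<alpha> k) (s k ` inversions (wp is))"
  proof (rule set_eqI)
    fix \<beta> show "\<beta> \<in> inversions (wp is \<circ> s k) \<longleftrightarrow> \<beta> \<in> insert (\<alpha> k) (s k ` inversions (wp is))"
      using eq[of \<beta>] \<open>\<alpha> k \<in> inversions (wp is \<circ> s k)\<close> by (cases "\<beta> = \<alpha> k") simp_all
  qed
qed

text \<open>By \<open>reduced_word\<close> this is the length function of the Coxeter group.\<close>

definition len :: "('v \<Rightarrow> 'v) \<Rightarrow> nat" where "len w = card (inversions w)"

lemma len_up: "wp is (\<alpha> k) \<in> Pos \<Longrightarrow> len (wp is \<circ> s k) = Suc (len (wp is))"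
  using inv_up[of "is" k] by (simp add: len_def finite_inv card_image[OF inj_s])

lemma len_down:
  assumes "wp is (\<alpha> k) \<notin> Pos" shows "len (wp is) = Suc (len (wp is \<circ> s k))"
proof -
  have "- wp is (\<alpha> k) \<in> Pos" using assms pos_or_neg[OF wp_root[OF simple_root]] by blast
  then have "wp (is @ [k]) (\<alpha> k) \<in> Pos" by (simp add: wp_snoc s_self linear_neg[OF wp_linear])
  from len_up[OF this] show ?thesis by (simp add: wp_snoc o_assoc[symmetric] s_comp_s)
qed

text \<open>The root \<open>\<alpha> k\<close> becomes negative at some letter \<open>i\<close> of the word; there the image of \<open>\<alpha> k\<close> under the
  remaining letters is \<open>\<alpha> i\<close>, so that multiplying by \<open>s k\<close> amounts to deleting this letter.\<close>

lemma exchange: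
  "wp is (\<alpha> k) \<notin> Pos \<Longrightarrow> \<exists>js. Suc (length js) = length is \<and> wp js = wp is \<circ> s k"
proof (induction "is")
  case Nil then show ?case by (simp add: wp_Nil simple_Pos)
next
  case (Cons i "is")
  show ?case
  proof (cases "wp is (\<alpha> k) \<in> Pos")
    case False
    then obtain js where "Suc (length js) = length is" "wp js = wp is \<circ> s k" using Cons.IH by blast
    then have "Suc (length (i # js)) = length (i # is) \<and> wp (i # js) = wp (i # is) \<circ> s k"
      by (simp add: wp_Cons o_assoc)
    then show ?thesis by blast
  next
    case True
    have e: "wp is (\<alpha> k) = \<alpha> i" using s_Pos[OF True] Cons.prems by (auto simp: wp_Cons)
    have "s i (wp is x) = wp is (s k x)" for x
      using reflect_conjugate[OF wp_linear wp_inner, of "is" "\<alpha> k" x] by (simp add: e)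
    then have "wp is = wp (i # is) \<circ> s k"
      by (auto simp: wp_Cons fun_eq_iff) (metis s_s)
    then show ?thesis by (metis length_Cons)
  qed
qed

lemma len_le: "len (wp is) \<le> length is"
proof (induction "is" rule: rev_induct)
  case Nil then show ?case by (simp only: wp_Nil len_def inversions_id card.empty)
next
  case (snoc k "is")
  then show ?case
    using len_up[of "is" k] len_down[of "is" k] unfolding wp_snoc length_append_singleton
    by (cases "wp is (\<alpha> k) \<in> Pos") linarith+
qed

lemma reduced_word: "\<exists>js. wp js = wp is \<and> length js = len (wp is)"
proof (induction "is" rule: rev_induct)
  case Nil then show ?case
    by (intro exI[of _ "[]"]) (simp only: wp_Nil len_def inversions_id card.empty list.size simp_thms)
next
  case (snoc k "is")
  then obtain js where js: "wp js = wp is" "length js = len (wp is)" by blast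
  show ?case
  proof (cases "wp is (\<alpha> k) \<in> Pos")
    case True
    then have "wp (js @ [k]) = wp (is @ [k]) \<and> length (js @ [k]) = len (wp (is @ [k]))"
      using js by (simp add: wp_snoc len_up)
    then show ?thesis by blast
  next
    case False
    then obtain ks where ks: "Suc (length ks) = length js" "wp ks = wp js \<circ> s k"
      using exchange[of js k] js by auto
    then have "length ks = len (wp (is @ [k]))" using len_down[OF False] js by (simp add: wp_snoc)
    then show ?thesis using ks js by (metis wp_snoc)
  qed
qed

lemma len_zero: "len (wp is) = 0 \<Longrightarrow> wp is = id"
  using reduced_word[of "is"] wp_Nil by (metis length_0_conv)

lemma finite_W: "finite W"
proof -
  have "W \<subseteq> wp ` {is. set is \<subseteq> UNIV \<and> length is \<le> card Pos}"
  proof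
    fix w assume "w \<in> W"
    then obtain js where "wp js = w" "length js = len w" using Weyl_iff reduced_word by metis
    moreover have "len w \<le> card Pos" unfolding len_def by (rule card_mono[OF finite_Pos]) (auto simp: inversions_def)
    ultimately show "w \<in> wp ` {is. set is \<subseteq> UNIV \<and> length is \<le> card Pos}" by auto
  qed
  then show ?thesis
    by (rule finite_subset) (rule finite_imageI[OF finite_lists_length_le[OF finite]])
qed

text \<open>An element that fixes \<open>\<rho>\<close> preserves the inner product with \<open>\<rho>\<close>, whose sign tells positive from
  negative roots; it has no inversions.\<close>

lemma regular_rho: "w \<in> W \<Longrightarrow> w (rho \<Phi> \<alpha>) = rho \<Phi> \<alpha> \<Longrightarrow> w = id"
proof -
  assume w: "w \<in> W" "w (rho \<Phi> \<alpha>) = rho \<Phi> \<alpha>"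
  then obtain "is" where i: "w = wp is" using Weyl_iff by blast
  have "inversions w = {}"
  proof (rule ccontr)
    assume "inversions w \<noteq> {}"
    then obtain \<beta> where b: "\<beta> \<in> Pos" "w \<beta> \<notin> Pos" by (auto simp: inversions_def)
    then have "- w \<beta> \<in> Pos" using pos_or_neg wp_root i pos_root by blast
    then have "rho \<Phi> \<alpha> \<bullet> w \<beta> < 0" using inner_rho_Pos by fastforce
    moreover have "rho \<Phi> \<alpha> \<bullet> w \<beta> = rho \<Phi> \<alpha> \<bullet> \<beta>" using w(2) wp_inner i by metis
    ultimately show False using inner_rho_Pos[OF b(1)] by simp
  qed
  then show "w = id" using len_zero i by (simp add: len_def)
qed

lemma s_commute: "k \<noteq> l \<Longrightarrow> \<not> adjacent \<alpha> k l \<Longrightarrow> s k (s l v) = s l (s k v)"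
proof -
  assume a: "k \<noteq> l" "\<not> adjacent \<alpha> k l"
  then have "pair (\<alpha> l) k = 0" "pair (\<alpha> k) l = 0" using pair_simple adjacent_sym by auto
  then show ?thesis by (simp add: s_eq pair_diff pair_scale)
qed

lemma s_braid: "adjacent \<alpha> k l \<Longrightarrow> s k (s l (s k v)) = s l (s k (s l v))"
proof -
  assume a: "adjacent \<alpha> k l"
  then have "k \<noteq> l" by (auto simp: adjacent_def)
  then have "pair (\<alpha> l) k = - 1" "pair (\<alpha> k) l = - 1" using a pair_simple adjacent_sym by auto
  then show ?thesis by (simp add: s_eq pair_add pair_diff pair_scale pair_self algebra_simps)
qed

text \<open>Operators that satisfy the quadratic and the braid relations define an action of the Weyl group.
  The heart is that two reduced words of the same element \<open>w\<close> act alike, by induction on the length: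
  if they end in different letters \<open>k\<close> and \<open>l\<close>, then \<open>w\<close> has a reduced word ending in the
  longest word of the dihedral group of \<open>k\<close> and \<open>l\<close>, in either of its two forms, which a braid
  relation exchanges. Arbitrary words are then reduced letter by letter with the quadratic relation.\<close>

lemma Matsumoto:
  fixes T :: "'i \<Rightarrow> 'x \<Rightarrow> 'x"
  assumes inv: "\<And>k x. T k (T k x) = x"
    and comm: "\<And>k l x. k \<noteq> l \<Longrightarrow> \<not> adjacent \<alpha> k l \<Longrightarrow> T k (T l x) = T l (T k x)"
    and braid: "\<And>k l x. adjacent \<alpha> k l \<Longrightarrow> T k (T l (T k x)) = T l (T k (T l x))"
    and eq: "wp is = wp js"
  shows "fold T is = fold T js"
proof -
  have app: "fold T (is @ [k]) = T k \<circ> fold T is" for "is" k by simp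
  have red: "fold T is = fold T js"
    if "length is = n" "length is = len (wp is)" "length js = len (wp js)" "wp is = wp js" for n "is" js
    using that
  proof (induction n arbitrary: "is" js rule: less_induct)
    case (less n)
    define w where "w = wp is"
    have w: "wp js = w" "length is = len w" "length js = len w" "len w = n" using less.prems w_def by auto
    show ?case
    proof (cases n)
      case 0 then show ?thesis using w by simp
    next
      case (Suc m)
      then obtain u k v l where uv: "is = u @ [k]" "js = v @ [l]"
        using w by (metis length_0_conv nat.distinct(1) rev_exhaust)
      have wu: "wp u \<circ> s k = w" "wp v \<circ> s l = w" using uv w w_def by (auto simp: wp_snoc)
      have u: "wp u = w \<circ> s k" "wp v = w \<circ> s l"
        using wu by (metis o_assoc s_comp_s comp_id)+
      have desc: "wp x (\<alpha> a) \<notin> Pos"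
        if "wp x = w" "wp y = w \<circ> s a" "Suc (length y) = len w" for x y a
      proof
        assume "wp x (\<alpha> a) \<in> Pos"
        from len_up[OF this] that have "len (wp y) = Suc (len w)" by simp
        then show False using len_le[of y] that by simp
      qed
      have lu: "Suc (length u) = len w" "Suc (length v) = len w" using uv w by auto
      have nk: "w (\<alpha> k) \<notin> Pos" and nl: "w (\<alpha> l) \<notin> Pos"
        using desc[of "is" u k] desc[of "is" v l] u lu w_def by auto
      have ru: "length u = len (wp u)" "length v = len (wp v)"
        using len_down[of "is" k] len_down[of "is" l] nk nl lu u w_def by auto
      have IH: "fold T x = fold T y" if "wp x = wp y" "length x = m" "length y = m" "len (wp x) = m" for x y
        using less.IH[of m x y] that Suc by simp
      have m: "length u = m" "length v = m" using lu w Suc by auto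
      (* descents k and l of w: cancel the common last letter, or pass through the dihedral coset *)
      consider (eq) "k = l" | (comm) "k \<noteq> l" "\<not> adjacent \<alpha> k l" | (braid) "adjacent \<alpha> k l" by blast
      then show ?thesis
      proof cases
        case eq
        then show ?thesis using IH[of u v] u m ru uv by (simp add: app)
      next
        case comm
        have "pair (\<alpha> l) k = 0" using pair_simple[of l k] comm adjacent_sym by auto
        then have "wp u (\<alpha> l) \<notin> Pos" using nl u by (simp add: s_eq)
        then have l2: "len (wp u) = Suc (len (wp (u @ [l])))" by (simp add: len_down wp_snoc)
        obtain r where r: "wp r = wp (u @ [l])" "length r = len (wp (u @ [l]))" using reduced_word by blast
        have r1: "wp (r @ [l]) = wp u" using r by (simp add: wp_snoc o_assoc[symmetric] s_comp_s)
        have "wp (r @ [k]) x = wp v x" for x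
          using comm by (simp add: wp_snoc r u s_commute[of k l] s_s)
        then have r2: "wp (r @ [k]) = wp v" by auto
        have "fold T u = fold T (r @ [l])" using IH[of u "r @ [l]"] r1 r l2 ru m by simp
        moreover have "fold T v = fold T (r @ [k])" using IH[of v "r @ [k]"] r2 r l2 ru m by simp
        ultimately show ?thesis using uv assms(2)[OF comm] by (simp add: fun_eq_iff)
      next
        case braid
        then have kl: "k \<noteq> l" by (auto simp: adjacent_def)
        have pr: "pair (\<alpha> l) k = - 1" "pair (\<alpha> k) l = - 1"
          using pair_simple[of l k] pair_simple[of k l] braid kl adjacent_sym by auto
        have neg: "wp x \<beta> \<notin> Pos" if "wp x (\<beta> - \<gamma>) \<notin> Pos" "wp x \<gamma> \<notin> Pos" "\<gamma> \<in> \<Phi>" "\<beta> - \<gamma> \<in> \<Phi>" for x \<beta> \<gamma>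
        proof
          assume p: "wp x \<beta> \<in> Pos"
          have "crd (wp x \<beta>) i = crd (wp x (\<beta> - \<gamma>)) i + crd (wp x \<gamma>) i" for i
            by (simp add: linear_diff[OF wp_linear] crd_diff)
          then have "crd (wp x \<beta>) i \<le> 0" for i
            using nonpos_root[OF wp_root that(1)] nonpos_root[OF wp_root that(2)] that(3,4)
            by (metis add_nonpos_nonpos)
          then have "crd (wp x \<beta>) i = 0" for i using p by (simp add: Pos_iff order_antisym)
          then have "wp x \<beta> = 0" by (intro crd_eqI) (simp add: crd_zero)
          then show False using p pos_root zero_notin by metis
        qed
        have "w (\<alpha> l + \<alpha> k) \<notin> Pos"
          using neg[of "is" "\<alpha> l + \<alpha> k" "\<alpha> k"] nk nl simple_root w_def by simp
        then have n1: "wp u (\<alpha> l) \<notin> Pos" using u pr by (simp add: s_eq)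
        then have l2: "len (wp u) = Suc (len (wp (u @ [l])))" by (simp add: len_down wp_snoc)
        have "wp (u @ [l]) (\<alpha> k) = w (\<alpha> l)"
          by (simp add: wp_snoc u s_eq pair_diff pair_add pair_scale pair_self pr algebra_simps)
        then have "wp (u @ [l]) (\<alpha> k) \<notin> Pos" using nl by simp
        then have l3: "len (wp (u @ [l])) = Suc (len (wp (u @ [l, k])))"
          using len_down[of "u @ [l]" k] wp_snoc[of "u @ [l]" k] by simp
        obtain r where r: "wp r = wp (u @ [l, k])" "length r = len (wp (u @ [l, k]))" using reduced_word by blast
        have rr: "wp r x = w (s k (s l (s k x)))" for x by (simp add: r wp_append wp_Cons wp_Nil u)
        have rr': "wp r x = w (s l (s k (s l x)))" for x using rr s_braid[OF braid] by simp
        have "wp (r @ [k, l]) x = wp u x" for x by (simp add: wp_append wp_Cons wp_Nil rr s_s u)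
        then have r1: "wp (r @ [k, l]) = wp u" by auto
        have "wp (r @ [l, k]) x = wp v x" for x by (simp add: wp_append wp_Cons wp_Nil rr' s_s u)
        then have r2: "wp (r @ [l, k]) = wp v" by auto
        have "fold T u = fold T (r @ [k, l])" using IH[of u "r @ [k, l]"] r1 r l2 l3 ru m by simp
        moreover have "fold T v = fold T (r @ [l, k])" using IH[of v "r @ [l, k]"] r2 r l2 l3 ru m by simp
        ultimately show ?thesis using uv assms(3)[OF braid] by (simp add: fun_eq_iff)
      qed
    qed
  qed
  have ex: "\<exists>js. wp js = wp is \<and> length js = len (wp is) \<and> fold T is = fold T js" for "is"
  proof (induction "is" rule: rev_induct)
    case Nil
    have "wp [] = id" by (rule wp_Nil)
    then show ?case by (intro exI[of _ "[]"]) (simp only: len_def inversions_id card.empty list.size simp_thms)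
  next
    case (snoc k "is")
    then obtain js where js: "wp js = wp is" "length js = len (wp is)" "fold T is = fold T js" by blast
    show ?case
    proof (cases "wp is (\<alpha> k) \<in> Pos")
      case True
      then have "wp (js @ [k]) = wp (is @ [k]) \<and> length (js @ [k]) = len (wp (is @ [k])) \<and>
          fold T (is @ [k]) = fold T (js @ [k])"
        using js len_up[OF True] by (simp add: wp_snoc)
      then show ?thesis by blast
    next
      case False
      obtain ks where ks: "wp ks = wp (is @ [k])" "length ks = len (wp (is @ [k]))" using reduced_word by blast
      have e: "wp (ks @ [k]) = wp js" unfolding wp_snoc ks js by (simp add: wp_snoc o_assoc[symmetric] s_comp_s)
      have "length (ks @ [k]) = len (wp (ks @ [k]))"
        using len_down[OF False] ks e js by (simp add: wp_snoc)
      then have "fold T js = fold T (ks @ [k])" using red[of js _ "ks @ [k]"] js e by simp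
      then have "fold T (is @ [k]) = fold T ks" using js(3) inv by (simp add: fun_eq_iff)
      then show ?thesis using ks by blast
    qed
  qed
  obtain i' where i': "wp i' = wp is" "length i' = len (wp is)" "fold T is = fold T i'" using ex by blast
  obtain j' where j': "wp j' = wp js" "length j' = len (wp js)" "fold T js = fold T j'" using ex by blast
  have "fold T i' = fold T j'" using red[of i' _ j'] i' j' eq by simp
  then show ?thesis using i' j' by simp
qed

end

section \<open>Substitution in the field of rational functions\<close>

text \<open>Rational functions are repeatedly divided by \<open>2\<close> when they are split into even and odd parts.\<close>

instance fract :: ("{idom,ring_char_0}") field_char_0
proof
  show "inj (of_nat :: nat \<Rightarrow> 'a fract)"
    by (rule injI) (simp add: of_nat_fract eq_fract)
qed

lemma of_poly_add: "of_poly (p + q) = of_poly p + of_poly q"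
  and of_poly_mult: "of_poly (p * q) = of_poly p * of_poly q"
  and of_poly_0: "of_poly 0 = 0" and of_poly_1: "of_poly 1 = 1"
  and of_poly_eq_iff: "of_poly p = of_poly q \<longleftrightarrow> p = q"
  by (simp_all add: of_poly_def eq_fract Zero_fract_def One_fract_def)

lemma of_poly_sum: "of_poly (sum f A) = (\<Sum>a\<in>A. of_poly (f a))"
  by (induction A rule: infinite_finite_induct) (auto simp: of_poly_0 of_poly_add)

lemma of_poly_prod: "of_poly (prod f A) = (\<Prod>a\<in>A. of_poly (f a))"
  by (induction A rule: infinite_finite_induct) (auto simp: of_poly_1 of_poly_mult)

lemma of_poly_power: "of_poly (p ^ n) = of_poly p ^ n"
  by (induction n) (auto simp: of_poly_1 of_poly_mult)

lemma const_fun_add: "const_fun (a + b) = const_fun a + const_fun b"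
  and const_fun_mult: "const_fun (a * b) = const_fun a * const_fun b"
  and const_fun_0: "const_fun 0 = 0" and const_fun_1: "const_fun 1 = 1"
  by (simp_all add: const_fun_def single_add of_poly_add of_poly_0 of_poly_1 mult_single flip: of_poly_mult)

lemma const_fun_eq_iff: "const_fun a = const_fun b \<longleftrightarrow> a = b"
  unfolding const_fun_def of_poly_eq_iff by (metis lookup_single_eq)

lemma const_fun_eq_0_iff: "const_fun a = 0 \<longleftrightarrow> a = 0"
  using const_fun_eq_iff[of a 0] by (simp add: const_fun_0)

lemma const_fun_minus: "const_fun (- a) = - const_fun a"
  using const_fun_add[of a "- a"] by (simp add: const_fun_0 eq_neg_iff_add_eq_0 add.commute)

lemma const_fun_inverse: "const_fun (inverse a) = inverse (const_fun a)"
proof (cases "a = 0")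
  case False
  then have "const_fun a * const_fun (inverse a) = (1 :: 'a ratfun)"
    by (simp flip: const_fun_mult add: const_fun_1)
  then show ?thesis by (metis inverse_unique)
qed (simp add: const_fun_0)

lemma const_fun_divide: "const_fun (a / b) = const_fun a / const_fun b"
  by (simp add: divide_inverse const_fun_mult const_fun_inverse)

lemma const_fun_power: "const_fun (a ^ n) = const_fun a ^ n"
  by (induction n) (auto simp: const_fun_1 const_fun_mult)

lemma const_fun_powi: "const_fun (a powi n) = const_fun a powi n"
  by (simp add: power_int_def const_fun_power const_fun_inverse)

lemma const_fun_prod: "const_fun (prod f A) = (\<Prod>a\<in>A. const_fun (f a))"
  by (induction A rule: infinite_finite_induct) (auto simp: const_fun_1 const_fun_mult)

lemma const_fun_of_nat: "const_fun (of_nat n) = of_nat n"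
  by (induction n) (auto simp: const_fun_0 const_fun_1 const_fun_add)

lemma const_fun_numeral: "const_fun (numeral n) = numeral n"
  using const_fun_of_nat[of "numeral n"] by simp

lemma mpoly_expand:
  "p = (\<Sum>m\<in>Poly_Mapping.keys p. Poly_Mapping.single m (Poly_Mapping.lookup p m))"
  by (rule poly_mapping_eqI)
     (auto simp: lookup_sum lookup_single when_def sum.delta' not_in_keys_iff_lookup_eq_zero)

lemma Xvar_nonzero: "Xvar i \<noteq> 0"
proof -
  have "Poly_Mapping.single (Poly_Mapping.single i 1) (1 :: complex) \<noteq> 0"
    by (metis lookup_single_eq lookup_zero zero_neq_one)
  then show ?thesis unfolding Xvar_def by (metis of_poly_eq_iff of_poly_0)
qed

lemma of_poly_monomial:
  fixes m :: "'i::{finite,linorder} \<Rightarrow>\<^sub>0 nat"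
  shows "of_poly (Poly_Mapping.single m c) = const_fun c * (\<Prod>i\<in>UNIV. Xvar i ^ Poly_Mapping.lookup m i)"
proof -
  have pow: "Poly_Mapping.single (Poly_Mapping.single i 1) (1::complex) ^ n =
      Poly_Mapping.single (Poly_Mapping.single i n) 1" for i :: 'i and n
    by (induction n) (auto simp: mult_single single_add[symmetric])
  have pr: "(\<Prod>i\<in>A. Poly_Mapping.single (f i) (1::complex)) = Poly_Mapping.single (\<Sum>i\<in>A. f i) 1"
    for A :: "'i set" and f :: "'i \<Rightarrow> ('i \<Rightarrow>\<^sub>0 nat)"
    by (induction A rule: infinite_finite_induct) (auto simp: mult_single)
  have m: "m = (\<Sum>i\<in>UNIV. Poly_Mapping.single i (Poly_Mapping.lookup m i))"
    by (rule poly_mapping_eqI) (simp add: lookup_sum lookup_single when_def)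
  have "(\<Prod>i\<in>UNIV. Xvar i ^ Poly_Mapping.lookup m i) = of_poly (Poly_Mapping.single m 1)"
    unfolding Xvar_def of_poly_power[symmetric] of_poly_prod[symmetric] pow pr m[symmetric] ..
  then show ?thesis
    by (simp add: const_fun_def mult_single flip: of_poly_mult)
qed

lemma eval_poly_superset:
  assumes "finite A" "Poly_Mapping.keys p \<subseteq> A"
  shows "eval_poly y p = (\<Sum>m\<in>A. const_fun (Poly_Mapping.lookup p m) * (\<Prod>i\<in>UNIV. y i ^ Poly_Mapping.lookup m i))"
  unfolding eval_poly_def using assms
  by (intro sum.mono_neutral_left) (auto simp: not_in_keys_iff_lookup_eq_zero const_fun_0)

lemma eval_poly_add: "eval_poly y (p + q) = eval_poly y p + eval_poly y q"
proof -
  let ?A = "Poly_Mapping.keys p \<union> Poly_Mapping.keys q"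
  show ?thesis
    using keys_add[of p q]
    by (simp add: eval_poly_superset[of ?A] lookup_add const_fun_add distrib_right sum.distrib)
qed

lemma eval_poly_single:
  "eval_poly y (Poly_Mapping.single m c) = const_fun c * (\<Prod>i\<in>UNIV. y i ^ Poly_Mapping.lookup m i)"
  by (subst eval_poly_superset[of "{m}"]) (auto simp: const_fun_0)

lemma eval_poly_0: "eval_poly y 0 = 0" by (simp add: eval_poly_def)

lemma eval_poly_sum: "eval_poly y (sum f A) = (\<Sum>a\<in>A. eval_poly y (f a))"
  by (induction A rule: infinite_finite_induct) (auto simp: eval_poly_0 eval_poly_add)

lemma eval_poly_mult: "eval_poly y (p * q) = eval_poly y p * eval_poly y q"
proof -
  have 1: "eval_poly y (Poly_Mapping.single m a * Poly_Mapping.single n b) =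
      eval_poly y (Poly_Mapping.single m a) * eval_poly y (Poly_Mapping.single n b)" for m n a b
    by (simp add: mult_single eval_poly_single const_fun_mult lookup_add power_add prod.distrib)
  let ?P = "\<lambda>p m. Poly_Mapping.single m (Poly_Mapping.lookup p m)"
  have "p * q = (\<Sum>m\<in>Poly_Mapping.keys p. \<Sum>n\<in>Poly_Mapping.keys q. ?P p m * ?P q n)"
    using mpoly_expand[of p] mpoly_expand[of q] by (metis (no_types, lifting) sum.cong sum_product)
  then have "eval_poly y (p * q) =
      (\<Sum>m\<in>Poly_Mapping.keys p. \<Sum>n\<in>Poly_Mapping.keys q. eval_poly y (?P p m) * eval_poly y (?P q n))"
    by (simp add: eval_poly_sum 1)
  also have "\<dots> = eval_poly y (\<Sum>m\<in>Poly_Mapping.keys p. ?P p m) * eval_poly y (\<Sum>n\<in>Poly_Mapping.keys q. ?P q n)"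
    by (simp add: eval_poly_sum sum_product)
  finally show ?thesis by (simp flip: mpoly_expand)
qed

lemma eval_poly_const: "eval_poly y (Poly_Mapping.single 0 c) = const_fun c"
  by (simp add: eval_poly_single)

lemma eval_poly_var: "eval_poly y (Poly_Mapping.single (Poly_Mapping.single i 1) 1) = y i"
proof -
  have "(\<Prod>j\<in>UNIV. y j ^ Poly_Mapping.lookup (Poly_Mapping.single i (1::nat)) j) = (\<Prod>j\<in>UNIV. if j = i then y j else 1)"
    by (rule prod.cong) (auto simp: lookup_single when_def)
  then show ?thesis by (simp add: eval_poly_single const_fun_1)
qed

definition field_hom :: "('i::{finite,linorder} ratfun \<Rightarrow> 'i ratfun) \<Rightarrow> bool" where
  "field_hom \<phi> \<longleftrightarrow> (\<forall>f g. \<phi> (f + g) = \<phi> f + \<phi> g) \<and> (\<forall>f g. \<phi> (f * g) = \<phi> f * \<phi> g) \<and>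
     (\<forall>c. \<phi> (const_fun c) = const_fun c)"

context
  fixes \<phi> :: "'i::{finite,linorder} ratfun \<Rightarrow> 'i ratfun"
  assumes hom: "field_hom \<phi>"
begin

lemma hom_add: "\<phi> (f + g) = \<phi> f + \<phi> g"
  and hom_mult: "\<phi> (f * g) = \<phi> f * \<phi> g"
  and hom_const: "\<phi> (const_fun c) = const_fun c"
  using hom by (auto simp: field_hom_def)

lemma hom_0: "\<phi> 0 = 0" and hom_1: "\<phi> 1 = 1"
  using hom_const[of 0] hom_const[of 1] by (simp_all add: const_fun_0 const_fun_1)

lemma hom_minus: "\<phi> (- f) = - \<phi> f"
  using hom_add[of f "- f"] by (simp add: hom_0 eq_neg_iff_add_eq_0 add.commute)

lemma hom_diff: "\<phi> (f - g) = \<phi> f - \<phi> g"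
  using hom_add[of f "- g"] by (simp add: hom_minus)

lemma hom_inverse: "\<phi> (inverse f) = inverse (\<phi> f)"
proof (cases "f = 0")
  case False
  then have "\<phi> f * \<phi> (inverse f) = 1" by (simp add: hom_1 flip: hom_mult)
  then show ?thesis by (metis inverse_unique)
qed (simp add: hom_0)

lemma hom_eq_0_iff: "\<phi> f = 0 \<longleftrightarrow> f = 0"
proof -
  have "\<phi> f * \<phi> (inverse f) = 1" if "f \<noteq> 0" using that by (simp add: hom_1 flip: hom_mult)
  then show ?thesis by (metis hom_0 mult_zero_left zero_neq_one)
qed

lemma hom_divide: "\<phi> (f / g) = \<phi> f / \<phi> g"
  by (simp add: divide_inverse hom_mult hom_inverse)

lemma hom_power: "\<phi> (f ^ n) = \<phi> f ^ n"
  by (induction n) (auto simp: hom_1 hom_mult)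

lemma hom_powi: "\<phi> (f powi n) = \<phi> f powi n"
  by (simp add: power_int_def hom_power hom_inverse)

lemma hom_sum: "\<phi> (sum h A) = (\<Sum>a\<in>A. \<phi> (h a))"
  by (induction A rule: infinite_finite_induct) (auto simp: hom_0 hom_add)

lemma hom_prod: "\<phi> (prod h A) = (\<Prod>a\<in>A. \<phi> (h a))"
  by (induction A rule: infinite_finite_induct) (auto simp: hom_1 hom_mult)

lemma hom_of_nat: "\<phi> (of_nat n) = of_nat n"
  using hom_const[of "of_nat n"] by (simp add: const_fun_of_nat)

lemma hom_2: "\<phi> 2 = 2" using hom_of_nat[of 2] by simp

lemma hom_of_poly: "\<phi> (of_poly p) = eval_poly (\<lambda>i. \<phi> (Xvar i)) p"
proof -
  have "\<phi> (of_poly p) = \<phi> (\<Sum>m\<in>Poly_Mapping.keys p. of_poly (Poly_Mapping.single m (Poly_Mapping.lookup p m)))"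
    using mpoly_expand[of p] by (simp flip: of_poly_sum)
  then show ?thesis
    by (simp add: of_poly_monomial hom_sum hom_mult hom_const hom_prod hom_power eval_poly_def)
qed

end

lemma ratfun_quotient: "\<exists>a b. b \<noteq> 0 \<and> f = of_poly a / of_poly b"
  by (cases f rule: Fract_cases) (auto simp: of_poly_def)

lemma field_hom_eqI:
  fixes \<phi> \<psi> :: "'i::{finite,linorder} ratfun \<Rightarrow> 'i ratfun"
  assumes "field_hom \<phi>" "field_hom \<psi>" "\<And>i. \<phi> (Xvar i) = \<psi> (Xvar i)"
  shows "\<phi> = \<psi>"
proof
  fix f :: "'i ratfun"
  obtain a b where "f = of_poly a / of_poly b" using ratfun_quotient by blast
  then show "\<phi> f = \<psi> f"
    using assms(3) by (simp add: hom_divide[OF assms(1)] hom_divide[OF assms(2)]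
      hom_of_poly[OF assms(1)] hom_of_poly[OF assms(2)])
qed

lemma field_hom_comp: "field_hom \<phi> \<Longrightarrow> field_hom \<psi> \<Longrightarrow> field_hom (\<lambda>f. \<phi> (\<psi> f))"
  by (simp add: field_hom_def)

lemma field_hom_id: "field_hom (\<lambda>f. f)" by (simp add: field_hom_def)

lemma subst_Fract:
  obtains a b where "b \<noteq> 0" "f = Fract a b" "subst y f = eval_poly y a / eval_poly y b"
proof -
  let ?S = "SOME (a, b). b \<noteq> 0 \<and> f = Fract a b"
  have "\<exists>p. case p of (a, b) \<Rightarrow> b \<noteq> 0 \<and> f = Fract a b"
    by (cases f rule: Fract_cases) auto
  then have "case ?S of (a, b) \<Rightarrow> b \<noteq> 0 \<and> f = Fract a b" by (rule someI_ex)
  then show ?thesis using that by (auto simp: subst_def split: prod.splits)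
qed

text \<open>The fraction chosen in the definition of \<open>subst\<close> is irrelevant for a substitution that comes from
  a homomorphism of fields.\<close>

lemma subst_eqI:
  assumes "field_hom \<phi>" shows "subst (\<lambda>i. \<phi> (Xvar i)) f = \<phi> f"
proof -
  obtain a b where ab: "b \<noteq> 0" "f = Fract a b"
    "subst (\<lambda>i. \<phi> (Xvar i)) f = eval_poly (\<lambda>i. \<phi> (Xvar i)) a / eval_poly (\<lambda>i. \<phi> (Xvar i)) b"
    by (rule subst_Fract)
  have "f = of_poly a / of_poly b" using ab by (simp add: of_poly_def)
  then have "\<phi> f = \<phi> (of_poly a) / \<phi> (of_poly b)" using hom_divide[OF assms] by simp
  then show ?thesis by (simp only: ab(3) hom_of_poly[OF assms])
qed

text \<open>Conversely, a substitution that is injective on polynomials never makes a denominator vanish, and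
  extends to a homomorphism of fields.\<close>

lemma field_hom_subst:
  assumes inj: "\<And>p. eval_poly y p = 0 \<Longrightarrow> p = 0"
  shows "field_hom (subst y)" "subst y (Xvar i) = y i"
proof -
  have sub: "subst y (Fract a b) = eval_poly y a / eval_poly y b" if "b \<noteq> 0" for a b
  proof -
    obtain c d where cd: "d \<noteq> 0" "Fract a b = Fract c d" "subst y (Fract a b) = eval_poly y c / eval_poly y d"
      by (rule subst_Fract)
    then have "a * d = c * b" using that by (simp add: eq_fract)
    then have "eval_poly y a * eval_poly y d = eval_poly y c * eval_poly y b"
      by (simp flip: eval_poly_mult)
    moreover have "eval_poly y b \<noteq> 0" "eval_poly y d \<noteq> 0" using inj that cd by blast+
    ultimately show ?thesis using cd(3) by (simp add: frac_eq_eq)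
  qed
  have nz: "eval_poly y b \<noteq> 0" if "b \<noteq> 0" for b using inj that by blast
  have add: "subst y (f + g) = subst y f + subst y g"
   and mult: "subst y (f * g) = subst y f * subst y g" for f g
  proof -
    obtain a b where f: "b \<noteq> 0" "f = Fract a b" by (rule subst_Fract)
    obtain c d where g: "d \<noteq> 0" "g = Fract c d" by (rule subst_Fract)
    show "subst y (f + g) = subst y f + subst y g" "subst y (f * g) = subst y f * subst y g"
      using f g nz by (simp_all add: sub eval_poly_add eval_poly_mult add_frac_eq)
  qed
  have e1: "eval_poly y 1 = 1" using eval_poly_const[of y 1] by (simp add: const_fun_1)
  have "subst y (const_fun c) = const_fun c" for c
    by (simp add: const_fun_def of_poly_def sub e1) (simp add: eval_poly_const const_fun_def of_poly_def)
  then show "field_hom (subst y)" using add mult by (simp add: field_hom_def)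
  show "subst y (Xvar i) = y i"
    unfolding Xvar_def of_poly_def by (simp only: sub[OF one_neq_zero] e1 eval_poly_var div_by_1)
qed

section \<open>Laurent monomials\<close>

text \<open>The field is a complex vector space; linear independence and coordinates refer to this structure.\<close>

global_interpretation rf: vector_space "\<lambda>c (f :: 'i::{finite,linorder} ratfun). const_fun c * f"
  by unfold_locales (simp_all add: const_fun_add const_fun_mult const_fun_1 algebra_simps)

definition xmon :: "('i::{finite,linorder} \<Rightarrow> int) \<Rightarrow> 'i ratfun" where
  "xmon u = (\<Prod>i\<in>UNIV. Xvar i powi u i)"

lemma xmon_nonzero: "xmon u \<noteq> 0"
  by (simp add: xmon_def Xvar_nonzero)

lemma xmon_add: "xmon (\<lambda>i. u i + v i) = xmon u * xmon v"
  by (simp add: xmon_def power_int_add Xvar_nonzero prod.distrib)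

lemma xmon_of_nat: "xmon (\<lambda>i. int (Poly_Mapping.lookup m i)) = of_poly (Poly_Mapping.single m 1)"
  by (simp add: xmon_def of_poly_monomial const_fun_1)

text \<open>Multiplying by one monomial with large exponents turns all exponents into natural numbers, and
  distinct monomials are independent in the polynomial ring.\<close>

lemma xmon_independent:
  assumes "finite A" "(\<Sum>u\<in>A. const_fun (c u) * xmon u) = 0" "u \<in> A"
  shows "c u = 0"
proof -
  (* a single exponent vector that dominates all the others *)
  define b where "b i = (\<Sum>u\<in>A. \<bar>u i\<bar>)" for i
  define e where "e u = Abs_poly_mapping (\<lambda>i. nat (u i + b i))" for u :: "'a \<Rightarrow> int"
  have nn: "u i + b i \<ge> 0" if "u \<in> A" for u i
  proof -
    have "\<bar>u i\<bar> \<le> b i" unfolding b_def using assms(1) that by (intro member_le_sum) auto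
    then show ?thesis by linarith
  qed
  have e: "int (Poly_Mapping.lookup (e u) i) = u i + b i" if "u \<in> A" for u i
    using nn[OF that] by (simp add: e_def)
  have inj: "inj_on e A"
    by (rule inj_onI) (metis e add_right_cancel ext)
  have "of_poly (\<Sum>u\<in>A. Poly_Mapping.single (e u) (c u)) = (\<Sum>u\<in>A. const_fun (c u) * xmon u) * xmon b"
    unfolding of_poly_sum sum_distrib_right
  proof (rule sum.cong)
    fix u assume u: "u \<in> A"
    have "Poly_Mapping.single (e u) (c u) = Poly_Mapping.single 0 (c u) * Poly_Mapping.single (e u) 1"
      by (simp add: mult_single)
    then have "of_poly (Poly_Mapping.single (e u) (c u)) = const_fun (c u) * xmon (\<lambda>i. int (Poly_Mapping.lookup (e u) i))"
      by (simp add: of_poly_mult const_fun_def xmon_of_nat)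
    then show "of_poly (Poly_Mapping.single (e u) (c u)) = const_fun (c u) * xmon u * xmon b"
      by (simp add: e[OF u] xmon_add)
  qed simp
  then have "(\<Sum>u\<in>A. Poly_Mapping.single (e u) (c u)) = 0"
    using assms(2) by (metis mult_zero_left of_poly_eq_iff of_poly_0)
  then have "0 = Poly_Mapping.lookup (\<Sum>v\<in>A. Poly_Mapping.single (e v) (c v)) (e u)" by simp
  also have "\<dots> = (\<Sum>v\<in>A. if v = u then c v else 0)"
    unfolding lookup_sum using inj assms(3)
    by (intro sum.cong) (auto simp: lookup_single when_def dest: inj_onD)
  also have "\<dots> = c u" using assms by simp
  finally show ?thesis by simp
qed

locale laurent_system = simply_laced_system \<Phi> \<alpha>
  for \<Phi> :: "'v::euclidean_space set" and \<alpha> :: "'i::{finite,linorder} \<Rightarrow> 'v" +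
  fixes q :: nat
  assumes q_gt_1: "q > 1"
begin

definition sq :: complex where "sq = complex_of_real (sqrt (real q))"

lemma sq_nonzero: "sq \<noteq> 0" using q_gt_1 by (simp add: sq_def)

lemma sq_square: "sq * sq = of_nat q"
proof -
  have "sq * sq = complex_of_real (sqrt (real q) * sqrt (real q))" unfolding sq_def by (simp only: of_real_mult)
  then show ?thesis by simp
qed

abbreviation "sF \<equiv> const_fun sq :: 'i ratfun"

lemma sF_nonzero: "sF \<noteq> 0" by (simp add: const_fun_eq_0_iff sq_nonzero)

lemma sF_square: "sF * sF = of_nat q"
  by (simp add: sq_square const_fun_of_nat flip: const_fun_mult)

lemma sqrt_const_eq: "sqrt_const q = sF" by (simp add: sqrt_const_def sq_def)

text \<open>In the normalised monomials the reflections act without constants.\<close>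

definition ymon :: "'v \<Rightarrow> 'i ratfun" where
  "ymon \<nu> = sF powi height \<alpha> \<nu> * monomial \<alpha> \<nu>"

lemma root_coord_add: "x \<in> L \<Longrightarrow> y \<in> L \<Longrightarrow> root_coord \<alpha> (x + y) i = root_coord \<alpha> x i + root_coord \<alpha> y i"
  using root_coord_eq[of x i] root_coord_eq[of y i] root_coord_eq[of "x + y" i]
  by (simp add: lattice_add crd_add flip: of_int_add)

lemma root_coord_simple: "root_coord \<alpha> (\<alpha> j) i = (if i = j then 1 else 0)"
  using root_coord_eq[of "\<alpha> j" i] by (simp add: lattice_simple crd_simple split: if_splits)

lemma root_coord_zero: "root_coord \<alpha> 0 i = 0"
  using root_coord_eq[of 0 i] by (simp add: lattice_zero crd_zero)

lemma root_coord_inj: "x \<in> L \<Longrightarrow> y \<in> L \<Longrightarrow> root_coord \<alpha> x = root_coord \<alpha> y \<Longrightarrow> x = y"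
  by (rule crd_eqI) (simp flip: root_coord_eq)

lemma height_add: "x \<in> L \<Longrightarrow> y \<in> L \<Longrightarrow> height \<alpha> (x + y) = height \<alpha> x + height \<alpha> y"
  by (simp add: height_def root_coord_add sum.distrib)

lemma height_zero: "height \<alpha> 0 = 0" by (simp add: height_def root_coord_zero)

lemma height_simple: "height \<alpha> (\<alpha> k) = 1"
  by (simp add: height_def root_coord_simple)

lemma monomial_xmon: "monomial \<alpha> \<nu> = xmon (root_coord \<alpha> \<nu>)"
  by (simp add: monomial_def xmon_def)

lemma ymon_nonzero: "ymon \<nu> \<noteq> 0"
  by (simp add: ymon_def monomial_xmon xmon_nonzero sF_nonzero)

lemma ymon_add: "x \<in> L \<Longrightarrow> y \<in> L \<Longrightarrow> ymon (x + y) = ymon x * ymon y"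
proof -
  assume xy: "x \<in> L" "y \<in> L"
  have "root_coord \<alpha> (x + y) = (\<lambda>i. root_coord \<alpha> x i + root_coord \<alpha> y i)"
    by (rule ext) (rule root_coord_add[OF xy])
  then show ?thesis
    by (simp add: ymon_def height_add xy power_int_add sF_nonzero monomial_xmon xmon_add)
qed

lemma ymon_zero: "ymon 0 = 1"
  by (simp add: ymon_def height_zero monomial_def root_coord_zero)

lemma ymon_minus: "x \<in> L \<Longrightarrow> ymon (- x) = inverse (ymon x)"
  using ymon_add[of x "- x"] by (metis ab_group_add_class.ab_left_minus add.commute inverse_unique lattice_minus ymon_zero)

lemma ymon_simple: "ymon (\<alpha> k) = sF * Xvar k"
proof -
  have "(\<Prod>i\<in>UNIV. Xvar i powi (if i = k then 1 else 0)) = (\<Prod>i\<in>UNIV. if i = k then Xvar i else 1)"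
    by (rule prod.cong) auto
  then show ?thesis by (simp add: ymon_def height_simple monomial_def root_coord_simple)
qed

lemma Xvar_ymon: "Xvar k = ymon (\<alpha> k) / sF"
  by (simp add: ymon_simple sF_nonzero)

text \<open>A multiplicative function on the lattice is determined by its values at the simple roots. It is
  used for monomials as well as for their images under automorphisms.\<close>

lemma multiplicative_expand:
  fixes g :: "'v \<Rightarrow> 'i ratfun"
  assumes g: "\<And>x y. x \<in> L \<Longrightarrow> y \<in> L \<Longrightarrow> g (x + y) = g x * g y" "\<And>x. x \<in> L \<Longrightarrow> g x \<noteq> 0"
    and "x \<in> L"
  shows "g x = (\<Prod>i\<in>UNIV. g (\<alpha> i) powi root_coord \<alpha> x i)"
proof -
  have g0: "g 0 = 1" using g(1)[of 0 0] g(2)[of 0] lattice_zero by simp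
  have nat: "g (real n *\<^sub>R y) = g y ^ n" if "y \<in> L" for n y
  proof (induction n)
    case 0 then show ?case by (simp add: g0)
  next
    case (Suc n)
    have "g (y + real n *\<^sub>R y) = g y * g (real n *\<^sub>R y)"
      by (rule g(1)) (auto simp: that lattice_scale)
    then show ?case using Suc by (simp add: algebra_simps)
  qed
  have gm: "g (- y) = inverse (g y)" if "y \<in> L" for y
  proof -
    have "g y * g (- y) = 1" using g(1)[of y "- y"] that by (simp add: lattice_minus g0)
    then show ?thesis by (metis inverse_unique)
  qed
  have int: "g (of_int n *\<^sub>R y) = g y powi n" if "y \<in> L" for n y
  proof (cases "n \<ge> 0")
    case True then show ?thesis using nat[OF that, of "nat n"] by (simp add: power_int_def)
  next
    case False
    then have "g (of_int n *\<^sub>R y) = g (- (real (nat (- n)) *\<^sub>R y))" by simp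
    also have "\<dots> = inverse (g y ^ nat (- n))" by (simp add: gm that lattice_scale nat)
    finally show ?thesis using False by (simp add: power_int_def power_inverse)
  qed
  have sum: "g (\<Sum>i\<in>A. of_int (n i) *\<^sub>R \<alpha> i) = (\<Prod>i\<in>A. g (\<alpha> i) powi n i)" for A and n :: "'i \<Rightarrow> int"
  proof (induction A rule: infinite_finite_induct)
    case (insert a A)
    then show ?case using g(1)[of "of_int (n a) *\<^sub>R \<alpha> a" "\<Sum>i\<in>A. of_int (n i) *\<^sub>R \<alpha> i"]
      by (simp add: int lattice_simple lattice_scale lattice_sum)
  qed (auto simp: g0)
  have "x = (\<Sum>i\<in>UNIV. of_int (root_coord \<alpha> x i) *\<^sub>R \<alpha> i)"
    using crd_expand[of x] by (simp add: root_coord_eq[OF assms(3)])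
  then show ?thesis using sum[of "root_coord \<alpha> x" UNIV] by simp
qed

lemma hom_ymon:
  assumes "field_hom \<phi>" "\<And>x y. x \<in> L \<Longrightarrow> y \<in> L \<Longrightarrow> g (x + y) = g x * g y" "\<And>x. x \<in> L \<Longrightarrow> g x \<noteq> 0"
    and "\<And>i. \<phi> (ymon (\<alpha> i)) = g (\<alpha> i)" "x \<in> L"
  shows "\<phi> (ymon x) = g x"
proof -
  have "ymon x = (\<Prod>i\<in>UNIV. ymon (\<alpha> i) powi root_coord \<alpha> x i)"
    by (rule multiplicative_expand) (auto simp: ymon_add ymon_nonzero assms(5))
  then show ?thesis using multiplicative_expand[of g x, OF assms(2,3,5)]
    by (simp add: hom_prod[OF assms(1)] hom_powi[OF assms(1)] assms(4))
qed

lemma ymon_sum_zero: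
  assumes "finite A" "A \<subseteq> L" "(\<Sum>x\<in>A. const_fun (c x) * ymon x) = 0" "x \<in> A"
  shows "c x = 0"
proof -
  have inj: "inj_on (root_coord \<alpha>) A" using assms(2) root_coord_inj by (meson inj_onI subsetD)
  let ?r = "the_inv_into A (root_coord \<alpha>)"
  let ?c = "\<lambda>u. c (?r u) * sq powi height \<alpha> (?r u)"
  have "(\<Sum>u\<in>root_coord \<alpha> ` A. const_fun (?c u) * xmon u) = (\<Sum>x\<in>A. const_fun (c x) * ymon x)"
    unfolding sum.reindex[OF inj] o_def
    by (intro sum.cong)
       (auto simp: the_inv_into_f_f[OF inj] const_fun_mult const_fun_powi ymon_def monomial_xmon)
  then have "?c (root_coord \<alpha> x) = 0"
    using xmon_independent[of "root_coord \<alpha> ` A" ?c "root_coord \<alpha> x"] assms by auto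
  then show ?thesis using sq_nonzero by (simp add: the_inv_into_f_f[OF inj assms(4)])
qed

lemma inj_ymon: "inj_on ymon L"
proof (rule inj_onI, rule ccontr)
  fix x y assume a: "x \<in> L" "y \<in> L" "ymon x = ymon y" "x \<noteq> y"
  then have "(\<Sum>z\<in>{x, y}. const_fun (if z = x then 1 else - 1) * ymon z) = 0"
    by (auto simp: const_fun_1 const_fun_minus)
  from ymon_sum_zero[OF _ _ this, of x] a show False by auto
qed

lemma ymon_independent: "rf.independent (ymon ` L)"
  unfolding rf.independent_explicit_module
proof (intro allI impI)
  fix t u v assume t: "finite t" "t \<subseteq> ymon ` L" "(\<Sum>v\<in>t. const_fun (u v) * v) = 0" "v \<in> t"
  then obtain A where A: "A \<subseteq> L" "t = ymon ` A" by (meson subset_imageE)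
  have inj: "inj_on ymon A" using A inj_ymon inj_on_subset by blast
  then have "finite A" using t A finite_imageD by blast
  moreover have "(\<Sum>x\<in>A. const_fun (u (ymon x)) * ymon x) = 0"
    using t(3) unfolding A sum.reindex[OF inj] by simp
  ultimately show "u v = 0" using ymon_sum_zero[of A "\<lambda>x. u (ymon x)"] A t(4) by auto
qed

text \<open>A substitution of scaled monomials whose exponents come from an injective linear map sends distinct
  monomials to independent elements. This covers the maps \<open>\<sigma>\<^sub>k\<close> and \<open>\<epsilon>\<^sub>k\<close>.\<close>

lemma eval_poly_injective:
  assumes \<theta>: "linear \<theta>" "inj \<theta>" "\<And>x. x \<in> L \<Longrightarrow> \<theta> x \<in> L" and "\<And>i. c i \<noteq> 0"
    and ev: "eval_poly (\<lambda>i. const_fun (c i) * ymon (\<theta> (\<alpha> i))) p = 0"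
  shows "p = 0"
proof -
  define l where "l m = \<theta> (\<Sum>i\<in>UNIV. of_int (int (Poly_Mapping.lookup m i)) *\<^sub>R \<alpha> i)" for m :: "'i \<Rightarrow>\<^sub>0 nat"
  let ?K = "Poly_Mapping.keys p"
  have lat: "(\<Sum>i\<in>UNIV. of_int (int (Poly_Mapping.lookup m i)) *\<^sub>R \<alpha> i) \<in> L" for m :: "'i \<Rightarrow>\<^sub>0 nat"
    by (intro lattice_sum lattice_scale lattice_simple) auto
  have rc: "root_coord \<alpha> (\<Sum>i\<in>UNIV. of_int (int (Poly_Mapping.lookup m i)) *\<^sub>R \<alpha> i) j = int (Poly_Mapping.lookup m j)"
    for m :: "'i \<Rightarrow>\<^sub>0 nat" and j
    using root_coord_eq[OF lat[of m], of j] unfolding crd_comb by simp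
  have inj: "inj_on l A" for A
  proof (rule inj_onI)
    fix m n assume "l m = l n"
    then have "(\<Sum>i\<in>UNIV. of_int (int (Poly_Mapping.lookup m i)) *\<^sub>R \<alpha> i) = (\<Sum>i\<in>UNIV. of_int (int (Poly_Mapping.lookup n i)) *\<^sub>R \<alpha> i)"
      using \<theta>(2) by (simp add: l_def inj_eq)
    then show "m = n" using rc by (metis of_nat_eq_iff poly_mapping_eqI)
  qed
  have prod: "(\<Prod>i\<in>UNIV. ymon (\<theta> (\<alpha> i)) ^ Poly_Mapping.lookup m i) = ymon (l m)" for m
  proof -
    have "ymon (\<theta> x) = (\<Prod>i\<in>UNIV. ymon (\<theta> (\<alpha> i)) powi root_coord \<alpha> x i)" if "x \<in> L" for x
      by (rule multiplicative_expand[where g = "\<lambda>x. ymon (\<theta> x)"])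
         (simp_all add: linear_add[OF \<theta>(1)] ymon_add \<theta>(3) ymon_nonzero that)
    from this[OF lat[of m]] show ?thesis unfolding l_def rc by simp
  qed
  let ?d = "\<lambda>m. Poly_Mapping.lookup p m * (\<Prod>i\<in>UNIV. c i ^ Poly_Mapping.lookup m i)"
  have "(\<Sum>x\<in>l ` ?K. const_fun (?d (the_inv_into ?K l x)) * ymon x) =
      (\<Sum>m\<in>?K. const_fun (?d m) * ymon (l m))"
    unfolding sum.reindex[OF inj] o_def by (intro sum.cong) (auto simp: the_inv_into_f_f[OF inj])
  also have "\<dots> = 0"
    using ev by (simp add: eval_poly_def power_mult_distrib prod.distrib prod const_fun_mult const_fun_prod const_fun_power mult.assoc)
  finally have z: "(\<Sum>x\<in>l ` ?K. const_fun (?d (the_inv_into ?K l x)) * ymon x) = 0" .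
  have lL: "l ` ?K \<subseteq> L" using \<theta>(3) lat by (auto simp: l_def)
  have "?d m = 0" if "m \<in> ?K" for m
    using ymon_sum_zero[OF _ lL z, of "l m"] that by (simp add: the_inv_into_f_f[OF inj])
  then have "Poly_Mapping.lookup p m = 0" for m
    using assms(4) by (cases "m \<in> ?K") (auto simp: in_keys_iff)
  then show ?thesis by (intro poly_mapping_eqI) simp
qed

end

section \<open>The slash operators and their braid relations\<close>

text \<open>In the variable \<open>y = s x\<^sub>k\<close> these are the two coefficients in the definition of
  \<open>f|\<sigma>\<^sub>k\<close>, for even (\<open>b\<close> true) and odd parts.\<close>

definition slash_coeff :: "'a::field \<Rightarrow> bool \<Rightarrow> 'a \<Rightarrow> 'a" where
  "slash_coeff s b y = (if b then (s * y - 1) / (y * (s - y)) else 1 / y)"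

text \<open>Let \<open>k\<close> and \<open>l\<close> be adjacent, \<open>y\<close> and \<open>z\<close> their variables. If \<open>f\<close> has parity \<open>b\<close> under
  \<open>\<epsilon>\<^sub>k\<close>, then \<open>(f|\<sigma>\<^sub>k)|\<sigma>\<^sub>l\<close> is this multiple of the transform of \<open>f\<close>, where \<open>p\<close> is
  the parity of \<open>\<sigma>\<^sub>k f\<close> under \<open>\<epsilon>\<^sub>l\<close>: the first coefficient is itself a function of \<open>y\<close>, on
  which \<open>\<epsilon>\<^sub>l\<close> acts by a change of sign, and so it contributes an even and an odd part.\<close>

definition slash_coeff2 :: "'a::field \<Rightarrow> bool \<Rightarrow> bool \<Rightarrow> 'a \<Rightarrow> 'a \<Rightarrow> 'a" where
  "slash_coeff2 s p b y z =
     slash_coeff s p z * ((slash_coeff s b (y * z) + slash_coeff s b (- (y * z))) / 2) +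
     slash_coeff s (\<not> p) z * ((slash_coeff s b (y * z) - slash_coeff s b (- (y * z))) / 2)"

text \<open>The coefficient after the three steps \<open>k\<close>, \<open>l\<close>, \<open>k\<close>, for \<open>f\<close> of parities \<open>b\<close> and \<open>c\<close> under
  \<open>\<epsilon>\<^sub>k\<close> and \<open>\<epsilon>\<^sub>l\<close>.\<close>

definition slash_coeff3 :: "'a::field \<Rightarrow> bool \<Rightarrow> bool \<Rightarrow> 'a \<Rightarrow> 'a \<Rightarrow> 'a" where
  "slash_coeff3 s b c y z =
     slash_coeff s c y * ((slash_coeff2 s (b = c) b (1 / y) (y * z) + slash_coeff2 s (b = c) b (1 / y) (- (y * z))) / 2) +
     slash_coeff s (\<not> c) y * ((slash_coeff2 s (b = c) b (1 / y) (y * z) - slash_coeff2 s (b = c) b (1 / y) (- (y * z))) / 2)"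

definition slash_even :: "'a::field \<Rightarrow> bool \<Rightarrow> 'a \<Rightarrow> 'a" where
  "slash_even s b x = (if b then (s^2 - 1) / (s^2 - x^2) else 0)"

definition slash_odd :: "'a::field \<Rightarrow> bool \<Rightarrow> 'a \<Rightarrow> 'a" where
  "slash_odd s b x = (if b then s * (x^2 - 1) / (x * (s^2 - x^2)) else 1 / x)"

lemma slash_coeff_split:
  fixes s x :: "'a::field_char_0"
  assumes "x \<noteq> 0" "s^2 \<noteq> x^2"
  shows "slash_coeff s b x = slash_even s b x + slash_odd s b x"
    and "slash_coeff s b (- x) = slash_even s b x - slash_odd s b x"
proof -
  have e: "s^2 - x^2 = (s - x) * (s + x)" by (simp add: power2_eq_square algebra_simps)
  have n: "s - x \<noteq> 0" "s + x \<noteq> 0" using assms(2) by (auto simp: add_eq_0_iff)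
  have "(s * x - 1) / (x * (s - x)) = ((s * x - 1) * (s + x)) / (x * ((s - x) * (s + x)))"
    using n by simp
  also have "\<dots> = ((s^2 - 1) * x + s * (x^2 - 1)) / (x * ((s - x) * (s + x)))"
    by (simp add: algebra_simps power2_eq_square)
  also have "\<dots> = (s^2 - 1) / (s^2 - x^2) + s * (x^2 - 1) / (x * (s^2 - x^2))"
    using assms(1) by (simp add: e add_divide_distrib)
  finally have 1: "(s * x - 1) / (x * (s - x)) = (s^2 - 1) / (s^2 - x^2) + s * (x^2 - 1) / (x * (s^2 - x^2))" .
  have "(s * (- x) - 1) / ((- x) * (s - (- x))) = ((s * x + 1) * (s - x)) / (x * ((s - x) * (s + x)))"
  proof -
    have "(s * (- x) - 1) / ((- x) * (s - (- x))) = (s * x + 1) / (x * (s + x))"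
      by (simp add: minus_divide_right[symmetric] minus_divide_left)
    then show ?thesis using n by simp
  qed
  also have "\<dots> = ((s^2 - 1) * x - s * (x^2 - 1)) / (x * ((s - x) * (s + x)))"
    by (simp add: algebra_simps power2_eq_square)
  also have "\<dots> = (s^2 - 1) / (s^2 - x^2) - s * (x^2 - 1) / (x * (s^2 - x^2))"
    using assms(1) by (simp add: e diff_divide_distrib)
  finally have 2: "(s * (- x) - 1) / ((- x) * (s - (- x))) = (s^2 - 1) / (s^2 - x^2) - s * (x^2 - 1) / (x * (s^2 - x^2))" .
  show "slash_coeff s b x = slash_even s b x + slash_odd s b x"
    and "slash_coeff s b (- x) = slash_even s b x - slash_odd s b x"
    using 1 2 by (cases b; simp only: slash_coeff_def slash_even_def slash_odd_def if_True if_False; simp)+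
qed

text \<open>The braid relation for two adjacent nodes, stripped of everything but the coefficients: the
  steps \<open>l\<close>, \<open>k\<close>, \<open>l\<close> exchange the roles of the two variables and of the two parities.\<close>

lemma slash_coeff3_sym:
  fixes s y z :: "'a::field_char_0"
  assumes nz: "y \<noteq> 0" "z \<noteq> 0" and n: "s^2 \<noteq> y^2" "s^2 \<noteq> z^2" "s^2 \<noteq> (y * z)^2"
  shows "slash_coeff3 s b c y z = slash_coeff3 s c b z y"
proof -
  have main: "slash_coeff3 s b c y z =
      slash_coeff s c y * (slash_even s b z * slash_even s (b = c) (y * z) + slash_odd s b z * slash_odd s (b \<noteq> c) (y * z)) +
      slash_coeff s (\<not> c) y * (slash_even s b z * slash_odd s (b = c) (y * z) + slash_odd s b z * slash_even s (b \<noteq> c) (y * z))"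
    if "y \<noteq> 0" "z \<noteq> 0" "s^2 \<noteq> y^2" "s^2 \<noteq> z^2" "s^2 \<noteq> (y * z)^2" for b c and y z :: 'a
  proof -
    have simps: "1 / y * (y * z) = z" "1 / y * (- (y * z)) = - z" using that by simp_all
    have yz: "y * z \<noteq> 0" using that by simp
    note sp = slash_coeff_split[OF that(2,4)] slash_coeff_split[OF yz that(5)]
    show ?thesis unfolding slash_coeff3_def slash_coeff2_def simps minus_minus sp
      by (simp add: algebra_simps add_divide_distrib[symmetric] diff_divide_distrib[symmetric])
  qed
  define A where "A = s^2 - y^2"
  define B where "B = s^2 - z^2"
  define D where "D = s^2 - (y * z)^2"
  have D': "D = s^2 - (z * y)^2" by (simp add: D_def mult.commute)
  have abd: "A \<noteq> 0" "B \<noteq> 0" "D \<noteq> 0" using n by (simp_all add: A_def B_def D_def)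
  have n': "s^2 \<noteq> (z * y)^2" using n(3) by (simp add: mult.commute)
  note m = main[OF nz n] main[OF nz(2,1) n(2,1) n']
  note sp = slash_coeff_split(1)[OF nz(1) n(1)] slash_coeff_split(1)[OF nz(2) n(2)]
  note defs = slash_even_def slash_odd_def if_True if_False simp_thms
    A_def[symmetric] B_def[symmetric] D_def[symmetric] D'[symmetric]
  have FF: "slash_coeff3 s False False y z = slash_coeff3 s False False z y"
    unfolding m sp defs by simp
  have "((s^2 - 1) * y + s * (y^2 - 1)) * ((s^2 - 1)^2 * y * z^2 + s * (z^2 - 1) * D) + (s^2 - 1) * s * ((y * z)^2 - 1) * z * A =
      ((s^2 - 1) * z + s * (z^2 - 1)) * ((s^2 - 1)^2 * z * y^2 + s * (y^2 - 1) * D) + (s^2 - 1) * s * ((y * z)^2 - 1) * y * B"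
    unfolding A_def B_def D_def by algebra
  moreover have "slash_coeff3 s True True y z =
      (((s^2 - 1) * y + s * (y^2 - 1)) * ((s^2 - 1)^2 * y * z^2 + s * (z^2 - 1) * D) + (s^2 - 1) * s * ((y * z)^2 - 1) * z * A) / (y^2 * z^2 * A * B * D)"
    "slash_coeff3 s True True z y =
      (((s^2 - 1) * z + s * (z^2 - 1)) * ((s^2 - 1)^2 * z * y^2 + s * (y^2 - 1) * D) + (s^2 - 1) * s * ((y * z)^2 - 1) * y * B) / (y^2 * z^2 * A * B * D)"
    unfolding m sp defs using abd nz by (simp_all add: field_simps power2_eq_square)
  ultimately have TT: "slash_coeff3 s True True y z = slash_coeff3 s True True z y" by simp
  have TF: "slash_coeff3 s True False y z = slash_coeff3 s False True z y"
    if "y \<noteq> 0" "z \<noteq> 0" "s^2 \<noteq> y^2" "s^2 \<noteq> z^2" "s^2 \<noteq> (y * z)^2" for y z :: 'a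
  proof -
    define A where "A = s^2 - y^2"
    define B where "B = s^2 - z^2"
    define D where "D = s^2 - (y * z)^2"
    have D': "D = s^2 - (z * y)^2" by (simp add: D_def mult.commute)
    have abd: "A \<noteq> 0" "B \<noteq> 0" "D \<noteq> 0" using that by (simp_all add: A_def B_def D_def)
    have n': "s^2 \<noteq> (z * y)^2" using that(5) by (simp add: mult.commute)
    note m = main[OF that] main[OF that(2,1,4,3) n']
    note sp = slash_coeff_split(1)[OF that(1,3)] slash_coeff_split(1)[OF that(2,4)]
    note defs = slash_even_def slash_odd_def if_True if_False simp_thms
      A_def[symmetric] B_def[symmetric] D_def[symmetric] D'[symmetric]
    have "s^2 * (z^2 - 1) * ((y * z)^2 - 1) * A + ((s^2 - 1) * y + s * (y^2 - 1)) * z * ((s^2 - 1) * D + s * y * (z^2 - 1) * (s^2 - 1)) =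
        ((s^2 - 1) * z + s * (z^2 - 1)) * s * ((y * z)^2 - 1) * A + (s^2 - 1) * y * z * A * B"
      unfolding A_def B_def D_def by algebra
    moreover have "slash_coeff3 s True False y z =
        (s^2 * (z^2 - 1) * ((y * z)^2 - 1) * A + ((s^2 - 1) * y + s * (y^2 - 1)) * z * ((s^2 - 1) * D + s * y * (z^2 - 1) * (s^2 - 1))) / (y^2 * z^2 * A * B * D)"
      "slash_coeff3 s False True z y =
        (((s^2 - 1) * z + s * (z^2 - 1)) * s * ((y * z)^2 - 1) * A + (s^2 - 1) * y * z * A * B) / (y^2 * z^2 * A * B * D)"
      unfolding m sp defs using abd that(1,2) by (simp_all add: field_simps power2_eq_square)
    ultimately show ?thesis by simp
  qed
  show ?thesis using TT FF TF[OF nz n] TF[OF nz(2,1) n(2,1) n'] by (cases b; cases c) simp_all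
qed

context laurent_system begin

text \<open>\<open>S k\<close> and \<open>E k\<close> are the automorphisms of the field induced by \<open>\<sigma>\<^sub>k\<close> and \<open>\<epsilon>\<^sub>k\<close>.\<close>

definition S :: "'i \<Rightarrow> 'i ratfun \<Rightarrow> 'i ratfun" where "S k = subst (sigma_pt \<alpha> q k Xvar)"
definition E :: "'i \<Rightarrow> 'i ratfun \<Rightarrow> 'i ratfun" where "E k = subst (eps_pt \<alpha> k Xvar)"
abbreviation "T k \<equiv> slash_simple \<alpha> q k"
abbreviation "y k \<equiv> ymon (\<alpha> k)"

definition chi :: "'i \<Rightarrow> 'v \<Rightarrow> complex" where "chi k x = (if even (phi \<alpha> k x) then 1 else - 1)"

lemma phi_add: "x \<in> L \<Longrightarrow> z \<in> L \<Longrightarrow> phi \<alpha> k (x + z) = phi \<alpha> k x + phi \<alpha> k z"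
  by (simp add: phi_def root_coord_add sum.distrib)

lemma phi_simple: "phi \<alpha> k (\<alpha> j) = (if adjacent \<alpha> j k then 1 else 0)"
  by (simp add: phi_def root_coord_simple if_distrib sum.If_cases cong: if_cong)

lemma root_coord_scale: "x \<in> L \<Longrightarrow> root_coord \<alpha> (of_int n *\<^sub>R x) i = n * root_coord \<alpha> x i"
proof -
  assume x: "x \<in> L"
  have "real_of_int (root_coord \<alpha> (of_int n *\<^sub>R x) i) = of_int n * of_int (root_coord \<alpha> x i)"
    using root_coord_eq[OF x] root_coord_eq[OF lattice_scale[OF x Ints_of_int]] by (simp add: crd_scale)
  then show ?thesis by (simp flip: of_int_mult)
qed

lemma phi_scale: "x \<in> L \<Longrightarrow> phi \<alpha> k (of_int n *\<^sub>R x) = n * phi \<alpha> k x"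
  by (simp add: phi_def root_coord_scale sum_distrib_left)

lemma phi_s:
  assumes "x \<in> L"
  shows "phi \<alpha> l (s k x) = phi \<alpha> l x - (if adjacent \<alpha> k l then 2 * root_coord \<alpha> x k - phi \<alpha> k x else 0)"
proof -
  have "s k x = x + of_int (phi \<alpha> k x - 2 * root_coord \<alpha> x k) *\<^sub>R \<alpha> k"
    by (simp add: s_eq pair_eq[OF assms] algebra_simps)
  then have "phi \<alpha> l (s k x) = phi \<alpha> l x + phi \<alpha> l (of_int (phi \<alpha> k x - 2 * root_coord \<alpha> x k) *\<^sub>R \<alpha> k)"
    by (simp only: phi_add[OF assms lattice_scale[OF lattice_simple Ints_of_int]])
  then show ?thesis unfolding phi_scale[OF lattice_simple] phi_simple by simp
qed

lemma chi_add: "x \<in> L \<Longrightarrow> z \<in> L \<Longrightarrow> chi k (x + z) = chi k x * chi k z"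
  by (simp add: chi_def phi_add)

lemma chi_s: "x \<in> L \<Longrightarrow> chi l (s k x) = (if adjacent \<alpha> k l then chi l x * chi k x else chi l x)"
  by (simp add: chi_def phi_s)

lemma chi_simple: "chi k (\<alpha> j) = (if adjacent \<alpha> j k then - 1 else 1)"
  by (simp add: chi_def phi_simple)

lemma chi_sq: "chi k x * chi k x = 1" and chi_nonzero: "chi k x \<noteq> 0"
  by (simp_all add: chi_def)

lemma sigma_pt_ymon: "sigma_pt \<alpha> q k Xvar = (\<lambda>i. const_fun (1 / sq) * ymon (s k (\<alpha> i)))"
proof
  fix i
  have q: "(of_nat q :: 'i ratfun) = sF * sF" by (simp add: sF_square)
  show "sigma_pt \<alpha> q k Xvar i = const_fun (1 / sq) * ymon (s k (\<alpha> i))"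
    using sF_nonzero Xvar_nonzero adjacent_irrefl
    by (auto simp: sigma_pt_def s_simple ymon_add lattice_simple ymon_minus ymon_simple sqrt_const_eq
       const_fun_divide const_fun_1 q field_simps)
qed

lemma eps_pt_ymon: "eps_pt \<alpha> k Xvar = (\<lambda>i. const_fun (chi k (\<alpha> i) / sq) * ymon (\<alpha> i))"
  using sF_nonzero
  by (auto simp: fun_eq_iff eps_pt_def chi_simple adjacent_sym[of k] ymon_simple const_fun_divide const_fun_1 const_fun_minus)

lemma linear_s: "linear (s k)" by (rule linear_reflect)
lemma inj_s_UNIV: "inj (s k)" by (rule inj_s)

lemma S_hom: "field_hom (S k)" and S_Xvar: "S k (Xvar i) = const_fun (1 / sq) * ymon (s k (\<alpha> i))"
proof -
  have 1: "p = 0" if "eval_poly (\<lambda>i. const_fun (1 / sq) * ymon (s k (\<alpha> i))) p = 0" for p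
    by (rule eval_poly_injective[OF linear_s inj_s_UNIV s_lattice _ that]) (simp_all add: sq_nonzero)
  show "field_hom (S k)" "S k (Xvar i) = const_fun (1 / sq) * ymon (s k (\<alpha> i))"
    unfolding S_def sigma_pt_ymon
    by (rule field_hom_subst(1), erule 1) (rule field_hom_subst(2), erule 1)
qed

lemma E_hom: "field_hom (E k)" and E_Xvar: "E k (Xvar i) = const_fun (chi k (\<alpha> i) / sq) * ymon (\<alpha> i)"
proof -
  have 1: "p = 0" if "eval_poly (\<lambda>i. const_fun (chi k (\<alpha> i) / sq) * ymon (\<alpha> i)) p = 0" for p
    by (rule eval_poly_injective[of "\<lambda>x. x", OF _ _ _ _ that]) (simp_all add: sq_nonzero chi_nonzero linear_ident)
  show "field_hom (E k)" "E k (Xvar i) = const_fun (chi k (\<alpha> i) / sq) * ymon (\<alpha> i)"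
    unfolding E_def eps_pt_ymon
    by (rule field_hom_subst(1), erule 1) (rule field_hom_subst(2), erule 1)
qed

lemma S_ymon: "x \<in> L \<Longrightarrow> S k (ymon x) = ymon (s k x)"
  by (rule hom_ymon[OF S_hom])
     (simp_all add: s_add ymon_add s_lattice ymon_nonzero ymon_simple hom_mult[OF S_hom] hom_const[OF S_hom] S_Xvar
       sq_nonzero const_fun_1 flip: mult.assoc const_fun_mult)

lemma E_ymon: "x \<in> L \<Longrightarrow> E k (ymon x) = const_fun (chi k x) * ymon x"
proof (rule hom_ymon[OF E_hom])
  fix i
  have "E k (y i) = sF * (const_fun (chi k (\<alpha> i) / sq) * y i)"
    unfolding ymon_simple[of i] hom_mult[OF E_hom] hom_const[OF E_hom] E_Xvar ..
  then show "E k (y i) = const_fun (chi k (\<alpha> i)) * y i"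
    using sF_nonzero by (simp add: const_fun_divide const_fun_mult)
qed (simp_all add: ymon_add chi_add const_fun_mult ymon_nonzero chi_nonzero const_fun_eq_0_iff)

lemma hom_eqI_ymon:
  fixes \<phi> \<psi> :: "'i ratfun \<Rightarrow> 'i ratfun"
  assumes "field_hom \<phi>" "field_hom \<psi>" "\<And>x. x \<in> L \<Longrightarrow> \<phi> (ymon x) = \<psi> (ymon x)"
  shows "\<phi> f = \<psi> f"
proof -
  have "\<phi> = \<psi>"
    by (rule field_hom_eqI[OF assms(1,2)])
       (simp add: Xvar_ymon hom_divide[OF assms(1)] hom_divide[OF assms(2)] hom_const[OF assms(1)]
         hom_const[OF assms(2)] assms(3) lattice_simple)
  then show ?thesis by simp
qed

lemmas S_simps = hom_add[OF S_hom] hom_mult[OF S_hom] hom_const[OF S_hom] hom_0[OF S_hom] hom_1[OF S_hom]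
  hom_minus[OF S_hom] hom_diff[OF S_hom] hom_inverse[OF S_hom] hom_divide[OF S_hom] hom_power[OF S_hom]
  hom_sum[OF S_hom] hom_prod[OF S_hom] hom_2[OF S_hom]
lemmas E_simps = hom_add[OF E_hom] hom_mult[OF E_hom] hom_const[OF E_hom] hom_0[OF E_hom] hom_1[OF E_hom]
  hom_minus[OF E_hom] hom_diff[OF E_hom] hom_inverse[OF E_hom] hom_divide[OF E_hom] hom_power[OF E_hom]
  hom_sum[OF E_hom] hom_prod[OF E_hom] hom_2[OF E_hom]

lemma S_S: "S k (S k f) = f"
  using hom_eqI_ymon[of "\<lambda>f. S k (S k f)" "\<lambda>f. f" f]
  by (simp add: field_hom_comp S_hom field_hom_id S_ymon s_lattice s_s)

lemma S_commute: "k \<noteq> l \<Longrightarrow> \<not> adjacent \<alpha> k l \<Longrightarrow> S k (S l f) = S l (S k f)"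
  by (rule hom_eqI_ymon[of "\<lambda>f. S k (S l f)" "\<lambda>f. S l (S k f)" f])
     (simp_all add: field_hom_comp S_hom S_ymon s_lattice s_commute[of k l])

lemma S_braid: "adjacent \<alpha> k l \<Longrightarrow> S k (S l (S k f)) = S l (S k (S l f))"
  by (rule hom_eqI_ymon[of "\<lambda>f. S k (S l (S k f))" "\<lambda>f. S l (S k (S l f))" f])
     (simp_all add: field_hom_comp[OF S_hom field_hom_comp] S_hom S_ymon s_lattice s_braid[of k l])

lemma E_E: "E k (E k f) = f"
  using hom_eqI_ymon[of "\<lambda>f. E k (E k f)" "\<lambda>f. f" f]
  by (simp add: field_hom_comp E_hom field_hom_id E_ymon E_simps chi_sq const_fun_1 flip: mult.assoc const_fun_mult)

lemma E_commute: "E k (E l f) = E l (E k f)"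
  using hom_eqI_ymon[of "\<lambda>f. E k (E l f)" "\<lambda>f. E l (E k f)" f]
  by (simp add: field_hom_comp E_hom E_ymon E_simps mult.left_commute)

text \<open>The sign characters are permuted by the reflections like the classes of the roots modulo twice the
  lattice.\<close>

lemma E_S: "E l (S k f) = S k (if adjacent \<alpha> k l then E l (E k f) else E l f)"
proof (cases "adjacent \<alpha> k l")
  case True
  have "E l (S k f) = S k (E l (E k f))"
  proof (rule hom_eqI_ymon[OF field_hom_comp[OF E_hom S_hom] field_hom_comp[OF S_hom field_hom_comp[OF E_hom E_hom]]])
    fix x assume x: "x \<in> L"
    have "chi l (s k x) = chi k x * chi l x" using True x by (simp add: chi_s)
    then show "E l (S k (ymon x)) = S k (E l (E k (ymon x)))"
      using x by (simp add: E_ymon S_ymon s_lattice hom_mult[OF E_hom] hom_const[OF E_hom] hom_mult[OF S_hom]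
        hom_const[OF S_hom] const_fun_mult)
  qed
  then show ?thesis using True by simp
next
  case False
  have "E l (S k f) = S k (E l f)"
  proof (rule hom_eqI_ymon[OF field_hom_comp[OF E_hom S_hom] field_hom_comp[OF S_hom E_hom]])
    fix x assume x: "x \<in> L"
    have "chi l (s k x) = chi l x" using False x by (simp add: chi_s)
    then show "E l (S k (ymon x)) = S k (E l (ymon x))"
      using x by (simp add: E_ymon S_ymon s_lattice hom_mult[OF S_hom] hom_const[OF S_hom])
  qed
  then show ?thesis using False by simp
qed

lemma T_eq: "T k f = slash_coeff sF True (y k) * S k ((f + E k f) / 2) + slash_coeff sF False (y k) * S k ((f - E k f) / 2)"
proof -
  have 1: "of_nat q * Xvar k = sF * y k" by (simp add: ymon_simple sF_square flip: mult.assoc)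
  have 2: "sF * y k * (1 - Xvar k) = y k * (sF - y k)" by (simp add: ymon_simple algebra_simps)
  have "- ((1 - of_nat q * Xvar k) / (of_nat q * Xvar k * (1 - Xvar k))) = slash_coeff sF True (y k)"
    unfolding slash_coeff_def if_True 1 2 minus_divide_left by simp
  moreover have "1 / (Xvar k * sqrt_const q) = slash_coeff sF False (y k)"
    using sF_nonzero by (simp add: slash_coeff_def sqrt_const_eq ymon_simple mult.commute)
  ultimately show ?thesis
    by (simp only: slash_simple_def even_part_def odd_part_def S_def E_def)
qed

end

lemma hom_slash_coeff: "field_hom \<phi> \<Longrightarrow> \<phi> (slash_coeff (const_fun c) b x) = slash_coeff (const_fun c) b (\<phi> x)"
  by (simp add: slash_coeff_def hom_divide hom_diff hom_mult hom_1 hom_const)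

lemma hom_slash_coeff2:
  "field_hom \<phi> \<Longrightarrow> \<phi> (slash_coeff2 (const_fun c) p b x z) = slash_coeff2 (const_fun c) p b (\<phi> x) (\<phi> z)"
  by (simp add: slash_coeff2_def hom_slash_coeff hom_divide hom_diff hom_add hom_minus hom_mult hom_2)

context laurent_system begin

lemma ymon_neq_const: "x \<in> L \<Longrightarrow> x \<noteq> 0 \<Longrightarrow> ymon x \<noteq> const_fun c"
proof
  assume x: "x \<in> L" "x \<noteq> 0" "ymon x = const_fun c"
  have "(\<Sum>z\<in>{x, 0}. const_fun (if z = x then 1 else - c) * ymon z) = 0"
    using x by (simp add: const_fun_1 const_fun_minus ymon_zero)
  from ymon_sum_zero[OF _ _ this, of x] x lattice_zero show False by auto
qed

lemma T_add: "T k (f + g) = T k f + T k g"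
  by (simp add: T_eq S_simps E_simps add_divide_distrib diff_divide_distrib algebra_simps)

text \<open>The slash operators are linear over the functions that are fixed by \<open>\<epsilon>\<^sub>k\<close>, up to the
  reflection.\<close>

lemma T_mult: "E k g = g \<Longrightarrow> T k (g * f) = S k g * T k f"
  by (simp add: T_eq S_simps E_simps add_divide_distrib diff_divide_distrib algebra_simps)

lemma T_const: "T k (const_fun c * f) = const_fun c * T k f"
  using T_mult[of k "const_fun c" f] by (simp add: E_simps S_simps)

lemma T_zero: "T k 0 = 0" using T_add[of k 0 0] by simp

lemma T_sum: "T k (sum h A) = (\<Sum>a\<in>A. T k (h a))"
  by (induction A rule: infinite_finite_induct) (auto simp: T_add T_zero)

definition has_parity :: "'i \<Rightarrow> bool \<Rightarrow> 'i ratfun \<Rightarrow> bool" where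
  "has_parity k b f \<longleftrightarrow> E k f = (if b then f else - f)"

lemma T_has_parity: "has_parity k b f \<Longrightarrow> T k f = slash_coeff sF b (y k) * S k f"
  by (cases b) (simp_all add: T_eq has_parity_def S_simps)

lemma S_y: "S k (y k) = 1 / y k" "adjacent \<alpha> k l \<Longrightarrow> S k (y l) = y k * y l"
  "k \<noteq> l \<Longrightarrow> \<not> adjacent \<alpha> k l \<Longrightarrow> S k (y l) = y l"
  by (auto simp: S_ymon s_simple adjacent_irrefl lattice_simple ymon_minus ymon_add inverse_eq_divide)

lemma E_y: "E k (y k) = y k" "adjacent \<alpha> k l \<Longrightarrow> E k (y l) = - y l" "\<not> adjacent \<alpha> k l \<Longrightarrow> E k (y l) = y l"
  using adjacent_sym[of k l]
  by (auto simp: E_ymon chi_simple adjacent_irrefl lattice_simple const_fun_1 const_fun_minus)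

lemma sF_ne: "sF \<noteq> y k" "sF * y k \<noteq> 1" "sF^2 \<noteq> (y k)^2" "adjacent \<alpha> k l \<Longrightarrow> sF^2 \<noteq> (y k * y l)^2"
proof -
  show "sF \<noteq> y k" using ymon_neq_const[OF lattice_simple simple_nonzero] by metis
  have "ymon (\<alpha> k) \<noteq> const_fun (1 / sq)" by (rule ymon_neq_const[OF lattice_simple simple_nonzero])
  then show "sF * y k \<noteq> 1" using sF_nonzero by (auto simp: const_fun_divide const_fun_1 field_simps)
  have *: "(ymon x)^2 \<noteq> sF^2" if "x \<in> L" "x \<noteq> 0" for x
  proof -
    have "(ymon x)^2 = ymon (x + x)" using that by (simp add: ymon_add power2_eq_square)
    moreover have "x + x \<noteq> 0" using that(2) by (simp flip: scaleR_2)
    moreover have "sF^2 = const_fun (sq^2)" by (simp add: const_fun_power)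
    ultimately show ?thesis using ymon_neq_const[of "x + x"] that lattice_add by metis
  qed
  show "sF^2 \<noteq> (y k)^2" using *[OF lattice_simple simple_nonzero] by metis
  assume a: "adjacent \<alpha> k l"
  have "s k (\<alpha> l) = \<alpha> l + \<alpha> k" using a by (simp add: s_simple)
  then have "\<alpha> k + \<alpha> l \<noteq> 0" using s_root[OF simple_root] zero_notin by (metis add.commute)
  then show "sF^2 \<noteq> (y k * y l)^2"
    using *[of "\<alpha> k + \<alpha> l"] by (metis lattice_add lattice_simple ymon_add)
qed

text \<open>Every function is the sum of its four simultaneous eigenparts under \<open>\<epsilon>\<^sub>k\<close> and \<open>\<epsilon>\<^sub>l\<close>.
  On an eigenpart a slash operator is a field automorphism followed by multiplication by an explicit
  coefficient (\<open>T_has_parity\<close>).\<close>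

lemma parity_induct:
  assumes "\<And>f g. P f \<Longrightarrow> P g \<Longrightarrow> P (f + g)" "\<And>b c f. has_parity k b f \<Longrightarrow> has_parity l c f \<Longrightarrow> P f"
  shows "P f"
proof -
  define part where "part k b f = (f + (if b then E k f else - E k f)) / 2" for k b f
  have split: "f = part k True f + part k False f" for k f
    by (simp add: part_def add_divide_distrib[symmetric])
  have par1: "has_parity k b (part k b f)" for k b f
    by (simp add: part_def has_parity_def E_simps E_E add.commute) (simp add: field_simps)
  have par2: "has_parity l c (part k b f)" if "has_parity l c f" for k l b c f
    using that by (cases c; simp add: part_def has_parity_def E_simps E_commute[of l k]; simp add: field_simps)
  have "P (part k b (part l c f))" for b c by (rule assms(2)) (auto intro: par1 par2)
  then have "P (part l c f)" for c using assms(1) split[of "part l c f" k] by metis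
  then show ?thesis using assms(1) split[of f l] by metis
qed

lemma has_parity_S_self: "has_parity k b f \<Longrightarrow> has_parity k b (S k f)"
  by (auto simp: has_parity_def E_S adjacent_irrefl S_simps)

lemma T_T: "T k (T k f) = f"
proof (rule parity_induct[of _ k k])
  fix b c f assume p: "has_parity k b f"
  have n: "sF - y k \<noteq> 0" "sF * y k - 1 \<noteq> 0" "y k \<noteq> 0" using sF_ne[of k] ymon_nonzero by auto
  have c1: "slash_coeff sF b (y k) * slash_coeff sF b (1 / y k) = 1"
  proof (cases b)
    case True
    have "sF * (1 / y k) - 1 = (sF - y k) / y k" "1 / y k * (sF - 1 / y k) = (sF * y k - 1) / (y k * y k)"
      using n by (simp_all add: field_simps)
    then show ?thesis using True n by (simp add: slash_coeff_def)
  next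
    case False
    then show ?thesis using n by (simp add: slash_coeff_def)
  qed
  have "T k (T k f) = T k (slash_coeff sF b (y k) * S k f)" using T_has_parity[OF p] by simp
  also have "\<dots> = S k (slash_coeff sF b (y k)) * T k (S k f)"
    by (rule T_mult) (simp add: hom_slash_coeff[OF E_hom] E_y)
  also have "\<dots> = slash_coeff sF b (1 / y k) * (slash_coeff sF b (y k) * f)"
    by (simp add: hom_slash_coeff[OF S_hom] S_y T_has_parity[OF has_parity_S_self[OF p]] S_S)
  also have "\<dots> = (slash_coeff sF b (y k) * slash_coeff sF b (1 / y k)) * f" by (simp only: mult_ac)
  finally show "T k (T k f) = f" by (simp only: c1 mult_1_left)
qed (simp add: T_add)

lemma T_commute:
  assumes "k \<noteq> l" "\<not> adjacent \<alpha> k l" shows "T k (T l f) = T l (T k f)"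
proof (rule parity_induct[where P = "\<lambda>f. T k (T l f) = T l (T k f)" and k = k and l = l])
  fix b c f assume p: "has_parity k b f" "has_parity l c f"
  have *: "T k (T l f) = slash_coeff sF b (y k) * slash_coeff sF c (y l) * S k (S l f)"
    if p: "has_parity k b f" "has_parity l c f" and kl: "k \<noteq> l" "\<not> adjacent \<alpha> k l" for k l b c f
  proof -
    have lk: "\<not> adjacent \<alpha> l k" using kl adjacent_sym by blast
    have "has_parity k b (S l f)" using p(1) lk by (auto simp: has_parity_def E_S S_simps)
    then have "T k (S l f) = slash_coeff sF b (y k) * S k (S l f)" by (rule T_has_parity)
    moreover have "T k (slash_coeff sF c (y l) * S l f) = S k (slash_coeff sF c (y l)) * T k (S l f)"
      by (rule T_mult) (simp add: hom_slash_coeff[OF E_hom] E_y kl)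
    ultimately show ?thesis
      using T_has_parity[OF p(2)] by (simp add: hom_slash_coeff[OF S_hom] S_y kl)
  qed
  have lk: "l \<noteq> k" "\<not> adjacent \<alpha> l k" using assms adjacent_sym by blast+
  show "T k (T l f) = T l (T k f)"
    using *[OF p assms] *[OF p(2,1) lk] S_commute[OF assms] by simp
qed (simp add: T_add)

lemma T_prod:
  assumes "has_parity l b h"
  shows "T l (g * h) = (slash_coeff sF b (y l) * S l ((g + E l g) / 2) +
    slash_coeff sF (\<not> b) (y l) * S l ((g - E l g) / 2)) * S l h"
proof -
  have g: "g * h = (g + E l g) / 2 * h + (g - E l g) / 2 * h" by (simp add: field_simps)
  have "T l ((g + E l g) / 2 * h) = S l ((g + E l g) / 2) * T l h"
    by (rule T_mult) (simp add: E_simps E_E add.commute)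
  moreover have "has_parity l (\<not> b) ((g - E l g) / 2 * h)"
    using assms by (auto simp: has_parity_def E_simps E_E field_simps)
  then have "T l ((g - E l g) / 2 * h) = slash_coeff sF (\<not> b) (y l) * (S l ((g - E l g) / 2) * S l h)"
    unfolding hom_mult[OF S_hom, symmetric] by (rule T_has_parity)
  ultimately have "T l ((g + E l g) / 2 * h + (g - E l g) / 2 * h) =
      S l ((g + E l g) / 2) * (slash_coeff sF b (y l) * S l h) +
      slash_coeff sF (\<not> b) (y l) * (S l ((g - E l g) / 2) * S l h)"
    by (simp only: T_add T_has_parity[OF assms])
  then show ?thesis unfolding g[symmetric] by (simp only: distrib_right distrib_left mult_ac)
qed

lemma T_braid_has_parity:
  assumes kl: "adjacent \<alpha> k l" and p: "has_parity k b f" "has_parity l c f"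
  shows "T k (T l (T k f)) = slash_coeff3 sF b c (y k) (y l) * S k (S l (S k f))"
proof -
  have lk: "adjacent \<alpha> l k" using kl adjacent_sym by blast
  have p1: "has_parity l (b = c) (S k f)"
    using p kl by (cases b; cases c; simp add: has_parity_def E_S S_simps E_simps)
  have p2: "has_parity k c (S l (S k f))"
    using p kl lk by (cases b; cases c; simp add: has_parity_def E_S S_simps E_simps adjacent_irrefl E_E)
  let ?G = "slash_coeff2 sF (b = c) b (y k) (y l)"
  have "T l (T k f) = T l (slash_coeff sF b (y k) * S k f)" by (simp add: T_has_parity[OF p(1)])
  also have "\<dots> = ?G * S l (S k f)"
    unfolding T_prod[OF p1] slash_coeff2_def
    by (simp add: S_simps hom_slash_coeff[OF S_hom] hom_slash_coeff[OF E_hom] S_y E_y kl lk mult.commute)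
  finally have "T k (T l (T k f)) = T k (?G * S l (S k f))" by simp
  also have "\<dots> = slash_coeff3 sF b c (y k) (y l) * S k (S l (S k f))"
    unfolding T_prod[OF p2] slash_coeff3_def
    by (simp add: S_simps hom_slash_coeff2[OF S_hom] hom_slash_coeff2[OF E_hom] S_y E_y kl lk)
  finally show ?thesis .
qed

lemma T_braid:
  assumes "adjacent \<alpha> k l" shows "T k (T l (T k f)) = T l (T k (T l f))"
proof (rule parity_induct[where P = "\<lambda>f. T k (T l (T k f)) = T l (T k (T l f))" and k = k and l = l])
  fix b c f assume p: "has_parity k b f" "has_parity l c f"
  have lk: "adjacent \<alpha> l k" using assms adjacent_sym by blast
  have "slash_coeff3 sF b c (y k) (y l) = slash_coeff3 sF c b (y l) (y k)"
    by (rule slash_coeff3_sym) (use ymon_nonzero sF_ne[of k] sF_ne[of l] sF_ne(4)[OF assms] in auto)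
  then show "T k (T l (T k f)) = T l (T k (T l f))"
    using T_braid_has_parity[OF assms p] T_braid_has_parity[OF lk p(2,1)] S_braid[OF assms] by simp
qed (simp add: T_add)

lemma T_word: "wp is = wp js \<Longrightarrow> fold T is = fold T js"
  by (rule Matsumoto[OF T_T T_commute T_braid])

section \<open>The averaged function\<close>

text \<open>The factor of \<open>\<Delta>\<close> at \<open>\<beta>\<close> for \<open>c = 1\<close>, and of \<open>D\<close> for \<open>c = 1/q\<close>.\<close>

definition fac :: "complex \<Rightarrow> 'v \<Rightarrow> 'i ratfun" where
  "fac c \<beta> = 1 - const_fun c * ymon (2 *\<^sub>R \<beta>)"

lemma double_lattice: "x \<in> L \<Longrightarrow> 2 *\<^sub>R x \<in> L" by (simp add: lattice_scale)

lemma height_double: "x \<in> L \<Longrightarrow> height \<alpha> (2 *\<^sub>R x) = 2 * height \<alpha> x"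
  by (simp add: scaleR_2 height_add)

lemma ymon_double: "x \<in> L \<Longrightarrow> ymon (2 *\<^sub>R x) = of_nat q powi height \<alpha> x * monomial \<alpha> (2 *\<^sub>R x)"
  unfolding ymon_def height_double sF_square[symmetric]
  by (simp add: height_double power_int_mult_distrib power_int_add[symmetric] sF_nonzero flip: mult_2)

lemma Delta_eq: "Delta \<Phi> \<alpha> q = (\<Prod>\<beta>\<in>Pos. fac 1 \<beta>)"
  unfolding Delta_def fac_def
  by (rule prod.cong) (auto simp: ymon_double root_lattice_root pos_root const_fun_1)

lemma Dprod_eq: "Dprod \<Phi> \<alpha> q = (\<Prod>\<beta>\<in>Pos. fac (1 / of_nat q) \<beta>)"
proof -
  have "(of_nat q :: 'i ratfun) \<noteq> 0" using q_gt_1 by simp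
  then show ?thesis
    unfolding Dprod_def fac_def
    by (intro prod.cong) (auto simp: ymon_double root_lattice_root pos_root const_fun_divide const_fun_1
         const_fun_of_nat power_int_diff)
qed

lemma fac_nonzero: "\<beta> \<in> \<Phi> \<Longrightarrow> fac c \<beta> \<noteq> 0"
proof
  assume b: "\<beta> \<in> \<Phi>" "fac c \<beta> = 0"
  then have e: "const_fun c * ymon (2 *\<^sub>R \<beta>) = 1" by (simp add: fac_def)
  then have "c \<noteq> 0" by (auto simp: const_fun_0)
  then have "ymon (2 *\<^sub>R \<beta>) = const_fun (1 / c)"
    using e by (simp add: const_fun_divide const_fun_1 const_fun_eq_0_iff field_simps)
  moreover have "2 *\<^sub>R \<beta> \<noteq> 0" using b zero_notin by auto
  ultimately show False using ymon_neq_const[OF double_lattice[OF root_lattice_root[OF b(1)]]] by blast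
qed

lemma E_fac: "\<beta> \<in> L \<Longrightarrow> E k (fac c \<beta>) = fac c \<beta>"
  by (simp add: fac_def E_simps E_ymon double_lattice scaleR_2 chi_add lattice_add chi_sq const_fun_1)

lemma S_fac: "\<beta> \<in> L \<Longrightarrow> S k (fac c \<beta>) = fac c (s k \<beta>)"
  by (simp add: fac_def S_simps S_ymon double_lattice s_scale)

abbreviation "Del \<equiv> Delta \<Phi> \<alpha> q"

lemma Delta_nonzero: "Del \<noteq> 0"
  by (simp add: Delta_eq finite_Pos fac_nonzero pos_root)

definition even_elt :: "'i ratfun \<Rightarrow> bool" where "even_elt g \<longleftrightarrow> (\<forall>k. E k g = g)"

lemma even_S: "even_elt g \<Longrightarrow> even_elt (S k g)"
  by (simp add: even_elt_def E_S)

lemma even_fac: "\<beta> \<in> L \<Longrightarrow> even_elt (fac c \<beta>)" by (simp add: even_elt_def E_fac)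

lemma even_inverse: "even_elt f \<Longrightarrow> even_elt (inverse f)"
  by (simp add: even_elt_def E_simps)

lemma even_prod: "(\<And>a. a \<in> A \<Longrightarrow> even_elt (h a)) \<Longrightarrow> even_elt (prod h A)"
  by (simp add: even_elt_def E_simps)

lemma even_Delta: "even_elt Del"
  unfolding Delta_eq by (intro even_prod even_fac root_lattice_root pos_root)

lemma fold_S_hom: "field_hom (fold S is)"
  by (induction "is") (simp_all add: field_hom_id field_hom_comp[OF _ S_hom] o_def)

lemma fold_T_mult: "even_elt g \<Longrightarrow> fold T is (g * f) = fold S is g * fold T is f"
proof (induction "is" arbitrary: f g)
  case (Cons k "is")
  then show ?case using T_mult[of k g f] even_S[of g k] by (simp add: even_elt_def)
qed simp

lemma hom_sigma_pt:
  assumes "field_hom \<phi>" shows "(\<lambda>j. \<phi> (sigma_pt \<alpha> q k x j)) = sigma_pt \<alpha> q k (\<lambda>j. \<phi> (x j))"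
  by (auto simp: sigma_pt_def fun_eq_iff hom_mult[OF assms] hom_divide[OF assms] hom_1[OF assms]
      hom_of_nat[OF assms] sqrt_const_eq hom_const[OF assms])

lemma weyl_word: "foldr (sigma_pt \<alpha> q) is Xvar = (\<lambda>j. fold S is (Xvar j))"
proof (induction "is")
  case (Cons k "is")
  have "S k (Xvar j) = sigma_pt \<alpha> q k Xvar j" for j by (simp add: S_Xvar sigma_pt_ymon)
  then have "(\<lambda>j. fold S (k # is) (Xvar j)) = (\<lambda>j. fold S is (sigma_pt \<alpha> q k Xvar j))" by simp
  then show ?case using Cons hom_sigma_pt[OF fold_S_hom] by simp
qed simp

text \<open>The cocycle is exactly what is needed to move \<open>1/\<Delta>\<close> inside the slash action, since \<open>\<Delta>\<close> is
  fixed by all \<open>\<epsilon>\<^sub>k\<close>.\<close>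

lemma averaged_eq: "averaged \<Phi> \<alpha> q = (\<Sum>w\<in>W. fold T (word_of \<alpha> w) (inverse Del))"
proof -
  have "inverse Del * (cocycle \<Phi> \<alpha> q w * slash \<alpha> q 1 w) = fold T (word_of \<alpha> w) (inverse Del)" for w
  proof -
    have "subst (weyl_pt \<alpha> q w Xvar) Del = fold S (word_of \<alpha> w) Del"
      unfolding weyl_pt_def weyl_word by (rule subst_eqI[OF fold_S_hom])
    moreover have "slash \<alpha> q 1 w = fold T (word_of \<alpha> w) 1"
      by (simp add: slash_def foldl_conv_fold)
    moreover have "fold T (word_of \<alpha> w) (inverse Del * 1) = fold S (word_of \<alpha> w) (inverse Del) * fold T (word_of \<alpha> w) 1"
      by (rule fold_T_mult[OF even_inverse[OF even_Delta]])
    ultimately show ?thesis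
      using Delta_nonzero by (simp add: cocycle_def hom_inverse[OF fold_S_hom] divide_inverse)
  qed
  then show ?thesis unfolding averaged_def sum_distrib_left by simp
qed

lemma W_comp: "w \<in> W \<Longrightarrow> w \<circ> s k \<in> W"
  unfolding Weyl_iff by (metis wp_snoc)

lemma T_averaged: "T k (averaged \<Phi> \<alpha> q) = averaged \<Phi> \<alpha> q"
proof -
  have "T k (averaged \<Phi> \<alpha> q) = (\<Sum>w\<in>W. fold T (word_of \<alpha> w @ [k]) (inverse Del))"
    by (simp add: averaged_eq T_sum)
  also have "\<dots> = (\<Sum>w\<in>W. fold T (word_of \<alpha> (w \<circ> s k)) (inverse Del))"
  proof (rule sum.cong[OF refl])
    fix w assume w: "w \<in> W"
    have "wp (word_of \<alpha> w @ [k]) = wp (word_of \<alpha> (w \<circ> s k))"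
      by (simp only: wp_snoc word_of[OF w] word_of[OF W_comp[OF w]])
    then show "fold T (word_of \<alpha> w @ [k]) (inverse Del) = fold T (word_of \<alpha> (w \<circ> s k)) (inverse Del)"
      using T_word by metis
  qed
  also have "\<dots> = (\<Sum>w\<in>W. fold T (word_of \<alpha> w) (inverse Del))"
  proof (rule sum.reindex_bij_witness[of _ "\<lambda>w. w \<circ> s k" "\<lambda>w. w \<circ> s k"])
    fix w assume w: "w \<in> W"
    show "w \<circ> s k \<circ> s k = w" by (simp only: o_assoc[symmetric] s_comp_s comp_id)
    then show "w \<circ> s k \<circ> s k = w" .
  qed (auto simp only: W_comp)
  finally show ?thesis by (simp add: averaged_eq)
qed

section \<open>Laurent polynomials\<close>

text \<open>\<open>R\<close>, the case \<open>A = L\<close>, is the ring of Laurent polynomials.\<close>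

definition lspan :: "'v set \<Rightarrow> 'i ratfun set" where "lspan A = rf.span (ymon ` A)"

abbreviation "R \<equiv> lspan L"

definition coef :: "'i ratfun \<Rightarrow> 'v \<Rightarrow> complex" where
  "coef g x = (if x \<in> L then rf.representation (ymon ` L) g (ymon x) else 0)"

lemma lspan_induct [consumes 1, case_names zero add]:
  assumes "g \<in> lspan A" "P 0" "\<And>c x f. x \<in> A \<Longrightarrow> P f \<Longrightarrow> P (const_fun c * ymon x + f)"
  shows "P g"
  using assms(1) unfolding lspan_def
  by (rule rf.span_induct_alt) (use assms in auto)

lemma lspan_0: "0 \<in> lspan A"
  and lspan_add: "f \<in> lspan A \<Longrightarrow> g \<in> lspan A \<Longrightarrow> f + g \<in> lspan A"
  and lspan_diff: "f \<in> lspan A \<Longrightarrow> g \<in> lspan A \<Longrightarrow> f - g \<in> lspan A"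
  and lspan_minus: "f \<in> lspan A \<Longrightarrow> - f \<in> lspan A"
  and lspan_const: "f \<in> lspan A \<Longrightarrow> const_fun c * f \<in> lspan A"
  and lspan_ymon: "x \<in> A \<Longrightarrow> ymon x \<in> lspan A"
  and lspan_sum: "(\<And>a. a \<in> I \<Longrightarrow> h a \<in> lspan A) \<Longrightarrow> sum h I \<in> lspan A"
  and lspan_mono: "A \<subseteq> B \<Longrightarrow> lspan A \<subseteq> lspan B"
  unfolding lspan_def
  by (auto intro: rf.span_zero rf.span_add rf.span_diff rf.span_neg rf.span_scale rf.span_base rf.span_sum
      dest: rf.span_mono[OF image_mono])

lemma lspan_ymon_mult:
  assumes "g \<in> lspan B" "B \<subseteq> L" "x \<in> L" "\<And>z. z \<in> B \<Longrightarrow> x + z \<in> C"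
  shows "ymon x * g \<in> lspan C"
  using assms(1)
proof (induction rule: lspan_induct)
  case zero then show ?case by (simp add: lspan_0)
next
  case (add c z f)
  have "ymon x * (const_fun c * ymon z + f) = const_fun c * ymon (x + z) + ymon x * f"
    using add assms by (simp add: ymon_add subset_iff algebra_simps)
  then show ?case using add assms(4) by (simp add: lspan_add lspan_const lspan_ymon)
qed

lemma lspan_mult:
  assumes "f \<in> lspan A" "g \<in> lspan B" "A \<subseteq> L" "B \<subseteq> L" "\<And>x z. x \<in> A \<Longrightarrow> z \<in> B \<Longrightarrow> x + z \<in> C"
  shows "f * g \<in> lspan C"
  using assms(1)
proof (induction rule: lspan_induct)
  case zero then show ?case by (simp add: lspan_0)
next
  case (add c x f)
  have "ymon x * g \<in> lspan C" using lspan_ymon_mult[OF assms(2,4)] add assms by blast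
  then have "const_fun c * (ymon x * g) + f * g \<in> lspan C" using add by (simp add: lspan_add lspan_const)
  then show ?case by (simp add: algebra_simps)
qed

lemma R_mult: "f \<in> R \<Longrightarrow> g \<in> R \<Longrightarrow> f * g \<in> R"
  by (rule lspan_mult[of f L g L]) (auto simp: lattice_add)

lemma R_1: "1 \<in> R" using lspan_ymon[of 0 L] lattice_zero by (simp add: ymon_zero)

lemma R_const: "const_fun c \<in> R" using lspan_const[OF R_1, of c] by simp

lemma R_ymon: "x \<in> L \<Longrightarrow> ymon x \<in> R" by (rule lspan_ymon)

lemma R_fac: "\<beta> \<in> L \<Longrightarrow> fac c \<beta> \<in> R"
  unfolding fac_def by (intro lspan_diff R_1 lspan_const R_ymon double_lattice)

lemma R_prod: "(\<And>a. a \<in> A \<Longrightarrow> h a \<in> R) \<Longrightarrow> prod h A \<in> R"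
  by (induction A rule: infinite_finite_induct) (auto simp: R_1 R_mult)

lemma lspan_S:
  assumes "g \<in> lspan A" "A \<subseteq> L" "\<And>x. x \<in> A \<Longrightarrow> s k x \<in> B" shows "S k g \<in> lspan B"
  using assms(1)
proof (induction rule: lspan_induct)
  case zero then show ?case by (simp add: lspan_0 S_simps)
next
  case (add c x f)
  then show ?case using assms by (simp add: S_simps S_ymon lspan_add lspan_const lspan_ymon subset_iff)
qed

lemma R_S: "g \<in> R \<Longrightarrow> S k g \<in> R" by (rule lspan_S) (auto simp: s_lattice)

lemma lspan_E:
  assumes "g \<in> lspan A" "A \<subseteq> L" shows "E k g \<in> lspan A"
  using assms(1)
proof (induction rule: lspan_induct)
  case zero then show ?case by (simp add: lspan_0 E_simps)
next
  case (add c x f)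
  then show ?case using assms by (simp add: E_simps E_ymon lspan_add lspan_const lspan_ymon subset_iff)
qed

lemma R_half: "g \<in> lspan A \<Longrightarrow> g / 2 \<in> lspan A"
  using lspan_const[of g A "1 / 2"] by (simp add: const_fun_divide const_fun_1 const_fun_numeral)

lemma coef_zero: "coef 0 x = 0"
  by (simp add: coef_def rf.representation_zero)

lemma coef_add: "f \<in> R \<Longrightarrow> g \<in> R \<Longrightarrow> coef (f + g) x = coef f x + coef g x"
  and coef_diff: "f \<in> R \<Longrightarrow> g \<in> R \<Longrightarrow> coef (f - g) x = coef f x - coef g x"
  and coef_const: "f \<in> R \<Longrightarrow> coef (const_fun c * f) x = c * coef f x"
  using ymon_independent
  by (simp_all add: coef_def lspan_def rf.representation_add rf.representation_diff rf.representation_scale rf.representation_neg)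

lemma coef_ymon: "x \<in> L \<Longrightarrow> coef (ymon x) z = (if z = x then 1 else 0)"
  using rf.representation_basis[OF ymon_independent, of "ymon x"] inj_ymon
  by (auto simp: coef_def dest: inj_onD)

lemma coef_one: "coef 1 x = (if x = 0 then 1 else 0)"
  using coef_ymon[OF lattice_zero, of x] by (simp add: ymon_zero)

definition supp :: "'i ratfun \<Rightarrow> 'v set" where "supp g = {x. coef g x \<noteq> 0}"

lemma supp_lattice: "supp g \<subseteq> L" by (auto simp: supp_def coef_def)

lemma finite_supp: "finite (supp g)"
proof -
  have "ymon ` supp g \<subseteq> {b. rf.representation (ymon ` L) g b \<noteq> 0}"
    by (auto simp: supp_def coef_def split: if_splits)
  then have "finite (ymon ` supp g)" using rf.finite_representation finite_subset by blast
  then show ?thesis using inj_on_subset[OF inj_ymon supp_lattice] finite_imageD by blast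
qed

lemma coef_expand: assumes "g \<in> R" shows "g = (\<Sum>x\<in>supp g. const_fun (coef g x) * ymon x)"
proof -
  have inj: "inj_on ymon (supp g)" using inj_on_subset[OF inj_ymon supp_lattice] .
  have img: "{b. rf.representation (ymon ` L) g b \<noteq> 0} = ymon ` supp g"
  proof
    show "{b. rf.representation (ymon ` L) g b \<noteq> 0} \<subseteq> ymon ` supp g"
    proof
      fix b assume b: "b \<in> {b. rf.representation (ymon ` L) g b \<noteq> 0}"
      then obtain x where "x \<in> L" "b = ymon x" using rf.representation_ne_zero[of "ymon ` L" g b] by auto
      then show "b \<in> ymon ` supp g" using b by (auto simp: supp_def coef_def)
    qed
  qed (auto simp: supp_def coef_def split: if_splits)
  have "(\<Sum>b | rf.representation (ymon ` L) g b \<noteq> 0. const_fun (rf.representation (ymon ` L) g b) * b) = g"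
    using rf.sum_nonzero_representation_eq[OF ymon_independent] assms by (simp add: lspan_def)
  then have "g = (\<Sum>x\<in>supp g. const_fun (rf.representation (ymon ` L) g (ymon x)) * ymon x)"
    unfolding img sum.reindex[OF inj] by simp
  also have "\<dots> = (\<Sum>x\<in>supp g. const_fun (coef g x) * ymon x)"
    using supp_lattice[of g] by (intro sum.cong) (auto simp: coef_def)
  finally show ?thesis .
qed

lemma lspan_iff: "A \<subseteq> L \<Longrightarrow> g \<in> lspan A \<longleftrightarrow> g \<in> R \<and> supp g \<subseteq> A"
proof
  assume A: "A \<subseteq> L" and g: "g \<in> lspan A"
  have R: "f \<in> R" if "f \<in> lspan A" for f using lspan_mono[OF A] that by blast
  have "f \<in> lspan A \<and> coef f x = 0" if "f \<in> lspan A" "x \<notin> A" for f x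
    using that(1)
  proof (induction rule: lspan_induct)
    case zero then show ?case by (simp add: coef_zero lspan_0)
  next
    case (add c z f)
    then have "z \<in> L" "z \<noteq> x" using A that by auto
    then show ?case using add R by (auto simp: coef_add coef_const coef_ymon R_ymon lspan_const lspan_add lspan_ymon)
  qed
  then show "g \<in> R \<and> supp g \<subseteq> A" using R g by (auto simp: supp_def)
next
  assume "A \<subseteq> L" "g \<in> R \<and> supp g \<subseteq> A"
  moreover have "(\<Sum>x\<in>supp g. const_fun (coef g x) * ymon x) \<in> lspan A" if "supp g \<subseteq> A"
    using that by (intro lspan_sum lspan_const lspan_ymon) auto
  ultimately show "g \<in> lspan A" using coef_expand by metis
qed

lemma coef_ymon_mult:
  assumes "g \<in> R" "d \<in> L" shows "coef (ymon d * g) x = coef g (x - d)"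
proof -
  have "g \<in> R \<and> coef (ymon d * g) x = coef g (x - d)"
    using assms(1)
  proof (induction rule: lspan_induct)
    case zero then show ?case by (simp add: coef_zero lspan_0)
  next
    case (add c z f)
    have "ymon d * (const_fun c * ymon z + f) = const_fun c * ymon (d + z) + ymon d * f"
      using add assms by (simp add: ymon_add algebra_simps)
    moreover have "x = d + z \<longleftrightarrow> x - d = z" by (auto simp: algebra_simps)
    ultimately show ?case using add assms
      by (simp add: coef_add coef_const coef_ymon R_mult R_ymon lattice_add lspan_add lspan_const)
  qed
  then show ?thesis ..
qed

lemma coef_S: assumes "g \<in> R" shows "coef (S k g) x = coef g (s k x)"
proof -
  have "g \<in> R \<and> coef (S k g) x = coef g (s k x)"
    using assms
  proof (induction rule: lspan_induct)
    case zero then show ?case by (simp add: coef_zero lspan_0 S_simps)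
  next
    case (add c z f)
    moreover have "x = s k z \<longleftrightarrow> s k x = z" using s_s by metis
    ultimately show ?case
      by (simp add: coef_add coef_const coef_ymon R_ymon R_S s_lattice lspan_add lspan_const S_simps S_ymon)
  qed
  then show ?thesis ..
qed

lemma coef_E: assumes "g \<in> R" shows "coef (E k g) x = chi k x * coef g x"
proof -
  have "g \<in> R \<and> coef (E k g) x = chi k x * coef g x"
    using assms
  proof (induction rule: lspan_induct)
    case zero then show ?case by (simp add: coef_zero lspan_0 E_simps)
  next
    case (add c z f)
    then have "E k f \<in> R" by (simp add: lspan_E)
    then show ?case using add
      by (simp add: coef_add coef_const coef_ymon R_ymon lspan_add lspan_const E_simps E_ymon distrib_left)
  qed
  then show ?thesis ..
qed

definition lin_ext :: "('v \<Rightarrow> 'i ratfun) \<Rightarrow> 'i ratfun \<Rightarrow> 'i ratfun" where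
  "lin_ext g u = (\<Sum>z\<in>supp u. const_fun (coef u z) * g z)"

lemma lin_ext_superset: "finite A \<Longrightarrow> supp u \<subseteq> A \<Longrightarrow> lin_ext g u = (\<Sum>z\<in>A. const_fun (coef u z) * g z)"
  unfolding lin_ext_def by (rule sum.mono_neutral_left) (auto simp: supp_def const_fun_0)

lemma lin_ext_zero: "lin_ext g 0 = 0" by (simp add: lin_ext_def coef_zero supp_def)

lemma lin_ext_add:
  assumes "u \<in> R" "v \<in> R" shows "lin_ext g (u + v) = lin_ext g u + lin_ext g v"
proof -
  let ?A = "supp u \<union> supp v"
  have "supp (u + v) \<subseteq> ?A" by (auto simp: supp_def coef_add[OF assms])
  then show ?thesis
    by (simp add: lin_ext_superset[of ?A] finite_supp coef_add[OF assms] const_fun_add distrib_right sum.distrib)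
qed

lemma lin_ext_const: assumes "u \<in> R" shows "lin_ext g (const_fun c * u) = const_fun c * lin_ext g u"
proof -
  have "supp (const_fun c * u) \<subseteq> supp u" by (auto simp: supp_def coef_const[OF assms])
  then have "lin_ext g (const_fun c * u) = (\<Sum>z\<in>supp u. const_fun (coef (const_fun c * u) z) * g z)"
    by (rule lin_ext_superset[OF finite_supp])
  also have "\<dots> = const_fun c * lin_ext g u"
    unfolding lin_ext_def coef_const[OF assms] const_fun_mult sum_distrib_left mult.assoc ..
  finally show ?thesis .
qed

lemma lin_ext_ymon: "x \<in> L \<Longrightarrow> lin_ext g (ymon x) = g x"
  by (subst lin_ext_superset[of "{x}"]) (auto simp: supp_def coef_ymon const_fun_1)

section \<open>Divisibility by a factor of Delta\<close>

text \<open>Divisibility in the ring of Laurent polynomials by \<open>1 - y\<^sup>2\<^sup>\<beta>\<close>.\<close>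

definition wall_dvd :: "'v \<Rightarrow> 'i ratfun \<Rightarrow> bool" where
  "wall_dvd \<beta> u \<longleftrightarrow> (\<exists>v\<in>R. u = fac 1 \<beta> * v)"

lemma wall_dvd_0: "wall_dvd \<beta> 0" unfolding wall_dvd_def using lspan_0 by force

lemma wall_dvd_add: "wall_dvd \<beta> u \<Longrightarrow> wall_dvd \<beta> v \<Longrightarrow> wall_dvd \<beta> (u + v)"
  unfolding wall_dvd_def by (metis distrib_left lspan_add)

lemma wall_dvd_mult: "wall_dvd \<beta> u \<Longrightarrow> v \<in> R \<Longrightarrow> wall_dvd \<beta> (v * u)"
  unfolding wall_dvd_def using R_mult by (auto simp: mult.left_commute)

lemma wall_dvd_const: "wall_dvd \<beta> u \<Longrightarrow> wall_dvd \<beta> (const_fun c * u)" by (rule wall_dvd_mult[OF _ R_const])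

text \<open>A fixed representative of the string \<open>x + 2 \<int> \<beta>\<close>.\<close>

definition string_rep :: "'v \<Rightarrow> 'v \<Rightarrow> 'v" where
  "string_rep \<beta> x = (SOME z. \<exists>t::int. z = x + of_int t *\<^sub>R (2 *\<^sub>R \<beta>))"

lemma string_rep: "\<exists>t::int. string_rep \<beta> x = x + of_int t *\<^sub>R (2 *\<^sub>R \<beta>)"
  unfolding string_rep_def by (rule someI_ex) blast

lemma string_rep_shift: "string_rep \<beta> (x + of_int n *\<^sub>R (2 *\<^sub>R \<beta>)) = string_rep \<beta> x"
proof -
  have "(\<exists>t::int. z = (x + of_int n *\<^sub>R (2 *\<^sub>R \<beta>)) + of_int t *\<^sub>R (2 *\<^sub>R \<beta>)) \<longleftrightarrow>
      (\<exists>t::int. z = x + of_int t *\<^sub>R (2 *\<^sub>R \<beta>))" for z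
  proof
    assume "\<exists>t::int. z = (x + of_int n *\<^sub>R (2 *\<^sub>R \<beta>)) + of_int t *\<^sub>R (2 *\<^sub>R \<beta>)"
    then obtain t :: int where "z = (x + of_int n *\<^sub>R (2 *\<^sub>R \<beta>)) + of_int t *\<^sub>R (2 *\<^sub>R \<beta>)" ..
    then have "z = x + of_int (n + t) *\<^sub>R (2 *\<^sub>R \<beta>)" by (simp only: of_int_add scaleR_add_left add.assoc)
    then show "\<exists>t::int. z = x + of_int t *\<^sub>R (2 *\<^sub>R \<beta>)" by blast
  next
    assume "\<exists>t::int. z = x + of_int t *\<^sub>R (2 *\<^sub>R \<beta>)"
    then obtain t :: int where "z = x + of_int t *\<^sub>R (2 *\<^sub>R \<beta>)" ..
    then have "z = (x + of_int n *\<^sub>R (2 *\<^sub>R \<beta>)) + of_int (t - n) *\<^sub>R (2 *\<^sub>R \<beta>)"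
      by (simp add: scaleR_diff_left)
    then show "\<exists>t::int. z = (x + of_int n *\<^sub>R (2 *\<^sub>R \<beta>)) + of_int t *\<^sub>R (2 *\<^sub>R \<beta>)" by blast
  qed
  then show ?thesis unfolding string_rep_def by simp
qed

abbreviation "string_proj \<beta> \<equiv> lin_ext (\<lambda>z. ymon (string_rep \<beta> z))"

lemma string_rep_lattice: "\<beta> \<in> L \<Longrightarrow> x \<in> L \<Longrightarrow> string_rep \<beta> x \<in> L"
  using string_rep[of \<beta> x] by (metis Ints_of_int double_lattice lattice_add lattice_scale)

lemma string_proj_shift:
  assumes "\<beta> \<in> L" "u \<in> R" shows "string_proj \<beta> (ymon (of_int n *\<^sub>R (2 *\<^sub>R \<beta>)) * u) = string_proj \<beta> u"
proof -
  let ?d = "of_int n *\<^sub>R (2 *\<^sub>R \<beta>)"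
  have d: "?d \<in> L" using assms by (simp add: lattice_scale)
  have "u \<in> R \<and> string_proj \<beta> (ymon ?d * u) = string_proj \<beta> u"
    using assms(2)
  proof (induction rule: lspan_induct)
    case zero then show ?case by (simp add: lin_ext_zero lspan_0)
  next
    case (add c x f)
    have "ymon ?d * (const_fun c * ymon x + f) = const_fun c * ymon (x + ?d) + ymon ?d * f"
      using add d by (simp add: ymon_add algebra_simps)
    then show ?case using add d string_rep_shift[of \<beta> x n]
      by (simp add: lin_ext_add lin_ext_const lin_ext_ymon R_mult R_ymon lspan_const lspan_add lattice_add)
  qed
  then show ?thesis ..
qed

lemma wall_dvd_int_shift:
  assumes "\<beta> \<in> L" "x \<in> L" shows "wall_dvd \<beta> (ymon x - ymon (x + of_int n *\<^sub>R (2 *\<^sub>R \<beta>)))"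
proof -
  have b: "2 *\<^sub>R \<beta> \<in> L" by (rule double_lattice[OF assms(1)])
  have nat: "wall_dvd \<beta> (ymon x - ymon (x + real m *\<^sub>R (2 *\<^sub>R \<beta>)))" if "x \<in> L" for m x
  proof (induction m)
    case 0 then show ?case by (simp add: wall_dvd_0)
  next
    case (Suc m)
    let ?z = "x + real m *\<^sub>R (2 *\<^sub>R \<beta>)"
    have z: "?z \<in> L" by (intro lattice_add that lattice_scale b) auto
    have e: "x + real (Suc m) *\<^sub>R (2 *\<^sub>R \<beta>) = ?z + 2 *\<^sub>R \<beta>" by (simp add: algebra_simps)
    have "wall_dvd \<beta> (ymon ?z - ymon (?z + 2 *\<^sub>R \<beta>))"
      unfolding wall_dvd_def fac_def ymon_add[OF z b]
      by (rule bexI[OF _ R_ymon[OF z]]) (simp add: const_fun_1 algebra_simps)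
    from wall_dvd_add[OF Suc this] show ?case unfolding e by simp
  qed
  show ?thesis
  proof (cases "n \<ge> 0")
    case True then show ?thesis using nat[OF assms(2), of "nat n"] by simp
  next
    case False
    let ?z = "x + of_int n *\<^sub>R (2 *\<^sub>R \<beta>)"
    have z: "?z \<in> L" by (intro lattice_add assms lattice_scale b) auto
    have "?z + real (nat (- n)) *\<^sub>R (2 *\<^sub>R \<beta>) = x" using False by simp
    then have "wall_dvd \<beta> (ymon ?z - ymon x)" using nat[OF z, of "nat (- n)"] by (simp only:)
    from wall_dvd_const[OF this, of "- 1"] show ?thesis by (simp add: const_fun_minus const_fun_1)
  qed
qed

text \<open>Modulo \<open>1 - y\<^sup>2\<^sup>\<beta>\<close> all monomials of one string are equal, so the quotient ring is the space
  spanned by the representatives of the strings.\<close>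

lemma wall_dvd_iff:
  assumes "\<beta> \<in> L" "u \<in> R" shows "wall_dvd \<beta> u \<longleftrightarrow> string_proj \<beta> u = 0"
proof
  assume "wall_dvd \<beta> u"
  then obtain v where v: "v \<in> R" "u = fac 1 \<beta> * v" by (auto simp: wall_dvd_def)
  define w where "w = ymon (of_int 1 *\<^sub>R (2 *\<^sub>R \<beta>)) * v"
  have wR: "w \<in> R"
    unfolding w_def by (intro R_mult R_ymon lattice_scale v assms) auto
  have "u = v + const_fun (- 1) * w"
    using v by (simp add: w_def fac_def const_fun_1 const_fun_minus algebra_simps)
  then have "string_proj \<beta> u = string_proj \<beta> v + const_fun (- 1) * string_proj \<beta> w"
    by (simp only: lin_ext_add[OF v(1) lspan_const[OF wR]] lin_ext_const[OF wR])
  also have "string_proj \<beta> w = string_proj \<beta> v" unfolding w_def by (rule string_proj_shift[OF assms(1) v(1)])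
  finally show "string_proj \<beta> u = 0" by (simp add: const_fun_minus const_fun_1)
next
  assume z: "string_proj \<beta> u = 0"
  have "u \<in> R \<and> wall_dvd \<beta> (u - string_proj \<beta> u)"
    using assms(2)
  proof (induction rule: lspan_induct)
    case zero then show ?case by (simp add: lin_ext_zero wall_dvd_0 lspan_0)
  next
    case (add c x f)
    obtain t :: int where t: "string_rep \<beta> x = x + of_int t *\<^sub>R (2 *\<^sub>R \<beta>)" using string_rep by blast
    have "wall_dvd \<beta> (const_fun c * (ymon x - ymon (string_rep \<beta> x)) + (f - string_proj \<beta> f))"
      using add wall_dvd_int_shift[OF assms(1), of x t] t by (intro wall_dvd_add wall_dvd_const) auto
    moreover have "const_fun c * ymon x + f - string_proj \<beta> (const_fun c * ymon x + f) =
        const_fun c * (ymon x - ymon (string_rep \<beta> x)) + (f - string_proj \<beta> f)"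
      using add by (simp add: lin_ext_add lin_ext_const lin_ext_ymon R_ymon lspan_const algebra_simps)
    ultimately have "wall_dvd \<beta> (const_fun c * ymon x + f - string_proj \<beta> (const_fun c * ymon x + f))"
      by (simp only:)
    moreover have "const_fun c * ymon x + f \<in> R" using add by (simp add: lspan_add lspan_const R_ymon)
    ultimately show ?case by blast
  qed
  then show "wall_dvd \<beta> u" using z by simp
qed

text \<open>Multiplication by \<open>e\<close> is injective modulo \<open>1 - y\<^sup>2\<^sup>\<beta>\<close>. This plays the
  part of coprimality.\<close>

definition wall_coprime :: "'v \<Rightarrow> 'i ratfun \<Rightarrow> bool" where
  "wall_coprime \<beta> e \<longleftrightarrow> e \<in> R \<and> e \<noteq> 0 \<and> (\<forall>u\<in>R. wall_dvd \<beta> (e * u) \<longrightarrow> wall_dvd \<beta> u)"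

lemma wall_coprimeI: "e \<in> R \<Longrightarrow> e \<noteq> 0 \<Longrightarrow> (\<And>u. u \<in> R \<Longrightarrow> wall_dvd \<beta> (e * u) \<Longrightarrow> wall_dvd \<beta> u) \<Longrightarrow> wall_coprime \<beta> e"
  and wall_coprime_R: "wall_coprime \<beta> e \<Longrightarrow> e \<in> R" and wall_coprime_nonzero: "wall_coprime \<beta> e \<Longrightarrow> e \<noteq> 0"
  and wall_coprimeD: "wall_coprime \<beta> e \<Longrightarrow> u \<in> R \<Longrightarrow> wall_dvd \<beta> (e * u) \<Longrightarrow> wall_dvd \<beta> u"
  unfolding wall_coprime_def by blast+

lemma wall_coprime_1: "wall_coprime \<beta> 1" by (rule wall_coprimeI) (simp_all add: R_1)

lemma wall_coprime_mult: assumes "wall_coprime \<beta> d" "wall_coprime \<beta> e" shows "wall_coprime \<beta> (d * e)"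
proof (rule wall_coprimeI)
  show "d * e \<in> R" "d * e \<noteq> 0" using assms wall_coprime_R wall_coprime_nonzero R_mult by auto
  fix u assume u: "u \<in> R" "wall_dvd \<beta> (d * e * u)"
  then have "wall_dvd \<beta> (d * (e * u))" by (simp only: mult.assoc)
  then have "wall_dvd \<beta> (e * u)" using wall_coprimeD[OF assms(1) R_mult[OF wall_coprime_R[OF assms(2)] u(1)]] by blast
  then show "wall_dvd \<beta> u" using wall_coprimeD[OF assms(2) u(1)] by blast
qed

lemma wall_coprime_prod: "(\<And>a. a \<in> A \<Longrightarrow> wall_coprime \<beta> (h a)) \<Longrightarrow> wall_coprime \<beta> (prod h A)"
  by (induction A rule: infinite_finite_induct) (auto simp: wall_coprime_1 wall_coprime_mult)

lemma wall_dvd_S: assumes "\<beta> \<in> L" "wall_dvd \<beta> u" shows "wall_dvd (s k \<beta>) (S k u)"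
proof -
  obtain v where "v \<in> R" "u = fac 1 \<beta> * v" using assms(2) by (auto simp: wall_dvd_def)
  then show ?thesis unfolding wall_dvd_def using assms by (intro bexI[of _ "S k v"]) (simp_all add: S_simps S_fac R_S)
qed

lemma wall_dvd_E: assumes "\<beta> \<in> L" "wall_dvd \<beta> u" shows "wall_dvd \<beta> (E k u)"
proof -
  obtain v where "v \<in> R" "u = fac 1 \<beta> * v" using assms(2) by (auto simp: wall_dvd_def)
  then show ?thesis unfolding wall_dvd_def using assms by (intro bexI[of _ "E k v"]) (simp_all add: E_simps E_fac lspan_E)
qed

lemma wall_coprime_S: assumes "\<beta> \<in> L" "wall_coprime \<beta> e" shows "wall_coprime (s k \<beta>) (S k e)"
proof (rule wall_coprimeI)
  show "S k e \<in> R" "S k e \<noteq> 0"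
    using wall_coprime_R[OF assms(2)] wall_coprime_nonzero[OF assms(2)] by (simp_all add: R_S hom_eq_0_iff[OF S_hom])
  fix u assume u: "u \<in> R" "wall_dvd (s k \<beta>) (S k e * u)"
  have "wall_dvd (s k (s k \<beta>)) (S k (S k e * u))" by (rule wall_dvd_S[OF s_lattice[OF assms(1)] u(2)])
  then have "wall_dvd \<beta> (e * S k u)" by (simp only: hom_mult[OF S_hom] S_S s_s)
  then have "wall_dvd \<beta> (S k u)" by (rule wall_coprimeD[OF assms(2) R_S[OF u(1)]])
  then show "wall_dvd (s k \<beta>) u" using wall_dvd_S[OF assms(1), of "S k u" k] by (simp only: S_S)
qed

lemma wall_coprime_E: assumes "\<beta> \<in> L" "wall_coprime \<beta> e" shows "wall_coprime \<beta> (E k e)"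
proof (rule wall_coprimeI)
  show "E k e \<in> R" "E k e \<noteq> 0"
    using wall_coprime_R[OF assms(2)] wall_coprime_nonzero[OF assms(2)] by (simp_all add: lspan_E hom_eq_0_iff[OF E_hom])
  fix u assume u: "u \<in> R" "wall_dvd \<beta> (E k e * u)"
  have "wall_dvd \<beta> (E k (E k e * u))" by (rule wall_dvd_E[OF assms(1) u(2)])
  then have "wall_dvd \<beta> (e * E k u)" by (simp only: hom_mult[OF E_hom] E_E)
  then have "wall_dvd \<beta> (E k u)" by (rule wall_coprimeD[OF assms(2) lspan_E[OF u(1) order_refl]])
  then show "wall_dvd \<beta> u" using wall_dvd_E[OF assms(1), of "E k u" k] by (simp only: E_E)
qed

lemma supp_string_proj:
  assumes "\<beta> \<in> L" shows "supp (string_proj \<beta> u) \<subseteq> string_rep \<beta> ` supp u"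
proof -
  have L: "string_rep \<beta> ` supp u \<subseteq> L" using supp_lattice string_rep_lattice[OF assms] by blast
  have "string_proj \<beta> u \<in> lspan (string_rep \<beta> ` supp u)"
    unfolding lin_ext_def by (intro lspan_sum lspan_const lspan_ymon) auto
  then show ?thesis using lspan_iff[OF L] by blast
qed

text \<open>If \<open>fac c \<gamma>\<close> kills \<open>u\<close> in the quotient by \<open>1 - y\<^sup>2\<^sup>\<beta>\<close>, then \<open>u\<close> agrees there with
  \<open>c\<^sup>n y\<^sup>2\<^sup>n\<^sup>\<gamma> u\<close> for all \<open>n\<close>. When \<open>\<gamma>\<close> is not proportional to \<open>\<beta>\<close> the strings that meet the
  supports of these elements eventually are disjoint from those that meet the support of \<open>u\<close>; when \<open>\<gamma>\<close> is proportional
  to \<open>\<beta>\<close> the factor is the scalar \<open>1 - c\<close> in the quotient.\<close>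

lemma wall_coprime_fac:
  assumes b: "\<beta> \<in> \<Phi>" and g: "\<gamma> \<in> \<Phi>" and c: "c \<noteq> 1 \<or> (\<gamma> \<noteq> \<beta> \<and> \<gamma> \<noteq> - \<beta>)"
  shows "wall_coprime \<beta> (fac c \<gamma>)"
proof (rule wall_coprimeI)
  have bL: "\<beta> \<in> L" and gL: "\<gamma> \<in> L" using b g root_lattice_root by auto
  show "fac c \<gamma> \<in> R" "fac c \<gamma> \<noteq> 0" using R_fac gL fac_nonzero[OF g] by auto
  fix u assume u: "u \<in> R" "wall_dvd \<beta> (fac c \<gamma> * u)"
  have m: "ymon (of_int n *\<^sub>R (2 *\<^sub>R \<gamma>)) * v \<in> R" if "v \<in> R" for v n
    using that gL by (intro R_mult R_ymon) (auto simp: lattice_scale)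
  have step: "string_proj \<beta> v = const_fun c * string_proj \<beta> (ymon (of_int 1 *\<^sub>R (2 *\<^sub>R \<gamma>)) * v)"
    if "v \<in> R" "wall_dvd \<beta> (fac c \<gamma> * v)" for v
  proof -
    define w where "w = ymon (of_int 1 *\<^sub>R (2 *\<^sub>R \<gamma>)) * v"
    have wR: "w \<in> R" unfolding w_def by (rule m[OF that(1)])
    have e: "fac c \<gamma> * v = v + const_fun (- c) * w"
      by (simp add: w_def fac_def const_fun_minus algebra_simps)
    have "string_proj \<beta> (fac c \<gamma> * v) = 0"
      using wall_dvd_iff[OF bL R_mult[OF R_fac[OF gL] that(1)]] that(2) by simp
    then have "string_proj \<beta> v + const_fun (- c) * string_proj \<beta> w = 0"
      by (simp only: e lin_ext_add[OF that(1) lspan_const[OF wR]] lin_ext_const[OF wR])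
    then have "string_proj \<beta> v = const_fun c * string_proj \<beta> w" by (simp add: const_fun_minus)
    then show ?thesis by (simp only: w_def)
  qed
  have "string_proj \<beta> u = 0"
  proof (cases "\<gamma> = \<beta> \<or> \<gamma> = - \<beta>")
    case True
    then obtain n :: int where n: "of_int 1 *\<^sub>R (2 *\<^sub>R \<gamma>) = of_int n *\<^sub>R (2 *\<^sub>R \<beta>)"
      by (metis of_int_1 of_int_minus scaleR_minus1_left scaleR_minus_right scaleR_one)
    have "string_proj \<beta> u = const_fun c * string_proj \<beta> u"
      using step[OF u] unfolding n string_proj_shift[OF bL u(1)] .
    then have "(1 - const_fun c) * string_proj \<beta> u = 0" by (simp add: algebra_simps)
    moreover have "1 - const_fun c \<noteq> (0 :: 'i ratfun)" using c True const_fun_eq_iff[of 1 c] by (auto simp: const_fun_1)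
    ultimately show ?thesis by simp
  next
    case False
    have it: "string_proj \<beta> u = const_fun (c ^ n) * string_proj \<beta> (ymon (of_int (int n) *\<^sub>R (2 *\<^sub>R \<gamma>)) * u)" for n
    proof (induction n)
      case 0 then show ?case by (simp add: const_fun_1 ymon_zero)
    next
      case (Suc n)
      let ?v = "ymon (of_int (int n) *\<^sub>R (2 *\<^sub>R \<gamma>)) * u"
      have "wall_dvd \<beta> (fac c \<gamma> * ?v)"
        using wall_dvd_mult[OF u(2) R_ymon[of "of_int (int n) *\<^sub>R (2 *\<^sub>R \<gamma>)"]] gL
        by (simp add: lattice_scale mult.left_commute)
      from step[OF m[OF u(1)] this]
      have "string_proj \<beta> ?v = const_fun c * string_proj \<beta> (ymon (of_int 1 *\<^sub>R (2 *\<^sub>R \<gamma>)) * ?v)" .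
      moreover have "ymon (of_int 1 *\<^sub>R (2 *\<^sub>R \<gamma>)) * ?v = ymon (of_int (int (Suc n)) *\<^sub>R (2 *\<^sub>R \<gamma>)) * u"
      proof -
        have "of_int (int (Suc n)) *\<^sub>R (2 *\<^sub>R \<gamma>) = of_int 1 *\<^sub>R (2 *\<^sub>R \<gamma>) + of_int (int n) *\<^sub>R (2 *\<^sub>R \<gamma>)"
          by (simp add: algebra_simps)
        then show ?thesis using gL by (simp add: ymon_add lattice_scale mult.assoc double_lattice)
      qed
      ultimately have "string_proj \<beta> ?v = const_fun c * string_proj \<beta> (ymon (of_int (int (Suc n)) *\<^sub>R (2 *\<^sub>R \<gamma>)) * u)"
        by (simp only:)
      then have "string_proj \<beta> u = const_fun (c ^ n) * (const_fun c * string_proj \<beta> (ymon (of_int (int (Suc n)) *\<^sub>R (2 *\<^sub>R \<gamma>)) * u))"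
        using Suc by (simp only:)
      then show ?case by (simp only: const_fun_mult power_Suc2 mult.assoc)
    qed
    show ?thesis
    proof (rule ccontr)
      assume nz: "string_proj \<beta> u \<noteq> 0"
      have pR: "string_proj \<beta> v \<in> R" for v
        unfolding lin_ext_def using supp_lattice string_rep_lattice[OF bL] by (intro lspan_sum lspan_const R_ymon) blast
      have "supp (string_proj \<beta> u) \<noteq> {}" using coef_expand[OF pR[of u]] nz by auto
      then obtain x where x: "coef (string_proj \<beta> u) x \<noteq> 0" by (auto simp: supp_def)
      have "\<exists>z\<in>supp u. x = string_rep \<beta> (z + real n *\<^sub>R (2 *\<^sub>R \<gamma>))" for n
      proof -
        let ?d = "of_int (int n) *\<^sub>R (2 *\<^sub>R \<gamma>)"
        have d: "?d \<in> L" using gL by (simp add: lattice_scale)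
        have "coef (string_proj \<beta> u) x = c ^ n * coef (string_proj \<beta> (ymon ?d * u)) x"
          by (subst it[of n]) (rule coef_const[OF pR])
        then have "x \<in> supp (string_proj \<beta> (ymon ?d * u))" using x unfolding supp_def mem_Collect_eq by (metis mult_zero_right)
        then obtain z where z: "z \<in> supp (ymon ?d * u)" "x = string_rep \<beta> z"
          using supp_string_proj[OF bL, of "ymon ?d * u"] by blast
        have "z - ?d \<in> supp u" using z(1) unfolding supp_def mem_Collect_eq coef_ymon_mult[OF u(1) d] .
        moreover have "x = string_rep \<beta> ((z - ?d) + real n *\<^sub>R (2 *\<^sub>R \<gamma>))" using z(2) by simp
        ultimately show ?thesis by blast
      qed
      then obtain z where z: "\<And>n. z n \<in> supp u" "\<And>n. x = string_rep \<beta> (z n + real n *\<^sub>R (2 *\<^sub>R \<gamma>))" by metis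
      have "range z \<subseteq> supp u" using z(1) by blast
      then have "\<not> inj z" using finite_supp[of u] range_inj_infinite finite_subset by blast
      then obtain n m where nm: "n \<noteq> m" "z n = z m" by (auto simp: inj_def)
      obtain t1 t2 :: int where
        "x = (z n + real n *\<^sub>R (2 *\<^sub>R \<gamma>)) + of_int t1 *\<^sub>R (2 *\<^sub>R \<beta>)"
        "x = (z m + real m *\<^sub>R (2 *\<^sub>R \<gamma>)) + of_int t2 *\<^sub>R (2 *\<^sub>R \<beta>)"
        using string_rep z(2) by metis
      then have "(z n + real n *\<^sub>R (2 *\<^sub>R \<gamma>)) + of_int t1 *\<^sub>R (2 *\<^sub>R \<beta>) = (z n + real m *\<^sub>R (2 *\<^sub>R \<gamma>)) + of_int t2 *\<^sub>R (2 *\<^sub>R \<beta>)"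
        using nm(2) by metis
      then have "real n *\<^sub>R (2 *\<^sub>R \<gamma>) - real m *\<^sub>R (2 *\<^sub>R \<gamma>) = of_int t2 *\<^sub>R (2 *\<^sub>R \<beta>) - of_int t1 *\<^sub>R (2 *\<^sub>R \<beta>)"
        by (simp only: add.assoc add_left_cancel) (simp only: algebra_simps)
      then have eq: "(2 * (real n - real m)) *\<^sub>R \<gamma> = (2 * (of_int t2 - of_int t1)) *\<^sub>R \<beta>"
        by (simp add: algebra_simps)
      have nz: "2 * (real n - real m) \<noteq> 0" using nm(1) by simp
      have "\<gamma> = inverse (2 * (real n - real m)) *\<^sub>R ((2 * (real n - real m)) *\<^sub>R \<gamma>)"
        unfolding scaleR_scaleR left_inverse[OF nz] by simp
      then have "\<gamma> = (inverse (2 * (real n - real m)) * (2 * (of_int t2 - of_int t1))) *\<^sub>R \<beta>"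
        unfolding eq scaleR_scaleR .
      then show False using reducedD[OF b] g False by (metis scaleR_minus1_left scaleR_one)
    qed
  qed
  then show "wall_dvd \<beta> u" using wall_dvd_iff[OF bL u(1)] by simp
qed

section \<open>Poles of the averaged function\<close>

abbreviation "qi \<equiv> 1 / of_nat q :: complex"

lemma qi_ne: "qi \<noteq> 1" using q_gt_1 by simp

text \<open>The function \<open>g\<close> has no pole along \<open>y\<^sup>2\<^sup>\<beta> = 1\<close>.\<close>

definition wall_regular :: "'v \<Rightarrow> 'i ratfun \<Rightarrow> bool" where
  "wall_regular \<beta> g \<longleftrightarrow> (\<exists>e. wall_coprime \<beta> e \<and> g * e \<in> R)"

lemma wall_regularI: "wall_coprime \<beta> e \<Longrightarrow> g * e \<in> R \<Longrightarrow> wall_regular \<beta> g" unfolding wall_regular_def by blast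

lemma wall_regular_R: "g \<in> R \<Longrightarrow> wall_regular \<beta> g" by (rule wall_regularI[OF wall_coprime_1]) simp

lemma wall_regular_add: assumes "wall_regular \<beta> f" "wall_regular \<beta> g" shows "wall_regular \<beta> (f + g)"
proof -
  obtain d e where de: "wall_coprime \<beta> d" "f * d \<in> R" "wall_coprime \<beta> e" "g * e \<in> R" using assms unfolding wall_regular_def by blast
  have "(f + g) * (d * e) = f * d * e + g * e * d" by (simp add: algebra_simps)
  moreover have "f * d * e + g * e * d \<in> R"
    by (intro lspan_add R_mult[OF de(2)] R_mult[OF de(4)] wall_coprime_R[OF de(1)] wall_coprime_R[OF de(3)])
  ultimately have "(f + g) * (d * e) \<in> R" by (simp only:)
  then show ?thesis by (rule wall_regularI[OF wall_coprime_mult[OF de(1,3)]])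
qed

lemma wall_regular_mult: assumes "wall_regular \<beta> f" "wall_regular \<beta> g" shows "wall_regular \<beta> (f * g)"
proof -
  obtain d e where de: "wall_coprime \<beta> d" "f * d \<in> R" "wall_coprime \<beta> e" "g * e \<in> R" using assms unfolding wall_regular_def by blast
  have "(f * g) * (d * e) = f * d * (g * e)" by (simp add: algebra_simps)
  then have "(f * g) * (d * e) \<in> R" using R_mult[OF de(2,4)] by (simp only:)
  then show ?thesis by (rule wall_regularI[OF wall_coprime_mult[OF de(1,3)]])
qed

lemma wall_regular_inverse: "wall_coprime \<beta> e \<Longrightarrow> wall_regular \<beta> (inverse e)"
  by (rule wall_regularI[of _ e]) (simp_all add: wall_coprime_nonzero R_1)

lemma wall_regular_diff: "wall_regular \<beta> f \<Longrightarrow> wall_regular \<beta> g \<Longrightarrow> wall_regular \<beta> (f - g)"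
  using wall_regular_add[of \<beta> f "const_fun (- 1) * g"] wall_regular_mult[OF wall_regular_R[OF R_const], of \<beta> g "- 1"]
  by (simp add: const_fun_minus const_fun_1)

lemma wall_regular_half: "wall_regular \<beta> f \<Longrightarrow> wall_regular \<beta> (f / 2)"
  using wall_regular_mult[OF wall_regular_R[OF R_const], of \<beta> f "1 / 2"]
  by (simp add: const_fun_divide const_fun_1 const_fun_numeral)

lemma wall_regular_S: assumes "\<beta> \<in> L" "wall_regular \<beta> g" shows "wall_regular (s k \<beta>) (S k g)"
proof -
  obtain e where e: "wall_coprime \<beta> e" "g * e \<in> R" using assms unfolding wall_regular_def by blast
  have "S k g * S k e \<in> R" using R_S[OF e(2)] by (simp only: hom_mult[OF S_hom])
  then show ?thesis using wall_regularI[OF wall_coprime_S[OF assms(1) e(1)]] by blast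
qed

lemma wall_regular_E: assumes "\<beta> \<in> L" "wall_regular \<beta> g" shows "wall_regular \<beta> (E k g)"
proof -
  obtain e where e: "wall_coprime \<beta> e" "g * e \<in> R" using assms unfolding wall_regular_def by blast
  have "E k g * E k e \<in> R" using lspan_E[OF e(2)] by (simp only: hom_mult[OF E_hom] order_refl)
  then show ?thesis using wall_regularI[OF wall_coprime_E[OF assms(1) e(1)]] by blast
qed

lemma ymon_double_eq: "x \<in> L \<Longrightarrow> ymon (2 *\<^sub>R x) = ymon x * ymon x"
  by (simp add: scaleR_2 ymon_add)

lemma qi_const: "const_fun qi = 1 / (sF * sF)"
  by (simp add: sF_square const_fun_divide const_fun_1 const_fun_of_nat)

lemma fac_qi: "fac qi (\<alpha> k) = (sF - y k) * (sF + y k) / (sF * sF)"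
  unfolding fac_def ymon_double_eq[OF lattice_simple] qi_const
  using sF_nonzero by (simp add: field_simps)

lemma fac_qi_minus: "fac qi (- \<alpha> k) = (sF * y k - 1) * (sF * y k + 1) / (sF * y k * (sF * y k))"
proof -
  have "y k \<noteq> 0" by (rule ymon_nonzero)
  then show ?thesis
    unfolding fac_def ymon_double_eq[OF lattice_minus[OF lattice_simple]] qi_const ymon_minus[OF lattice_simple]
    using sF_nonzero by (simp add: field_simps const_fun_eq_0_iff sq_nonzero)
qed

lemma fac_1: "fac 1 (\<alpha> k) = 1 - y k * y k"
  unfolding fac_def ymon_double_eq[OF lattice_simple] by (simp add: const_fun_1)

lemma fac_1_minus: "fac 1 (- \<alpha> k) = - fac 1 (\<alpha> k) / (y k * y k)"
proof -
  have "y k \<noteq> 0" by (rule ymon_nonzero)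
  then have "fac 1 (- \<alpha> k) = - (1 - y k * y k) / (y k * y k)"
    unfolding fac_def ymon_double_eq[OF lattice_minus[OF lattice_simple]] ymon_minus[OF lattice_simple]
    by (simp add: const_fun_1 field_simps)
  then show ?thesis by (simp only: fac_1)
qed

lemma R_y: "y k \<in> R" by (rule R_ymon[OF lattice_simple])

lemma R_inverse_y: "1 / y k \<in> R"
  using R_ymon[OF lattice_minus[OF lattice_simple[of k]]] by (simp add: ymon_minus lattice_simple inverse_eq_divide)

lemma slash_coeff_fac: "slash_coeff sF b (y k) * fac qi (\<alpha> k) \<in> R"
proof (cases b)
  case True
  have n: "sF - y k \<noteq> 0" using sF_ne(1)[of k] by simp
  have "slash_coeff sF b (y k) * fac qi (\<alpha> k) = (sF * y k - 1) * (1 / y k) * (sF + y k) * const_fun qi"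
    unfolding fac_qi slash_coeff_def qi_const using True n by simp
  moreover have "(sF * y k - 1) * (1 / y k) * (sF + y k) * const_fun qi \<in> R"
    by (intro R_mult lspan_diff lspan_add R_const R_y R_1 R_inverse_y)
  ultimately show ?thesis by (simp only:)
next
  case False
  then have "slash_coeff sF b (y k) = 1 / y k" by (simp add: slash_coeff_def)
  then show ?thesis using R_mult[OF R_inverse_y R_fac[OF lattice_simple]] by metis
qed

lemma wall_coprime_fac_qi: "\<beta> \<in> \<Phi> \<Longrightarrow> \<gamma> \<in> \<Phi> \<Longrightarrow> wall_coprime \<beta> (fac qi \<gamma>)"
  using wall_coprime_fac qi_ne by blast

lemma wall_regular_slash_coeff: "\<beta> \<in> \<Phi> \<Longrightarrow> wall_regular \<beta> (slash_coeff sF b (y k))"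
  by (rule wall_regularI[OF wall_coprime_fac_qi[OF _ simple_root] slash_coeff_fac])

text \<open>The slash operator \<open>T k\<close> moves the walls by \<open>s k\<close>, because the denominator \<open>1 - x\<^sub>k\<close> that it introduces
  divides \<open>fac (1/q) (\<alpha> k)\<close>, which is a non-zerodivisor along every wall.\<close>

lemma wall_regular_T: assumes "\<beta> \<in> \<Phi>" "wall_regular \<beta> g" shows "wall_regular (s k \<beta>) (T k g)"
proof -
  have L: "\<beta> \<in> L" and r: "s k \<beta> \<in> \<Phi>" using assms root_lattice_root s_root by auto
  show ?thesis unfolding T_eq
    by (intro wall_regular_add wall_regular_mult wall_regular_slash_coeff r wall_regular_S[OF L] wall_regular_half wall_regular_diff wall_regular_E[OF L] assms)
qed

lemma TR: "u \<in> R \<Longrightarrow> T k u * fac qi (\<alpha> k) \<in> R"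
proof -
  assume u: "u \<in> R"
  have "T k u * fac qi (\<alpha> k) =
      (slash_coeff sF True (y k) * fac qi (\<alpha> k)) * S k ((u + E k u) / 2) +
      (slash_coeff sF False (y k) * fac qi (\<alpha> k)) * S k ((u - E k u) / 2)"
    unfolding T_eq by (simp only: distrib_right distrib_left mult_ac)
  also have "\<dots> \<in> R"
    by (intro lspan_add R_mult slash_coeff_fac R_S R_half lspan_diff lspan_E u order_refl)
  finally show ?thesis .
qed

lemma S_Del: "S k Del = const_fun (- 1) * ymon (- (2 *\<^sub>R \<alpha> k)) * Del"
proof -
  let ?P = "\<Prod>\<beta>\<in>Pos - {\<alpha> k}. fac 1 \<beta>"
  have D: "Del = fac 1 (\<alpha> k) * ?P"
    unfolding Delta_eq by (rule prod.remove[OF finite_Pos simple_Pos])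
  have "S k ?P = (\<Prod>\<beta>\<in>Pos - {\<alpha> k}. fac 1 (s k \<beta>))"
    unfolding hom_prod[OF S_hom] by (rule prod.cong) (auto simp: S_fac root_lattice_root pos_root)
  also have "\<dots> = (\<Prod>\<beta>\<in>s k ` (Pos - {\<alpha> k}). fac 1 \<beta>)"
    by (simp add: prod.reindex[OF inj_s])
  finally have P: "S k ?P = ?P" by (simp only: s_Pos_image)
  have "S k (fac 1 (\<alpha> k)) = fac 1 (- \<alpha> k)" by (simp add: S_fac lattice_simple s_self)
  also have "\<dots> = const_fun (- 1) * ymon (- (2 *\<^sub>R \<alpha> k)) * fac 1 (\<alpha> k)"
    unfolding fac_1_minus ymon_minus[OF double_lattice[OF lattice_simple]] ymon_double_eq[OF lattice_simple]
    by (simp add: const_fun_minus const_fun_1 divide_inverse)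
  finally show ?thesis unfolding D hom_mult[OF S_hom] P by (simp only: mult.assoc)
qed

lemma fold_S_Del: "\<exists>c x. x \<in> L \<and> c \<noteq> 0 \<and> fold S is Del = const_fun c * ymon x * Del"
proof (induction "is" rule: rev_induct)
  case Nil
  have "fold S [] Del = const_fun 1 * ymon 0 * Del" by (simp add: ymon_zero const_fun_1)
  then show ?case using lattice_zero by (intro exI[of _ 1] exI[of _ 0]) simp
next
  case (snoc k "is")
  then obtain c x where cx: "x \<in> L" "c \<noteq> 0" "fold S is Del = const_fun c * ymon x * Del" by blast
  have d: "- (2 *\<^sub>R \<alpha> k) \<in> L" by (rule lattice_minus[OF double_lattice[OF lattice_simple]])
  have "fold S (is @ [k]) Del = const_fun c * ymon (s k x) * (const_fun (- 1) * ymon (- (2 *\<^sub>R \<alpha> k)) * Del)"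
    by (simp only: fold_append fold.simps o_apply id_apply cx(3) hom_mult[OF S_hom] hom_const[OF S_hom] S_ymon[OF cx(1)] S_Del)
  also have "\<dots> = const_fun (c * - 1) * ymon (s k x + - (2 *\<^sub>R \<alpha> k)) * Del"
    by (simp only: const_fun_mult ymon_add[OF s_lattice[OF cx(1)] d] mult_ac)
  finally show ?case using cx lattice_add[OF s_lattice[OF cx(1)] d]
    by (intro exI[of _ "c * - 1"] exI[of _ "s k x + - (2 *\<^sub>R \<alpha> k)"]) simp
qed

definition inv_den :: "('v \<Rightarrow> 'v) \<Rightarrow> 'i ratfun" where
  "inv_den w = (\<Prod>\<beta>\<in>inversions w. fac qi \<beta>)"

lemma inversions_Pos: "inversions w \<subseteq> Pos" by (auto simp: inversions_def)

text \<open>Each letter of a reduced word contributes the factor of \<open>D\<close> at the corresponding inversion to the denominator.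
  As the inversions are distinct positive roots, the whole denominator divides \<open>D\<close>.\<close>

lemma reduced_denominator:
  "length is = len (wp is) \<Longrightarrow> fold T is 1 * inv_den (wp is) \<in> R"
proof (induction "is" rule: rev_induct)
  case Nil
  have "inv_den (wp []) = 1" by (simp only: wp_Nil inv_den_def inversions_id prod.empty)
  then show ?case by (simp add: R_1)
next
  case (snoc k "is")
  have P: "wp is (\<alpha> k) \<in> Pos"
  proof (rule ccontr)
    assume "wp is (\<alpha> k) \<notin> Pos"
    from len_down[OF this] have "len (wp is) = Suc (len (wp (is @ [k])))" by (simp only: wp_snoc)
    then show False using len_le[of "is"] snoc.prems by simp
  qed
  have "len (wp (is @ [k])) = Suc (len (wp is))" using len_up[OF P] by (simp only: wp_snoc)
  then have "fold T is 1 * inv_den (wp is) \<in> R" using snoc by simp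
  from TR[OF this, of k] have r: "T k (inv_den (wp is) * fold T is 1) * fac qi (\<alpha> k) \<in> R"
    by (simp only: mult.commute)
  have ev: "even_elt (inv_den (wp is))"
    unfolding inv_den_def using inversions_Pos root_lattice_root pos_root by (intro even_prod even_fac) blast
  have "S k (inv_den (wp is)) = (\<Prod>\<beta>\<in>inversions (wp is). fac qi (s k \<beta>))"
    unfolding inv_den_def hom_prod[OF S_hom] using inversions_Pos root_lattice_root pos_root
    by (intro prod.cong refl S_fac) blast
  also have "\<dots> = (\<Prod>\<beta>\<in>s k ` inversions (wp is). fac qi \<beta>)" by (simp add: prod.reindex[OF inj_s])
  finally have Sd: "S k (inv_den (wp is)) = (\<Prod>\<beta>\<in>s k ` inversions (wp is). fac qi \<beta>)" .
  have "inv_den (wp (is @ [k])) = fac qi (\<alpha> k) * S k (inv_den (wp is))"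
    unfolding Sd unfolding inv_den_def wp_snoc inv_up(1)[OF P]
    by (rule prod.insert) (use inv_up(2)[OF P] finite_inv in auto)
  then have "fold T (is @ [k]) 1 * inv_den (wp (is @ [k])) = S k (inv_den (wp is)) * T k (fold T is 1) * fac qi (\<alpha> k)"
    by (simp only: fold_append fold.simps o_apply id_apply mult_ac)
  also have "\<dots> = T k (inv_den (wp is) * fold T is 1) * fac qi (\<alpha> k)"
    using T_mult[of k "inv_den (wp is)"] ev by (simp add: even_elt_def)
  finally show ?case using r by simp
qed

abbreviation "Dp \<equiv> Dprod \<Phi> \<alpha> q"
abbreviation "fav \<equiv> averaged \<Phi> \<alpha> q"

lemma fold_T_1_R: "Dp * fold T is 1 \<in> R"
proof -
  obtain js where js: "wp js = wp is" "length js = len (wp is)" using reduced_word by blast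
  have e: "Dp = (\<Prod>\<beta>\<in>Pos - inversions (wp js). fac qi \<beta>) * inv_den (wp js)"
    unfolding Dprod_eq inv_den_def by (rule prod.subset_diff[OF inversions_Pos finite_Pos])
  have "fold T js 1 * inv_den (wp js) \<in> R" using reduced_denominator[of js] js by simp
  moreover have "(\<Prod>\<beta>\<in>Pos - inversions (wp js). fac qi \<beta>) \<in> R"
    by (intro R_prod R_fac root_lattice_root pos_root) auto
  ultimately have "(\<Prod>\<beta>\<in>Pos - inversions (wp js). fac qi \<beta>) * (fold T js 1 * inv_den (wp js)) \<in> R"
    using R_mult by blast
  then have "Dp * fold T js 1 \<in> R" unfolding e by (simp only: mult_ac)
  then show ?thesis using T_word[OF js(1)] by simp
qed

lemma numerator_denominator: "fav * (Dp * Del) \<in> R"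
proof -
  have "fold T is (inverse Del) * (Dp * Del) \<in> R" for "is"
  proof -
    obtain c x where cx: "x \<in> L" "c \<noteq> 0" "fold S is Del = const_fun c * ymon x * Del"
      using fold_S_Del by blast
    have f: "fold T is (inverse Del) = inverse (fold S is Del) * fold T is 1"
      using fold_T_mult[OF even_inverse[OF even_Delta], of "is" 1] by (simp add: hom_inverse[OF fold_S_hom])
    have g: "inverse (fold S is Del) * Del = const_fun (inverse c) * ymon (- x)"
      unfolding cx(3) inverse_mult_distrib const_fun_inverse ymon_minus[OF cx(1)]
      using Delta_nonzero by (simp add: mult.assoc)
    have "fold T is (inverse Del) * (Dp * Del) = (inverse (fold S is Del) * Del) * (Dp * fold T is 1)"
      unfolding f by (simp only: mult_ac)
    then have "fold T is (inverse Del) * (Dp * Del) = (const_fun (inverse c) * ymon (- x)) * (Dp * fold T is 1)"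
      unfolding g .
    moreover have "(const_fun (inverse c) * ymon (- x)) * (Dp * fold T is 1) \<in> R"
      by (intro R_mult R_const R_ymon lattice_minus cx fold_T_1_R)
    ultimately show ?thesis by (simp only:)
  qed
  then show ?thesis unfolding averaged_eq sum_distrib_right by (intro lspan_sum) blast
qed

lemma geometric: "(ymon (of_int (2 * m) *\<^sub>R \<alpha> k) - 1) / fac 1 (\<alpha> k) \<in> R"
proof -
  have "wall_dvd (\<alpha> k) (ymon 0 - ymon (0 + of_int m *\<^sub>R (2 *\<^sub>R \<alpha> k)))"
    by (rule wall_dvd_int_shift[OF lattice_simple lattice_zero])
  from wall_dvd_const[OF this, of "- 1"] obtain v where
    "v \<in> R" "ymon (of_int (2 * m) *\<^sub>R \<alpha> k) - 1 = fac 1 (\<alpha> k) * v"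
    by (auto simp: wall_dvd_def ymon_zero const_fun_minus const_fun_1 mult.commute)
  then show ?thesis using fac_nonzero[OF simple_root, of 1 k] by simp
qed

text \<open>By linearity \<open>u\<close> may be taken to be a monomial \<open>y\<^sup>x\<close>. With \<open>n\<close> the value of \<open>x\<close> on the coroot
  and \<open>t = y\<^sub>k\<close>, the sum is a monomial times
  \<open>(t\<^sup>n - 1) / (1 - t\<^sup>2) + s / (s - t)\<close> for even \<open>n\<close>, and a monomial times
  \<open>(t\<^sup>n - t) / (1 - t\<^sup>2)\<close> for odd \<open>n\<close>.\<close>

lemma Demazure: "u \<in> R \<Longrightarrow> wall_regular (\<alpha> k) (u / fac 1 (\<alpha> k) + T k (u / fac 1 (\<alpha> k)))"
proof (induction rule: lspan_induct)
  case zero then show ?case by (simp add: T_zero wall_regular_R lspan_0)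
next
  case (add c x f)
  let ?P = "fac 1 (\<alpha> k)"
  have P0: "?P \<noteq> 0" by (rule fac_nonzero[OF simple_root])
  have y0: "y k \<noteq> 0" by (rule ymon_nonzero)
  have n: "sF - y k \<noteq> 0" using sF_ne(1)[of k] by simp
  define n where "n = 2 * root_coord \<alpha> x k - phi \<alpha> k x"
  have sx: "s k x \<in> L" by (rule s_lattice[OF add(1)])
  have "x = s k x + of_int n *\<^sub>R \<alpha> k" by (simp add: s_eq pair_eq[OF add(1)] n_def)
  then have yx: "ymon x = ymon (s k x) * ymon (of_int n *\<^sub>R \<alpha> k)"
    using ymon_add[OF sx lattice_scale[OF lattice_simple Ints_of_int]] by metis
  define b where "b \<longleftrightarrow> even (phi \<alpha> k x)"
  have "has_parity k b (ymon x)"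
    by (simp add: has_parity_def E_ymon[OF add(1)] chi_def b_def const_fun_1 const_fun_minus)
  then have Tx: "T k (ymon x) = slash_coeff sF b (y k) * ymon (s k x)"
    using T_has_parity S_ymon[OF add(1)] by simp
  have "T k (inverse ?P * ymon x) = S k (inverse ?P) * T k (ymon x)"
    by (rule T_mult) (simp add: hom_inverse[OF E_hom] E_fac lattice_simple)
  also have "S k (inverse ?P) = - (y k * y k) / ?P"
    by (simp add: hom_inverse[OF S_hom] S_fac lattice_simple s_self fac_1_minus)
  finally have T1: "T k (inverse ?P * ymon x) = - (y k * y k) / ?P * (slash_coeff sF b (y k) * ymon (s k x))"
    unfolding Tx .
  have eq: "ymon x / ?P + T k (ymon x / ?P) =
      ymon (s k x) * ((ymon (of_int n *\<^sub>R \<alpha> k) - y k * y k * slash_coeff sF b (y k)) / ?P)"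
    using T1 P0 unfolding yx by (simp add: divide_inverse algebra_simps)
  have "wall_regular (\<alpha> k) ((ymon (of_int n *\<^sub>R \<alpha> k) - y k * y k * slash_coeff sF b (y k)) / ?P)"
  proof (cases b)
    case True
    then have "even n" by (simp add: b_def n_def)
    then obtain m where m: "n = 2 * m" by blast
    have e: "y k * y k * slash_coeff sF b (y k) = 1 - sF * ?P / (sF - y k)"
      unfolding fac_1 slash_coeff_def using True y0 n by (simp add: field_simps)
    (* the even case: the pole cancels up to the harmless denominator s - y *)
    have split: "(Y - (1 - a * P / d)) / P = (Y - 1) / P + a / d" if "P \<noteq> 0" for Y a P d :: "'i ratfun"
    proof -
      have "Y - (1 - a * P / d) = (Y - 1) + (a / d) * P" by simp
      then show ?thesis using that by (simp only: add_divide_distrib nonzero_mult_div_cancel_right[OF that])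
    qed
    have "(ymon (of_int n *\<^sub>R \<alpha> k) - y k * y k * slash_coeff sF b (y k)) / ?P =
        (ymon (of_int (2 * m) *\<^sub>R \<alpha> k) - 1) / ?P + sF / (sF - y k)"
      unfolding m e by (rule split[OF P0])
    moreover have "wall_regular (\<alpha> k) (sF / (sF - y k))"
    proof (rule wall_regularI[OF wall_coprime_fac_qi[OF simple_root simple_root[of k]]])
      have "sF / (sF - y k) * fac qi (\<alpha> k) = const_fun (1 / sq) * (sF + y k)"
        unfolding fac_qi using n sF_nonzero by (simp add: const_fun_divide const_fun_1)
      then show "sF / (sF - y k) * fac qi (\<alpha> k) \<in> R"
        using R_mult[OF R_const lspan_add[OF R_const R_y]] by metis
    qed
    ultimately show ?thesis using wall_regular_add[OF wall_regular_R[OF geometric]] by metis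
  next
    case False
    then have "odd n" by (auto simp: b_def n_def)
    then obtain m where m: "n = 2 * m + 1" by (auto elim!: oddE)
    have "of_int n *\<^sub>R \<alpha> k = of_int (2 * m) *\<^sub>R \<alpha> k + \<alpha> k" by (simp add: m algebra_simps)
    then have "ymon (of_int n *\<^sub>R \<alpha> k) = ymon (of_int (2 * m) *\<^sub>R \<alpha> k) * y k"
      using ymon_add[OF lattice_scale[OF lattice_simple Ints_of_int] lattice_simple] by metis
    then have "(ymon (of_int n *\<^sub>R \<alpha> k) - y k * y k * slash_coeff sF b (y k)) / ?P =
        y k * ((ymon (of_int (2 * m) *\<^sub>R \<alpha> k) - 1) / ?P)"
      using False y0 by (simp add: slash_coeff_def algebra_simps)
    then show ?thesis using wall_regular_R[OF R_mult[OF R_y geometric]] by metis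
  qed
  then have l: "wall_regular (\<alpha> k) (ymon x / ?P + T k (ymon x / ?P))"
    unfolding eq by (rule wall_regular_mult[OF wall_regular_R[OF R_ymon[OF sx]]])
  have "(const_fun c * ymon x + f) / ?P + T k ((const_fun c * ymon x + f) / ?P) =
      const_fun c * (ymon x / ?P + T k (ymon x / ?P)) + (f / ?P + T k (f / ?P))"
    using T_const[of k c "ymon x / ?P"] by (simp add: add_divide_distrib T_add algebra_simps)
  then show ?case using wall_regular_add[OF wall_regular_mult[OF wall_regular_R[OF R_const] l] add(2)] by metis
qed

lemma S_prod_others: "S k (\<Prod>\<beta>\<in>Pos - {\<alpha> k}. fac c \<beta>) = (\<Prod>\<beta>\<in>Pos - {\<alpha> k}. fac c \<beta>)"
proof -
  have "S k (\<Prod>\<beta>\<in>Pos - {\<alpha> k}. fac c \<beta>) = (\<Prod>\<beta>\<in>Pos - {\<alpha> k}. fac c (s k \<beta>))"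
    unfolding hom_prod[OF S_hom] by (rule prod.cong) (auto simp: S_fac root_lattice_root pos_root)
  also have "\<dots> = (\<Prod>\<beta>\<in>s k ` (Pos - {\<alpha> k}). fac c \<beta>)" by (simp add: prod.reindex[OF inj_s])
  finally show ?thesis by (simp only: s_Pos_image)
qed

text \<open>Write \<open>f = v A / (1 - y\<^sub>k\<^sup>2)\<close> with a Laurent polynomial \<open>A\<close> and with \<open>v\<close> fixed by \<open>\<sigma>\<^sub>k\<close> and
  \<open>\<epsilon>\<^sub>k\<close> and regular along the wall. As \<open>f\<close> is invariant, twice \<open>f\<close> is \<open>v\<close> times a sum to which
  \<open>Demazure\<close> applies.\<close>

lemma wall_regular_simple: "wall_regular (\<alpha> k) fav"
proof -
  let ?P = "fac 1 (\<alpha> k)"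
  let ?D' = "\<Prod>\<beta>\<in>Pos - {\<alpha> k}. fac qi \<beta>" and ?E' = "\<Prod>\<beta>\<in>Pos - {\<alpha> k}. fac 1 \<beta>"
  let ?a = "fac qi (\<alpha> k)" and ?b = "fac qi (- \<alpha> k)"
  (* the factor of D at the simple root is completed to a reflection invariant product *)
  define v where "v = ?D' * ?E' * (?a * ?b)"
  have D: "Dp = ?a * ?D'" "Del = ?P * ?E'"
    unfolding Dprod_eq Delta_eq by (rule prod.remove[OF finite_Pos simple_Pos])+
  define A where "A = fav * (Dp * Del) * ?b"
  have A: "A \<in> R"
    unfolding A_def by (intro R_mult numerator_denominator R_fac lattice_minus lattice_simple)
  have nz: "wall_coprime (\<alpha> k) v"
    unfolding v_def
  proof (intro wall_coprime_mult wall_coprime_prod wall_coprime_fac_qi simple_root)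
    fix \<beta> assume b: "\<beta> \<in> Pos - {\<alpha> k}"
    then show "\<beta> \<in> \<Phi>" using pos_root by blast
    then show "wall_coprime (\<alpha> k) (fac 1 \<beta>)" using b minus_simple_not_Pos by (intro wall_coprime_fac simple_root) auto
  qed (simp add: uminus_root simple_root)
  have v0: "v \<noteq> 0" using wall_coprime_nonzero[OF nz] .
  have P0: "?P \<noteq> 0" by (rule fac_nonzero[OF simple_root])
  have f: "fav = inverse v * (A / ?P)"
    using v0 P0 unfolding A_def D v_def by (simp add: field_simps)
  have ev: "E k (inverse v) = inverse v"
    unfolding v_def hom_inverse[OF E_hom] hom_mult[OF E_hom] hom_prod[OF E_hom]
    by (simp add: E_fac root_lattice_root pos_root lattice_minus lattice_simple)
  have "S k v = v"
    unfolding v_def hom_mult[OF S_hom] S_prod_others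
    by (simp add: S_fac lattice_minus lattice_simple s_minus s_self mult.commute)
  then have Sv: "S k (inverse v) = inverse v" by (simp only: hom_inverse[OF S_hom])
  have "fav = T k fav" by (rule T_averaged[symmetric])
  also have "\<dots> = T k (inverse v * (A / ?P))" using f by (simp only:)
  also have "\<dots> = inverse v * T k (A / ?P)" by (simp only: T_mult[OF ev] Sv)
  finally have "fav + fav = inverse v * (A / ?P + T k (A / ?P))" using f by (simp add: distrib_left)
  moreover have "wall_regular (\<alpha> k) (inverse v * (A / ?P + T k (A / ?P)))"
    by (intro wall_regular_mult wall_regular_inverse nz Demazure A)
  ultimately have "wall_regular (\<alpha> k) ((fav + fav) / 2)" by (simp only: wall_regular_half)
  then show ?thesis by simp
qed

lemma wall_regular_word: "wall_regular (wp is (\<alpha> k)) fav"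
proof (induction "is")
  case Nil then show ?case using wall_regular_simple by (simp add: wp_Nil)
next
  case (Cons j "is")
  have "wall_regular (s j (wp is (\<alpha> k))) (T j fav)" by (rule wall_regular_T[OF wp_root[OF simple_root] Cons])
  then show ?case unfolding T_averaged wp_Cons by simp
qed

definition Num :: "'i ratfun" where "Num = Dp * fav"

text \<open>The product of \<open>N\<close> and \<open>\<Delta>\<close> is a Laurent polynomial that is divisible by each factor of \<open>\<Delta>\<close>, and
  the factors at distinct positive roots do not interfere.\<close>

lemma Num_R: "Num \<in> R"
proof -
  define A where "A = fav * (Dp * Del)"
  have A: "A \<in> R" unfolding A_def by (rule numerator_denominator)
  have dvA: "wall_dvd \<beta> A" if b: "\<beta> \<in> Pos" for \<beta>
  proof -
    have "wall_regular \<beta> fav" using Pos_conjugate_simple[OF b] wall_regular_word by metis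
    then obtain e where e: "wall_coprime \<beta> e" "fav * e \<in> R" unfolding wall_regular_def by blast
    have D: "Del = fac 1 \<beta> * (\<Prod>\<gamma>\<in>Pos - {\<beta>}. fac 1 \<gamma>)"
      unfolding Delta_eq by (rule prod.remove[OF finite_Pos b])
    have "e * A = fac 1 \<beta> * (fav * e * Dp * (\<Prod>\<gamma>\<in>Pos - {\<beta>}. fac 1 \<gamma>))"
      unfolding A_def D by (simp only: mult_ac)
    moreover have "fav * e * Dp * (\<Prod>\<gamma>\<in>Pos - {\<beta>}. fac 1 \<gamma>) \<in> R"
      unfolding Dprod_eq by (intro R_mult e R_prod R_fac root_lattice_root pos_root) auto
    ultimately have "wall_dvd \<beta> (e * A)" unfolding wall_dvd_def by blast
    then show ?thesis by (rule wall_coprimeD[OF e(1) A])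
  qed
  have "\<exists>v\<in>R. A = (\<Prod>\<beta>\<in>B. fac 1 \<beta>) * v" if "finite B" "B \<subseteq> Pos" for B
    using that
  proof (induction B rule: finite_induct)
    case empty then show ?case using A by auto
  next
    case (insert \<beta> B)
    then obtain v where v: "v \<in> R" "A = (\<Prod>\<gamma>\<in>B. fac 1 \<gamma>) * v" by auto
    have b: "\<beta> \<in> Pos" using insert by blast
    have "wall_coprime \<beta> (\<Prod>\<gamma>\<in>B. fac 1 \<gamma>)"
    proof (rule wall_coprime_prod)
      fix \<gamma> assume g: "\<gamma> \<in> B"
      then have "\<gamma> \<in> Pos" "\<gamma> \<noteq> \<beta>" using insert by auto
      moreover have "\<gamma> \<noteq> - \<beta>" using pos_not_minus[OF b] \<open>\<gamma> \<in> Pos\<close> by metis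
      ultimately show "wall_coprime \<beta> (fac 1 \<gamma>)" using b pos_root by (intro wall_coprime_fac) auto
    qed
    then have "wall_dvd \<beta> v" using wall_coprimeD[OF _ v(1)] dvA[OF b] unfolding v(2) by blast
    then obtain u where "u \<in> R" "v = fac 1 \<beta> * u" unfolding wall_dvd_def by blast
    then have "u \<in> R" "A = (\<Prod>\<gamma>\<in>insert \<beta> B. fac 1 \<gamma>) * u"
      using v insert by (simp_all add: mult_ac)
    then show ?case by blast
  qed
  from this[OF finite_Pos] obtain v where v: "v \<in> R" "A = Del * v" unfolding Delta_eq by blast
  have "Num = v" using v(2) Delta_nonzero unfolding A_def Num_def by (simp add: mult_ac)
  then show ?thesis using v by simp
qed

section \<open>Leading terms\<close>

text \<open>The linear form \<open>x \<mapsto> \<xi> \<bullet> x\<close> grades the Laurent polynomials.\<close>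

definition halfspace :: "'v \<Rightarrow> real \<Rightarrow> 'v set" where "halfspace \<xi> c = {x \<in> L. \<xi> \<bullet> x \<ge> c}"
definition open_halfspace :: "'v \<Rightarrow> 'v set" where "open_halfspace \<xi> = {x \<in> L. \<xi> \<bullet> x > 0}"

lemma halfspace_L: "halfspace \<xi> c \<subseteq> L" and open_halfspace_L: "open_halfspace \<xi> \<subseteq> L" by (auto simp: halfspace_def open_halfspace_def)

text \<open>Laurent polynomials of the form \<open>1\<close> plus terms of positive degree; they play the role of units.\<close>

definition leading_one :: "'v \<Rightarrow> 'i ratfun \<Rightarrow> bool" where
  "leading_one \<xi> G \<longleftrightarrow> G - 1 \<in> lspan (open_halfspace \<xi>)"

lemma leading_one_R: "leading_one \<xi> G \<Longrightarrow> G \<in> lspan (halfspace \<xi> 0)"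
proof -
  assume "leading_one \<xi> G"
  moreover have "open_halfspace \<xi> \<subseteq> halfspace \<xi> 0" by (auto simp: open_halfspace_def halfspace_def)
  ultimately have "G - 1 \<in> lspan (halfspace \<xi> 0)" unfolding leading_one_def using lspan_mono by blast
  moreover have "1 \<in> lspan (halfspace \<xi> 0)"
    using lspan_ymon[of 0 "halfspace \<xi> 0"] lattice_zero by (simp add: halfspace_def ymon_zero)
  ultimately have "(G - 1) + 1 \<in> lspan (halfspace \<xi> 0)" by (rule lspan_add)
  then show ?thesis by simp
qed

lemma halfspace_mult: "f \<in> lspan (halfspace \<xi> a) \<Longrightarrow> g \<in> lspan (halfspace \<xi> b) \<Longrightarrow> f * g \<in> lspan (halfspace \<xi> (a + b))"
  by (rule lspan_mult[OF _ _ halfspace_L halfspace_L]) (auto simp: halfspace_def lattice_add inner_add_right)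

lemma open_halfspace_mult: "f \<in> lspan (open_halfspace \<xi>) \<Longrightarrow> g \<in> lspan (halfspace \<xi> 0) \<Longrightarrow> f * g \<in> lspan (open_halfspace \<xi>)"
  by (rule lspan_mult[OF _ _ open_halfspace_L halfspace_L]) (auto simp: halfspace_def open_halfspace_def lattice_add inner_add_right)

lemma leading_one_1: "leading_one \<xi> 1" by (simp add: leading_one_def lspan_0)

lemma leading_one_mult: assumes "leading_one \<xi> G" "leading_one \<xi> H" shows "leading_one \<xi> (G * H)"
proof -
  have "(G - 1) * H + (H - 1) \<in> lspan (open_halfspace \<xi>)"
    using assms open_halfspace_mult[OF _ leading_one_R[OF assms(2)]] unfolding leading_one_def by (intro lspan_add)
  then show ?thesis by (simp add: leading_one_def algebra_simps)
qed

lemma leading_one_prod: "(\<And>a. a \<in> A \<Longrightarrow> leading_one \<xi> (h a)) \<Longrightarrow> leading_one \<xi> (prod h A)"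
  by (induction A rule: infinite_finite_induct) (auto simp: leading_one_1 leading_one_mult)

lemma leading_one_S: assumes "leading_one \<xi> G" shows "leading_one (s k \<xi>) (S k G)"
proof -
  have "S k (G - 1) \<in> lspan (open_halfspace (s k \<xi>))"
    using assms unfolding leading_one_def
    by (rule lspan_S[OF _ open_halfspace_L]) (auto simp: open_halfspace_def s_lattice reflect_inner simple_nonzero)
  then show ?thesis by (simp add: leading_one_def hom_diff[OF S_hom] hom_1[OF S_hom])
qed

lemma leading_one_E: assumes "leading_one \<xi> G" shows "leading_one \<xi> (E k G)"
proof -
  have "E k (G - 1) \<in> lspan (open_halfspace \<xi>)"
    using assms unfolding leading_one_def by (rule lspan_E[OF _ open_halfspace_L])
  then show ?thesis by (simp add: leading_one_def hom_diff[OF E_hom] hom_1[OF E_hom])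
qed

text \<open>The order of \<open>g\<close> in the direction \<open>\<xi>\<close> is at least \<open>c\<close>, as seen from the expansion of \<open>g\<close> in a
  series of increasing degree.\<close>

definition ord_ge :: "'v \<Rightarrow> real \<Rightarrow> 'i ratfun \<Rightarrow> bool" where
  "ord_ge \<xi> c g \<longleftrightarrow> (\<exists>G. leading_one \<xi> G \<and> g * G \<in> lspan (halfspace \<xi> c))"

lemma ord_geI: "leading_one \<xi> G \<Longrightarrow> g * G \<in> lspan (halfspace \<xi> c) \<Longrightarrow> ord_ge \<xi> c g" unfolding ord_ge_def by blast

lemma ord_ge_lspan: "g \<in> lspan (halfspace \<xi> c) \<Longrightarrow> ord_ge \<xi> c g" by (rule ord_geI[OF leading_one_1]) simp

lemma ord_ge_add: assumes "ord_ge \<xi> c f" "ord_ge \<xi> c g" shows "ord_ge \<xi> c (f + g)"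
proof -
  obtain G H where GH: "leading_one \<xi> G" "f * G \<in> lspan (halfspace \<xi> c)" "leading_one \<xi> H" "g * H \<in> lspan (halfspace \<xi> c)"
    using assms unfolding ord_ge_def by blast
  have "f * G * H + g * H * G \<in> lspan (halfspace \<xi> (c + 0))"
    by (intro lspan_add halfspace_mult GH leading_one_R)
  moreover have "(f + g) * (G * H) = f * G * H + g * H * G" by (simp add: algebra_simps)
  ultimately have "(f + g) * (G * H) \<in> lspan (halfspace \<xi> c)" by (simp only: add_0_right)
  then show ?thesis by (rule ord_geI[OF leading_one_mult[OF GH(1,3)]])
qed

lemma ord_ge_mult: assumes "ord_ge \<xi> a f" "ord_ge \<xi> b g" shows "ord_ge \<xi> (a + b) (f * g)"
proof -
  obtain G H where GH: "leading_one \<xi> G" "f * G \<in> lspan (halfspace \<xi> a)" "leading_one \<xi> H" "g * H \<in> lspan (halfspace \<xi> b)"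
    using assms unfolding ord_ge_def by blast
  have "(f * G) * (g * H) \<in> lspan (halfspace \<xi> (a + b))" by (rule halfspace_mult[OF GH(2,4)])
  then have "(f * g) * (G * H) \<in> lspan (halfspace \<xi> (a + b))" by (simp only: mult_ac)
  then show ?thesis by (rule ord_geI[OF leading_one_mult[OF GH(1,3)]])
qed

lemma ord_ge_const: "ord_ge \<xi> 0 (const_fun c)"
  using lspan_const[OF lspan_ymon[of 0 "halfspace \<xi> 0"], of c] lattice_zero
  by (intro ord_ge_lspan) (simp add: halfspace_def ymon_zero)

lemma ord_ge_ymon: "x \<in> L \<Longrightarrow> ord_ge \<xi> (\<xi> \<bullet> x) (ymon x)"
  by (intro ord_ge_lspan lspan_ymon) (simp add: halfspace_def)

lemma ord_ge_half: "ord_ge \<xi> c g \<Longrightarrow> ord_ge \<xi> c (g / 2)"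
  using ord_ge_mult[OF ord_ge_const[of \<xi> "1 / 2"], of c g]
  by (simp add: const_fun_divide const_fun_1 const_fun_numeral)

lemma ord_ge_minus: "ord_ge \<xi> c g \<Longrightarrow> ord_ge \<xi> c (- g)"
  using ord_ge_mult[OF ord_ge_const[of \<xi> "- 1"], of c g]
  by (simp add: const_fun_minus const_fun_1)

lemma ord_ge_diff: "ord_ge \<xi> c f \<Longrightarrow> ord_ge \<xi> c g \<Longrightarrow> ord_ge \<xi> c (f - g)"
  using ord_ge_add[of \<xi> c f "- g"] ord_ge_minus by simp

lemma ord_ge_1: "ord_ge \<xi> 0 1" using ord_ge_const[of \<xi> 1] by (simp add: const_fun_1)

lemma ord_ge_prod: "(\<And>a. a \<in> A \<Longrightarrow> ord_ge \<xi> (d a) (h a)) \<Longrightarrow> ord_ge \<xi> (sum d A) (prod h A)"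
  by (induction A rule: infinite_finite_induct) (auto simp: ord_ge_1 ord_ge_mult)

lemma ord_ge_S: assumes "ord_ge \<xi> c g" shows "ord_ge (s k \<xi>) c (S k g)"
proof -
  obtain G where G: "leading_one \<xi> G" "g * G \<in> lspan (halfspace \<xi> c)" using assms unfolding ord_ge_def by blast
  have "S k (g * G) \<in> lspan (halfspace (s k \<xi>) c)"
    using G(2) by (rule lspan_S[OF _ halfspace_L]) (auto simp: halfspace_def s_lattice reflect_inner simple_nonzero)
  then have "S k g * S k G \<in> lspan (halfspace (s k \<xi>) c)" by (simp only: hom_mult[OF S_hom])
  then show ?thesis by (rule ord_geI[OF leading_one_S[OF G(1)]])
qed

lemma ord_ge_E: assumes "ord_ge \<xi> c g" shows "ord_ge \<xi> c (E k g)"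
proof -
  obtain G where G: "leading_one \<xi> G" "g * G \<in> lspan (halfspace \<xi> c)" using assms unfolding ord_ge_def by blast
  have "E k (g * G) \<in> lspan (halfspace \<xi> c)" using G(2) by (rule lspan_E[OF _ halfspace_L])
  then have "E k g * E k G \<in> lspan (halfspace \<xi> c)" by (simp only: hom_mult[OF E_hom])
  then show ?thesis by (rule ord_geI[OF leading_one_E[OF G(1)]])
qed

lemma leading_one_one_minus: "x \<in> L \<Longrightarrow> \<xi> \<bullet> x > 0 \<Longrightarrow> leading_one \<xi> (1 - const_fun c * ymon x)"
proof -
  assume "x \<in> L" "\<xi> \<bullet> x > 0"
  then have "const_fun (- c) * ymon x \<in> lspan (open_halfspace \<xi>)" by (intro lspan_const lspan_ymon) (simp add: open_halfspace_def)
  then show ?thesis by (simp add: leading_one_def const_fun_minus)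
qed

lemma ord_ge_slash_coeff:
  assumes "\<xi> \<bullet> \<alpha> k \<noteq> 0"
  shows "ord_ge \<xi> (- (\<xi> \<bullet> \<alpha> k)) (slash_coeff sF b (y k))"
proof -
  have yi: "ymon (- \<alpha> k) = 1 / y k" by (simp add: ymon_minus lattice_simple inverse_eq_divide)
  have y0: "y k \<noteq> 0" by (rule ymon_nonzero)
  have n: "sF - y k \<noteq> 0" using sF_ne(1)[of k] by simp
  have Fi: "ord_ge \<xi> (- (\<xi> \<bullet> \<alpha> k)) (1 / y k)"
    using ord_ge_ymon[OF lattice_minus[OF lattice_simple[of k]], of \<xi>] by (simp add: yi)
  show ?thesis
  proof (cases b)
    case False then show ?thesis using Fi by (simp add: slash_coeff_def)
  next
    case True
    consider (p) "\<xi> \<bullet> \<alpha> k > 0" | (m) "\<xi> \<bullet> \<alpha> k < 0" using assms by linarith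
    then show ?thesis
    proof cases
      case p
      have u: "leading_one \<xi> (1 - const_fun (1 / sq) * y k)" by (rule leading_one_one_minus[OF lattice_simple p])
      have "sF * y k - 1 \<in> lspan (halfspace \<xi> 0)"
        using lspan_ymon[of 0 "halfspace \<xi> 0"] lspan_ymon[of "\<alpha> k" "halfspace \<xi> 0"] lattice_zero lattice_simple[of k] p
        by (intro lspan_diff lspan_const) (simp_all add: halfspace_def ymon_zero)
      moreover have "ymon (- \<alpha> k) \<in> lspan (halfspace \<xi> (- (\<xi> \<bullet> \<alpha> k)))"
        by (rule lspan_ymon) (simp add: halfspace_def lattice_minus lattice_simple)
      ultimately have "const_fun (1 / sq) * ((sF * y k - 1) * ymon (- \<alpha> k)) \<in> lspan (halfspace \<xi> (0 + - (\<xi> \<bullet> \<alpha> k)))"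
        by (intro lspan_const halfspace_mult)
      moreover have "slash_coeff sF b (y k) * (1 - const_fun (1 / sq) * y k) = const_fun (1 / sq) * ((sF * y k - 1) * ymon (- \<alpha> k))"
      proof -
        have "1 - const_fun (1 / sq) * y k = (sF - y k) / sF"
          using sF_nonzero by (simp add: const_fun_divide const_fun_1 diff_divide_distrib)
        then show ?thesis using True n unfolding slash_coeff_def yi by (simp add: const_fun_divide const_fun_1)
      qed
      ultimately show ?thesis using ord_geI[OF u, of "slash_coeff sF b (y k)"] by simp
    next
      case m
      have u: "leading_one \<xi> (1 - const_fun sq * ymon (- \<alpha> k))"
        by (rule leading_one_one_minus[OF lattice_minus[OF lattice_simple]]) (use m in simp)
      have "ymon (- \<alpha> k) - sF \<in> lspan (halfspace \<xi> 0)"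
        using lspan_const[OF lspan_ymon[of 0 "halfspace \<xi> 0"], of sq] lattice_zero m
        by (intro lspan_diff lspan_ymon) (simp_all add: halfspace_def ymon_zero lattice_minus lattice_simple)
      moreover have "ymon (- \<alpha> k) \<in> lspan (halfspace \<xi> (- (\<xi> \<bullet> \<alpha> k)))"
        by (rule lspan_ymon) (simp add: halfspace_def lattice_minus lattice_simple)
      ultimately have "(ymon (- \<alpha> k) - sF) * ymon (- \<alpha> k) \<in> lspan (halfspace \<xi> (0 + - (\<xi> \<bullet> \<alpha> k)))"
        by (intro halfspace_mult)
      moreover have "slash_coeff sF b (y k) * (1 - const_fun sq * ymon (- \<alpha> k)) = (ymon (- \<alpha> k) - sF) * ymon (- \<alpha> k)"
        using True n y0 unfolding slash_coeff_def yi by (simp add: field_simps)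
      ultimately show ?thesis using ord_geI[OF u, of "slash_coeff sF b (y k)"] by simp
    qed
  qed
qed

lemma ord_ge_T:
  assumes "ord_ge \<xi> c g" "\<xi> \<bullet> \<alpha> k \<noteq> 0"
  shows "ord_ge (s k \<xi>) (\<xi> \<bullet> \<alpha> k + c) (T k g)"
proof -
  have e: "s k \<xi> \<bullet> \<alpha> k = - (\<xi> \<bullet> \<alpha> k)"
    using reflect_inner[OF simple_nonzero, of k \<xi> "- \<alpha> k"] by (simp add: s_minus s_self)
  then have ne: "s k \<xi> \<bullet> \<alpha> k \<noteq> 0" using assms by simp
  show ?thesis unfolding T_eq
    using ord_ge_slash_coeff[OF ne] unfolding e minus_minus
    by (intro ord_ge_add ord_ge_mult ord_ge_S ord_ge_half ord_ge_diff ord_ge_E assms)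
qed

abbreviation "\<rho> \<equiv> rho \<Phi> \<alpha>"

text \<open>One slash operator changes the order by the value of \<open>\<xi>\<close> on \<open>\<alpha> k\<close> and replaces \<open>\<xi>\<close> by
  \<open>s k \<xi>\<close>. The shift by the value on \<open>\<rho>\<close> absorbs this change, since \<open>s k \<rho> = \<rho> - \<alpha> k\<close>.\<close>

lemma ord_ge_fold_T:
  assumes "ord_ge \<xi> (d - \<xi> \<bullet> \<rho>) g" "\<And>\<beta>. \<beta> \<in> \<Phi> \<Longrightarrow> \<xi> \<bullet> \<beta> \<noteq> 0"
  shows "ord_ge (wp (rev is) \<xi>) (d - wp (rev is) \<xi> \<bullet> \<rho>) (fold T is g)"
  using assms
proof (induction "is" arbitrary: \<xi> g)
  case Nil then show ?case by (simp add: wp_Nil)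
next
  case (Cons k "is")
  have "s k \<xi> \<bullet> \<rho> = \<xi> \<bullet> s k \<rho>"
    using reflect_inner[OF simple_nonzero, of k \<xi> "s k \<rho>"] by (simp add: s_s)
  then have e: "\<xi> \<bullet> \<alpha> k + (d - \<xi> \<bullet> \<rho>) = d - s k \<xi> \<bullet> \<rho>" by (simp add: s_rho inner_diff_right)
  have "ord_ge (s k \<xi>) (d - s k \<xi> \<bullet> \<rho>) (T k g)"
    using ord_ge_T[OF Cons.prems(1) Cons.prems(2)[OF simple_root[of k]]] by (simp only: e)
  moreover have "s k \<xi> \<bullet> \<beta> \<noteq> 0" if "\<beta> \<in> \<Phi>" for \<beta>
    using Cons.prems(2)[OF s_root[OF that, of k]] reflect_inner[OF simple_nonzero, of k \<xi> "s k \<beta>"] by (simp add: s_s)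
  ultimately have "ord_ge (wp (rev is) (s k \<xi>)) (d - wp (rev is) (s k \<xi>) \<bullet> \<rho>) (fold T is (T k g))"
    by (rule Cons.IH)
  then show ?case by (simp add: wp_snoc)
qed

text \<open>A factor \<open>1 - y\<^sup>2\<^sup>\<beta>\<close> has order \<open>0\<close> or \<open>2 \<xi> \<bullet> \<beta>\<close>, according to the sign of \<open>\<xi> \<bullet> \<beta>\<close>.\<close>

lemma ord_ge_inverse_Del:
  assumes "\<And>\<beta>. \<beta> \<in> \<Phi> \<Longrightarrow> \<xi> \<bullet> \<beta> \<noteq> 0"
  shows "ord_ge \<xi> (\<Sum>\<beta>\<in>Pos. \<bar>\<xi> \<bullet> \<beta>\<bar> - \<xi> \<bullet> \<beta>) (inverse Del)"
proof -
  have "ord_ge \<xi> (\<bar>\<xi> \<bullet> \<beta>\<bar> - \<xi> \<bullet> \<beta>) (inverse (fac 1 \<beta>))" if "\<beta> \<in> Pos" for \<beta>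
  proof -
    have L: "\<beta> \<in> L" using that pos_root root_lattice_root by blast
    have b2: "2 *\<^sub>R \<beta> \<in> L" "- (2 *\<^sub>R \<beta>) \<in> L" using double_lattice[OF L] lattice_minus by auto
    have f0: "fac 1 \<beta> \<noteq> 0" by (rule fac_nonzero[OF pos_root[OF that]])
    have "\<xi> \<bullet> \<beta> \<noteq> 0" by (rule assms[OF pos_root[OF that]])
    then consider (p) "\<xi> \<bullet> \<beta> > 0" | (m) "\<xi> \<bullet> \<beta> < 0" by linarith
    then show ?thesis
    proof cases
      case p
      have "leading_one \<xi> (fac 1 \<beta>)" unfolding fac_def by (rule leading_one_one_minus[OF b2(1)]) (use p in simp)
      moreover have "1 \<in> lspan (halfspace \<xi> 0)"
        using lspan_ymon[of 0 "halfspace \<xi> 0"] lattice_zero by (simp add: halfspace_def ymon_zero)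
      ultimately show ?thesis using p f0 by (intro ord_geI[of \<xi> "fac 1 \<beta>"]) simp_all
    next
      case m
      have "leading_one \<xi> (1 - const_fun 1 * ymon (- (2 *\<^sub>R \<beta>)))"
        by (rule leading_one_one_minus[OF b2(2)]) (use m in simp)
      moreover have "inverse (fac 1 \<beta>) * (1 - const_fun 1 * ymon (- (2 *\<^sub>R \<beta>))) = - ymon (- (2 *\<^sub>R \<beta>))"
        using f0 ymon_nonzero[of "2 *\<^sub>R \<beta>"] unfolding ymon_minus[OF b2(1)]
        by (simp add: fac_def const_fun_1 field_simps)
      moreover have "- ymon (- (2 *\<^sub>R \<beta>)) \<in> lspan (halfspace \<xi> (\<bar>\<xi> \<bullet> \<beta>\<bar> - \<xi> \<bullet> \<beta>))"
        using b2 m by (intro lspan_minus lspan_ymon) (simp add: halfspace_def)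
      ultimately show ?thesis
        by (intro ord_geI[of \<xi> "1 - const_fun 1 * ymon (- (2 *\<^sub>R \<beta>))"]) (simp_all only:)
    qed
  qed
  then show ?thesis unfolding Delta_eq prod_inversef[symmetric] o_def by (rule ord_ge_prod)
qed

lemma sum_Pos_abs: "(\<Sum>\<beta>\<in>Pos. \<bar>wp is \<xi> \<bullet> \<beta>\<bar>) = (\<Sum>\<beta>\<in>Pos. \<bar>\<xi> \<bullet> \<beta>\<bar>)"
proof -
  have all: "(\<Sum>\<beta>\<in>\<Phi>. \<bar>\<eta> \<bullet> \<beta>\<bar>) = 2 * (\<Sum>\<beta>\<in>Pos. \<bar>\<eta> \<bullet> \<beta>\<bar>)" for \<eta>
  proof -
    have P: "\<Phi> = Pos \<union> uminus ` Pos"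
    proof
      show "\<Phi> \<subseteq> Pos \<union> uminus ` Pos" using pos_or_neg by (metis UnCI image_eqI minus_minus subsetI)
      show "Pos \<union> uminus ` Pos \<subseteq> \<Phi>" using pos_root uminus_root by blast
    qed
    have "Pos \<inter> uminus ` Pos = {}" using pos_not_minus by auto
    then have "(\<Sum>\<beta>\<in>\<Phi>. \<bar>\<eta> \<bullet> \<beta>\<bar>) = (\<Sum>\<beta>\<in>Pos. \<bar>\<eta> \<bullet> \<beta>\<bar>) + (\<Sum>\<beta>\<in>uminus ` Pos. \<bar>\<eta> \<bullet> \<beta>\<bar>)"
      by (subst P) (rule sum.union_disjoint, simp_all add: finite_Pos)
    also have "(\<Sum>\<beta>\<in>uminus ` Pos. \<bar>\<eta> \<bullet> \<beta>\<bar>) = (\<Sum>\<beta>\<in>Pos. \<bar>\<eta> \<bullet> \<beta>\<bar>)"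
      by (subst sum.reindex) (auto simp: inj_on_def)
    finally show ?thesis by simp
  qed
  have "(\<Sum>\<beta>\<in>\<Phi>. \<bar>wp is \<xi> \<bullet> \<beta>\<bar>) = (\<Sum>\<beta>\<in>\<Phi>. \<bar>\<xi> \<bullet> \<beta>\<bar>)"
  proof (rule sum.reindex_bij_witness[of _ "wp is" "wp (rev is)"])
    fix \<beta> assume "\<beta> \<in> \<Phi>"
    show "\<bar>\<xi> \<bullet> wp (rev is) \<beta>\<bar> = \<bar>wp is \<xi> \<bullet> \<beta>\<bar>"
      using wp_inner[of "is" \<xi> "wp (rev is) \<beta>"] by (simp add: wp_rev')
  qed (auto simp: wp_rev wp_rev' wp_root)
  then show ?thesis by (simp add: all)
qed

lemma inner_two_rho: "(\<Sum>\<beta>\<in>Pos. \<xi> \<bullet> \<beta>) = 2 * (\<xi> \<bullet> \<rho>)"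
  by (simp add: rho_def inner_sum_right)

text \<open>The order of \<open>(1/\<Delta>)|w\<close> in the direction \<open>\<rho>\<close> is at least \<open>\<rho> \<bullet> \<rho> - w\<rho> \<bullet> \<rho>\<close>, which is positive for
  \<open>w \<noteq> 1\<close> because \<open>w\<rho>\<close> and \<open>\<rho>\<close> are distinct vectors of the same length.\<close>

lemma ord_ge_term:
  assumes "wp is \<noteq> id"
  shows "\<exists>c>0. ord_ge \<rho> c (fold T is (inverse Del))"
proof -
  (* the word carries the direction w(rho) back to rho *)
  define \<xi> where "\<xi> = wp is \<rho>"
  have reg: "\<xi> \<bullet> \<beta> \<noteq> 0" if "\<beta> \<in> \<Phi>" for \<beta>
  proof -
    have "wp (rev is) \<beta> \<in> \<Phi>" by (rule wp_root[OF that])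
    then have "\<rho> \<bullet> wp (rev is) \<beta> \<noteq> 0" using pos_or_neg inner_rho_Pos by fastforce
    then show ?thesis using wp_inner[of "is" \<rho> "wp (rev is) \<beta>"] by (simp add: wp_rev' \<xi>_def)
  qed
  define d where "d = (\<Sum>\<beta>\<in>Pos. \<bar>\<xi> \<bullet> \<beta>\<bar> - \<xi> \<bullet> \<beta>) + \<xi> \<bullet> \<rho>"
  have "ord_ge \<xi> (d - \<xi> \<bullet> \<rho>) (inverse Del)" using ord_ge_inverse_Del[of \<xi>, OF reg] by (simp add: d_def)
  from ord_ge_fold_T[OF this reg, of "is"] have "ord_ge \<rho> (d - \<rho> \<bullet> \<rho>) (fold T is (inverse Del))"
    by (simp add: \<xi>_def wp_rev)
  moreover have "d - \<rho> \<bullet> \<rho> > 0"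
  proof -
    have "(\<Sum>\<beta>\<in>Pos. \<bar>\<xi> \<bullet> \<beta>\<bar>) = (\<Sum>\<beta>\<in>Pos. \<bar>\<rho> \<bullet> \<beta>\<bar>)" unfolding \<xi>_def by (rule sum_Pos_abs)
    also have "\<dots> = (\<Sum>\<beta>\<in>Pos. \<rho> \<bullet> \<beta>)" using inner_rho_Pos by (intro sum.cong) (auto simp: abs_of_pos)
    also have "\<dots> = 2 * (\<rho> \<bullet> \<rho>)" by (rule inner_two_rho)
    finally have a: "(\<Sum>\<beta>\<in>Pos. \<bar>\<xi> \<bullet> \<beta>\<bar>) = 2 * (\<rho> \<bullet> \<rho>)" .
    have "d - \<rho> \<bullet> \<rho> = \<rho> \<bullet> \<rho> - \<xi> \<bullet> \<rho>"
      unfolding d_def sum_subtractf a inner_two_rho by simp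
    moreover have "\<xi> \<bullet> \<rho> < \<rho> \<bullet> \<rho>"
    proof -
      have "\<xi> \<bullet> \<xi> = \<rho> \<bullet> \<rho>" unfolding \<xi>_def by (rule wp_inner)
      moreover have "\<xi> \<noteq> \<rho>" using regular_rho[of "wp is"] assms Weyl_iff unfolding \<xi>_def by blast
      then have "(\<xi> - \<rho>) \<bullet> (\<xi> - \<rho>) > 0" by simp
      ultimately show ?thesis by (simp add: inner_diff_left inner_diff_right inner_commute)
    qed
    ultimately show ?thesis by simp
  qed
  ultimately show ?thesis by blast
qed

lemma leading_one_rho_fac: "\<beta> \<in> Pos \<Longrightarrow> leading_one \<rho> (fac c \<beta>)"
  unfolding fac_def
  by (rule leading_one_one_minus) (simp_all add: double_lattice root_lattice_root pos_root inner_rho_Pos)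

lemma leading_one_Dp: "leading_one \<rho> Dp" and leading_one_Del: "leading_one \<rho> Del"
  unfolding Dprod_eq Delta_eq by (rule leading_one_prod, erule leading_one_rho_fac)+

definition ord_pos :: "'v \<Rightarrow> 'i ratfun \<Rightarrow> bool" where
  "ord_pos \<xi> g \<longleftrightarrow> (\<exists>G. leading_one \<xi> G \<and> g * G \<in> lspan (open_halfspace \<xi>))"

lemma ord_pos_add: assumes "ord_pos \<xi> f" "ord_pos \<xi> g" shows "ord_pos \<xi> (f + g)"
proof -
  obtain G H where GH: "leading_one \<xi> G" "f * G \<in> lspan (open_halfspace \<xi>)" "leading_one \<xi> H" "g * H \<in> lspan (open_halfspace \<xi>)"
    using assms unfolding ord_pos_def by blast
  have "f * G * H + g * H * G \<in> lspan (open_halfspace \<xi>)"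
    by (intro lspan_add open_halfspace_mult GH leading_one_R)
  moreover have "(f + g) * (G * H) = f * G * H + g * H * G" by (simp add: algebra_simps)
  ultimately have "(f + g) * (G * H) \<in> lspan (open_halfspace \<xi>)" by (simp only:)
  then show ?thesis unfolding ord_pos_def using leading_one_mult[OF GH(1,3)] by blast
qed

lemma ord_pos_sum: "finite A \<Longrightarrow> (\<And>a. a \<in> A \<Longrightarrow> ord_pos \<xi> (h a)) \<Longrightarrow> ord_pos \<xi> (sum h A)"
proof (induction A rule: finite_induct)
  case empty
  show ?case unfolding ord_pos_def using leading_one_1 by (intro exI[of _ 1]) (simp add: lspan_0)
qed (simp add: ord_pos_add)

lemma ord_pos_mult: assumes "ord_ge \<xi> c g" "c > 0" "leading_one \<xi> D" shows "ord_pos \<xi> (D * g)"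
proof -
  obtain G where G: "leading_one \<xi> G" "g * G \<in> lspan (halfspace \<xi> c)" using assms unfolding ord_ge_def by blast
  have "halfspace \<xi> c \<subseteq> open_halfspace \<xi>" using assms(2) by (auto simp: halfspace_def open_halfspace_def)
  then have "g * G \<in> lspan (open_halfspace \<xi>)" using G(2) lspan_mono by blast
  then have "g * G * D \<in> lspan (open_halfspace \<xi>)" by (rule open_halfspace_mult[OF _ leading_one_R[OF assms(3)]])
  then have "D * g * G \<in> lspan (open_halfspace \<xi>)" by (simp only: mult_ac)
  then show ?thesis unfolding ord_pos_def using G(1) by blast
qed

lemma Num_leading: "Num - 1 \<in> lspan (open_halfspace \<rho>)"
proof -
  have id: "id \<in> W" by (rule weyl_id)
  have "fold T (word_of \<alpha> id) = fold T []" by (rule T_word) (simp only: word_of[OF id] wp_Nil)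
  then have "fold T (word_of \<alpha> id) (inverse Del) = inverse Del" by simp
  then have "fav = inverse Del + (\<Sum>w\<in>W - {id}. fold T (word_of \<alpha> w) (inverse Del))"
    unfolding averaged_eq by (simp add: sum.remove[OF finite_W id])
  then have N: "Num - 1 = (Dp * inverse Del - 1) + (\<Sum>w\<in>W - {id}. Dp * fold T (word_of \<alpha> w) (inverse Del))"
    unfolding Num_def by (simp add: distrib_left sum_distrib_left)
  have "ord_pos \<rho> (Dp * inverse Del - 1)"
  proof -
    have "(Dp - 1) - (Del - 1) \<in> lspan (open_halfspace \<rho>)"
      using leading_one_Dp leading_one_Del unfolding leading_one_def by (rule lspan_diff)
    moreover have "(Dp * inverse Del - 1) * Del = (Dp - 1) - (Del - 1)"
      using Delta_nonzero by (simp add: algebra_simps)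
    ultimately show ?thesis unfolding ord_pos_def using leading_one_Del by metis
  qed
  moreover have "ord_pos \<rho> (\<Sum>w\<in>W - {id}. Dp * fold T (word_of \<alpha> w) (inverse Del))"
  proof (rule ord_pos_sum)
    fix w assume w: "w \<in> W - {id}"
    then have "wp (word_of \<alpha> w) \<noteq> id" using word_of by auto
    then obtain c where "c > 0" "ord_ge \<rho> c (fold T (word_of \<alpha> w) (inverse Del))" using ord_ge_term by blast
    then show "ord_pos \<rho> (Dp * fold T (word_of \<alpha> w) (inverse Del))" using ord_pos_mult leading_one_Dp by blast
  qed (simp add: finite_W)
  ultimately have "ord_pos \<rho> (Num - 1)" unfolding N by (rule ord_pos_add)
  then obtain G where G: "leading_one \<rho> G" "(Num - 1) * G \<in> lspan (open_halfspace \<rho>)" unfolding ord_pos_def by blast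
  define M where "M = Num - 1"
  have M: "M \<in> R" unfolding M_def by (intro lspan_diff Num_R R_1)
  have "supp M \<subseteq> open_halfspace \<rho>"
  proof (rule ccontr)
    assume "\<not> supp M \<subseteq> open_halfspace \<rho>"
    then have ne: "supp M - open_halfspace \<rho> \<noteq> {}" by blast
    have fin: "finite (supp M - open_halfspace \<rho>)" using finite_supp by blast
    (* a term of lowest degree of M survives in M * G *)
    obtain x where x: "x \<in> supp M - open_halfspace \<rho>" "\<And>z. z \<in> supp M - open_halfspace \<rho> \<Longrightarrow> \<rho> \<bullet> x \<le> \<rho> \<bullet> z"
      using arg_min_if_finite[OF fin ne, of "\<lambda>z. \<rho> \<bullet> z"] by (metis not_le)
    have xL: "x \<in> L" "\<rho> \<bullet> x \<le> 0" using x(1) supp_lattice by (auto simp: open_halfspace_def)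
    have "supp M \<subseteq> halfspace \<rho> (\<rho> \<bullet> x)"
      using x(2) xL supp_lattice by (force simp: open_halfspace_def halfspace_def)
    then have "M \<in> lspan (halfspace \<rho> (\<rho> \<bullet> x))" using lspan_iff[OF halfspace_L] M by blast
    moreover have "G - 1 \<in> lspan (open_halfspace \<rho>)" using G(1) by (simp add: leading_one_def)
    ultimately have "(G - 1) * M \<in> lspan {z \<in> L. \<rho> \<bullet> z > \<rho> \<bullet> x}"
      by (intro lspan_mult[OF _ _ open_halfspace_L halfspace_L]) (auto simp: open_halfspace_def halfspace_def lattice_add inner_add_right)
    then have "coef ((G - 1) * M) x = 0" and R1: "(G - 1) * M \<in> R"
      using lspan_iff[of "{z \<in> L. \<rho> \<bullet> z > \<rho> \<bullet> x}" "(G - 1) * M"] by (auto simp: supp_def)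
    moreover have "M * G = M + (G - 1) * M" by (simp add: algebra_simps)
    ultimately have "coef (M * G) x = coef M x" using coef_add[OF M R1, of x] by simp
    moreover have "supp (M * G) \<subseteq> open_halfspace \<rho>" using G(2) lspan_iff[OF open_halfspace_L] unfolding M_def by blast
    ultimately show False using x(1) unfolding supp_def by (metis DiffD1 DiffD2 mem_Collect_eq subsetD)
  qed
  then show ?thesis using lspan_iff[OF open_halfspace_L] M unfolding M_def by blast
qed

end

section \<open>The functional equations and their extremal solutions\<close>

text \<open>The functional equations for an arbitrary function on the lattice in place of the coefficients of a
  polynomial; in this form they are linear, and also apply to Laurent polynomials.\<close>

definition FE :: "('i::{finite,linorder} \<Rightarrow> 'v::euclidean_space) \<Rightarrow> nat \<Rightarrow> ('v \<Rightarrow> complex) \<Rightarrow> bool" where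
  "FE \<alpha> q a \<longleftrightarrow>
     (\<forall>k. \<forall>\<nu>\<in>root_lattice \<alpha>. \<forall>\<mu>\<in>root_lattice \<alpha>.
        \<mu> = reflect (\<alpha> k) \<nu> + \<alpha> k \<and> weight_ge \<alpha> \<mu> \<nu> \<longrightarrow>
        (let \<beta> = \<nu> - \<mu> + \<alpha> k;
             q' = complex_of_nat q;
             c = complex_of_real (real q powr (real_of_int (height \<alpha> \<beta>) / 2))
         in (even (phi \<alpha> k \<mu>) \<longrightarrow>
               q' * a (\<nu> - \<alpha> k) + a \<nu> = c * (a \<mu> + a (\<mu> + \<alpha> k) / q')) \<and>
            (odd (phi \<alpha> k \<mu>) \<longrightarrow>
               q'^2 * a (\<nu> - 2 *\<^sub>R \<alpha> k) - a \<nu> =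
                 complex_of_real (sqrt (real q)) * c * (a \<mu> - a (\<mu> + 2 *\<^sub>R \<alpha> k) / q'^2))))"

lemma functional_equations_FE: "functional_equations \<alpha> q p \<longleftrightarrow> FE \<alpha> q (pcoeff \<alpha> p)"
  by (simp only: functional_equations_def FE_def Let_def)

lemma FE_diff:
  assumes "FE \<alpha> q a" "FE \<alpha> q b" shows "FE \<alpha> q (\<lambda>x. a x - b x)"
proof -
  have 1: "q' * (a1 - b1) + (a2 - b2) = c * ((a3 - b3) + (a4 - b4) / q')"
    if "q' * a1 + a2 = c * (a3 + a4 / q')" "q' * b1 + b2 = c * (b3 + b4 / q')"
    for q' c a1 a2 a3 a4 b1 b2 b3 b4 :: complex
  proof -
    have "q' * (a1 - b1) + (a2 - b2) = (q' * a1 + a2) - (q' * b1 + b2)" by (simp add: algebra_simps)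
    then show ?thesis unfolding that by (simp add: algebra_simps diff_divide_distrib)
  qed
  have 2: "r * (a1 - b1) - (a2 - b2) = c * ((a3 - b3) - (a4 - b4) / r)"
    if "r * a1 - a2 = c * (a3 - a4 / r)" "r * b1 - b2 = c * (b3 - b4 / r)"
    for r c a1 a2 a3 a4 b1 b2 b3 b4 :: complex
  proof -
    have "r * (a1 - b1) - (a2 - b2) = (r * a1 - a2) - (r * b1 - b2)" by (simp add: algebra_simps)
    then show ?thesis unfolding that by (simp add: algebra_simps diff_divide_distrib)
  qed
  show ?thesis
    unfolding FE_def Let_def
  proof (intro allI ballI impI conjI)
    fix k \<nu> \<mu> assume m: "\<nu> \<in> root_lattice \<alpha>" "\<mu> \<in> root_lattice \<alpha>" "\<mu> = reflect (\<alpha> k) \<nu> + \<alpha> k \<and> weight_ge \<alpha> \<mu> \<nu>"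
    note A = assms(1)[unfolded FE_def Let_def, rule_format, OF m] and B = assms(2)[unfolded FE_def Let_def, rule_format, OF m]
    show "of_nat q * (a (\<nu> - \<alpha> k) - b (\<nu> - \<alpha> k)) + (a \<nu> - b \<nu>) =
       complex_of_real (real q powr (real_of_int (height \<alpha> (\<nu> - \<mu> + \<alpha> k)) / 2)) *
         ((a \<mu> - b \<mu>) + (a (\<mu> + \<alpha> k) - b (\<mu> + \<alpha> k)) / of_nat q)" if "even (phi \<alpha> k \<mu>)"
      by (rule 1) (use A B that in blast)+
    show "of_nat q ^ 2 * (a (\<nu> - 2 *\<^sub>R \<alpha> k) - b (\<nu> - 2 *\<^sub>R \<alpha> k)) - (a \<nu> - b \<nu>) =
       complex_of_real (sqrt (real q)) * complex_of_real (real q powr (real_of_int (height \<alpha> (\<nu> - \<mu> + \<alpha> k)) / 2)) *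
         ((a \<mu> - b \<mu>) - (a (\<mu> + 2 *\<^sub>R \<alpha> k) - b (\<mu> + 2 *\<^sub>R \<alpha> k)) / of_nat q ^ 2)" if "odd (phi \<alpha> k \<mu>)"
      by (rule 2) (use A B that in blast)+
  qed
qed

context laurent_system begin

lemma powr_half: "complex_of_real (real q powr (real_of_int n / 2)) = sq powi n"
proof -
  have "real q powr (real_of_int n / 2) = (real q powr (1 / 2)) powr real_of_int n"
    by (simp add: powr_powr)
  also have "\<dots> = sqrt (real q) powr real_of_int n" by (simp add: powr_half_sqrt)
  also have "\<dots> = sqrt (real q) powi n" using q_gt_1 by (simp add: powr_real_of_int')
  finally show ?thesis by (simp add: sq_def)
qed

text \<open>Suppose that \<open>x\<close> pairs positively with the coroot of \<open>\<alpha> k\<close>, and let \<open>\<mu>\<close> be the last support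
  point of the form \<open>x + j \<alpha>\<^sub>k\<close>, in steps of \<open>1\<close> or \<open>2\<close> according to parity. The functional equation
  relates \<open>a \<mu>\<close> to the mirror point \<open>\<nu>\<close> and to points beyond \<open>\<mu>\<close> and \<open>\<nu>\<close>, where \<open>a\<close> vanishes. So \<open>\<nu>\<close>
  lies in the support, and \<open>\<xi> \<bullet> \<nu> \<ge> \<xi> \<bullet> x\<close> forces \<open>\<nu> = \<mu> = x\<close>. Then \<open>x\<close>
  takes the odd value \<open>1\<close> on the coroot, so the odd equation applies, and it reads \<open>- a x = q * a x\<close>.\<close>

lemma FE_extremal:
  assumes fe: "FE \<alpha> q a" and fin: "finite {x \<in> L. a x \<noteq> 0}" and xi: "\<And>k. \<xi> \<bullet> \<alpha> k > 0"
    and x: "x \<in> L" "a x \<noteq> 0" and min: "\<And>z. z \<in> L \<Longrightarrow> a z \<noteq> 0 \<Longrightarrow> \<xi> \<bullet> x \<le> \<xi> \<bullet> z"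
  shows "pair x k \<le> 0"
proof (rule ccontr)
  assume neg: "\<not> pair x k \<le> 0"
  define n where "n = 2 * root_coord \<alpha> x k - phi \<alpha> k x"
  have pn: "pair x k = of_int n" using pair_eq[OF x(1), of k] by (simp add: n_def)
  then have n1: "n \<ge> 1" using neg by simp
  (* the even equation links neighbours on the string, the odd one every second point *)
  define st :: nat where "st = (if even (phi \<alpha> k x) then 1 else 2)"
  have st: "st \<ge> 1" by (simp add: st_def)
  define pt where "pt j = x + real (st * j) *\<^sub>R \<alpha> k" for j
  have ptL: "pt j \<in> L" for j
    unfolding pt_def by (intro lattice_add x lattice_scale lattice_simple Ints_of_nat)
  have inj: "inj pt" using st simple_nonzero by (auto simp: inj_def pt_def)
  define J where "J = {j. a (pt j) \<noteq> 0}"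
  have "pt ` J \<subseteq> {x \<in> L. a x \<noteq> 0}" using ptL by (auto simp: J_def)
  then have finJ: "finite J" using fin inj finite_subset finite_imageD inj_on_subset by (metis subset_UNIV)
  have "0 \<in> J" using x by (simp add: J_def pt_def)
  define j where "j = Max J"
  have jJ: "j \<in> J" unfolding j_def using finJ \<open>0 \<in> J\<close> by (intro Max_in) auto
  have "Suc j \<notin> J" using Max_ge[OF finJ, of "Suc j"] unfolding j_def by auto
  define \<mu> where "\<mu> = pt j"
  have am: "a \<mu> \<noteq> 0" using jJ by (simp add: \<mu>_def J_def)
  have "\<mu> + real st *\<^sub>R \<alpha> k = pt (Suc j)" by (simp add: \<mu>_def pt_def algebra_simps)
  then have am': "a (\<mu> + real st *\<^sub>R \<alpha> k) = 0" using \<open>Suc j \<notin> J\<close> by (simp add: J_def)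
  have mL: "\<mu> \<in> L" unfolding \<mu>_def by (rule ptL)
  define N where "N = n - 1 + 2 * int (st * j)"
  have pm: "pair \<mu> k = of_int N + 1"
    by (simp add: \<mu>_def pt_def pair_add pair_scale pair_self pn N_def)
  define \<nu> where "\<nu> = s k \<mu> + \<alpha> k"
  have nL: "\<nu> \<in> L" unfolding \<nu>_def by (intro lattice_add s_lattice mL lattice_simple)
  have mn: "\<mu> = s k \<nu> + \<alpha> k" by (simp add: \<nu>_def s_add s_s s_self)
  have nm: "\<nu> = \<mu> - of_int N *\<^sub>R \<alpha> k" by (simp add: \<nu>_def s_eq pm algebra_simps)
  have nx: "\<nu> = x - of_int (n - 1 + int (st * j)) *\<^sub>R \<alpha> k"
  proof -
    have "real_of_int N - real (st * j) = of_int (n - 1 + int (st * j))" by (simp add: N_def)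
    moreover have "\<nu> = x - (of_int N - real (st * j)) *\<^sub>R \<alpha> k"
      unfolding nm \<mu>_def pt_def by (simp add: scaleR_diff_left)
    ultimately show ?thesis by (simp only:)
  qed
  have ge: "weight_ge \<alpha> \<mu> \<nu>"
    unfolding weight_ge_def
  proof (rule exI[of _ "\<lambda>i. if i = k then nat N else 0"])
    have "(\<Sum>i\<in>UNIV. real (if i = k then nat N else 0) *\<^sub>R \<alpha> i) = (\<Sum>i\<in>UNIV. if i = k then real (nat N) *\<^sub>R \<alpha> i else 0)"
      by (rule sum.cong) auto
    then show "\<mu> - \<nu> = (\<Sum>i\<in>UNIV. real (if i = k then nat N else 0) *\<^sub>R \<alpha> i)"
      using n1 by (simp add: nm N_def)
  qed
  have phi: "phi \<alpha> k \<mu> = phi \<alpha> k x"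
  proof -
    have "phi \<alpha> k \<mu> = phi \<alpha> k x + phi \<alpha> k (of_int (int (st * j)) *\<^sub>R \<alpha> k)"
      unfolding \<mu>_def pt_def of_int_of_nat_eq
      by (rule phi_add[OF x(1) lattice_scale[OF lattice_simple Ints_of_nat]])
    also have "phi \<alpha> k (of_int (int (st * j)) *\<^sub>R \<alpha> k) = 0"
      unfolding phi_scale[OF lattice_simple] by (simp add: phi_simple adjacent_irrefl)
    finally show ?thesis by simp
  qed
  have low: "a z = 0" if "z = \<nu> - t *\<^sub>R \<alpha> k" "t > 0" "z \<in> L" for z t
  proof (rule ccontr)
    assume "a z \<noteq> 0"
    then have "\<xi> \<bullet> x \<le> \<xi> \<bullet> z" using min that by blast
    moreover have "\<xi> \<bullet> z = \<xi> \<bullet> x - (of_int (n - 1 + int (st * j)) + t) * (\<xi> \<bullet> \<alpha> k)"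
      by (simp add: that(1) nx inner_diff_right algebra_simps)
    moreover have "(of_int (n - 1 + int (st * j)) + t) * (\<xi> \<bullet> \<alpha> k) > 0"
      using xi[of k] that(2) n1 by (intro mult_pos_pos add_nonneg_pos) auto
    ultimately show False by simp
  qed
  have l1: "a (\<nu> - \<alpha> k) = 0" by (rule low[of _ 1]) (simp_all add: lattice_diff nL lattice_simple)
  have l2: "a (\<nu> - 2 *\<^sub>R \<alpha> k) = 0" by (rule low[of _ 2]) (simp_all add: lattice_diff nL double_lattice lattice_simple)
  define c where "c = complex_of_real (real q powr (real_of_int (height \<alpha> (\<nu> - \<mu> + \<alpha> k)) / 2))"
  have c0: "c \<noteq> 0" using q_gt_1 by (simp add: c_def)
  note E = fe[unfolded FE_def Let_def, rule_format, OF nL mL conjI[OF mn ge], folded c_def, unfolded phi l1 l2]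
  have tight: "n = 1 \<and> j = 0" if "a \<nu> \<noteq> 0"
  proof -
    have "\<xi> \<bullet> x \<le> \<xi> \<bullet> \<nu>" using min nL that by blast
    then have "of_int (n - 1 + int (st * j)) * (\<xi> \<bullet> \<alpha> k) \<le> 0" by (simp add: nx inner_diff_right)
    then have "real_of_int (n - 1 + int (st * j)) \<le> 0" using xi[of k] by (metis mult_le_0_iff not_le)
    then have "n - 1 + int (st * j) \<le> 0" by (simp only: of_int_le_0_iff)
    then have "n = 1 \<and> int (st * j) = 0" using n1 by linarith
    then show ?thesis using st by auto
  qed
  show False
  proof (cases "even (phi \<alpha> k x)")
    case True
    then have "a (\<mu> + \<alpha> k) = 0" using am' by (simp add: st_def)
    then have "a \<nu> = c * a \<mu>" using E True by simp
    then have "n = 1" using tight am c0 by simp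
    moreover have "even n" using True by (simp add: n_def)
    ultimately show False by simp
  next
    case False
    then have "a (\<mu> + 2 *\<^sub>R \<alpha> k) = 0" using am' by (simp add: st_def)
    then have e: "- a \<nu> = complex_of_real (sqrt (real q)) * c * a \<mu>" using E False by simp
    then have "a \<nu> \<noteq> 0" using am c0 q_gt_1 by auto
    then have nj: "n = 1" "j = 0" using tight by auto
    then have nmx: "\<nu> = x" "\<mu> = x" by (simp_all add: nx \<mu>_def pt_def)
    have "c = sq" unfolding c_def powr_half nmx by (simp add: height_simple)
    then have "- a x = of_nat q * a x" using e sq_square unfolding nmx sq_def[symmetric] by simp
    then have "(1 + of_nat q) * a x = 0" by (metis add.right_inverse distrib_right mult_1)
    moreover have "1 + complex_of_nat q \<noteq> 0" by (metis of_nat_Suc of_nat_neq_0)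
    ultimately show False using x by simp
  qed
qed

text \<open>The simple roots pair nonpositively with \<open>x\<close>, hence so does every nonnegative combination of them.\<close>

lemma antidominant_inner: "(\<And>k. pair x k \<le> 0) \<Longrightarrow> (\<And>i. crd v i \<ge> 0) \<Longrightarrow> v \<bullet> x \<le> 0"
proof -
  assume p: "\<And>k. pair x k \<le> 0" and v: "\<And>i. crd v i \<ge> 0"
  have "x \<bullet> \<alpha> i \<le> 0" for i
    using p[of i] inner_ge_zero[of "\<alpha> i"] unfolding inner_pair[of x i] by (simp add: mult_nonpos_nonneg)
  then have "x \<bullet> v \<le> 0"
    unfolding inner_expand[of x v] using v by (intro sum_nonpos mult_nonneg_nonpos) auto
  then show ?thesis by (simp add: inner_commute)
qed

lemma antidominant_zero: "(\<And>k. pair x k \<le> 0) \<Longrightarrow> (\<And>i. crd x i \<ge> 0) \<Longrightarrow> x = 0"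
  using antidominant_inner[of x x] inner_ge_zero[of x] by (metis inner_eq_zero_iff order_antisym)

lemma inner_rho_simple: "\<rho> \<bullet> \<alpha> k > 0" by (rule inner_rho_Pos[OF simple_Pos])

lemma obtain_minimal:
  assumes "finite A" "A \<noteq> {}"
  obtains x where "x \<in> A" "\<And>z. z \<in> A \<Longrightarrow> \<xi> \<bullet> x \<le> (\<xi> \<bullet> z :: real)"
  using arg_min_if_finite[OF assms, of "\<lambda>z. \<xi> \<bullet> z"] by (metis not_le)

lemma pcoeff_nonneg: "x \<in> L \<Longrightarrow> pcoeff \<alpha> p x \<noteq> 0 \<Longrightarrow> crd x i \<ge> 0"
  using root_coord_eq[of x i] by (auto simp: pcoeff_def split: if_splits) (metis of_int_0_le_iff)

lemma finite_pcoeff: "finite {x \<in> L. pcoeff \<alpha> p x \<noteq> 0}"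
proof (rule finite_imageD)
  let ?e = "\<lambda>x. Abs_poly_mapping (\<lambda>i. nat (root_coord \<alpha> x i))"
  show "finite (?e ` {x \<in> L. pcoeff \<alpha> p x \<noteq> 0})"
    by (rule finite_subset[OF _ finite_keys[of p]]) (auto simp: pcoeff_def in_keys_iff split: if_splits)
  show "inj_on ?e {x \<in> L. pcoeff \<alpha> p x \<noteq> 0}"
  proof (rule inj_onI)
    fix x z assume x: "x \<in> {x \<in> L. pcoeff \<alpha> p x \<noteq> 0}" and z: "z \<in> {x \<in> L. pcoeff \<alpha> p x \<noteq> 0}" and e: "?e x = ?e z"
    have "root_coord \<alpha> x i = root_coord \<alpha> z i" for i
    proof -
      have "nat (root_coord \<alpha> x i) = nat (root_coord \<alpha> z i)"
        using arg_cong[OF e, of "\<lambda>m. Poly_Mapping.lookup m i"] by simp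
      moreover have "root_coord \<alpha> x i \<ge> 0" "root_coord \<alpha> z i \<ge> 0"
        using x z by (auto simp: pcoeff_def split: if_splits)
      ultimately show ?thesis by simp
    qed
    then show "x = z" using x z root_coord_inj by blast
  qed
qed

lemma pcoeff_inject:
  assumes "\<And>x. x \<in> L \<Longrightarrow> pcoeff \<alpha> p x = pcoeff \<alpha> p' x" shows "p = p'"
proof (rule poly_mapping_eqI)
  fix m :: "'i \<Rightarrow>\<^sub>0 nat"
  define x where "x = (\<Sum>i\<in>UNIV. of_int (int (Poly_Mapping.lookup m i)) *\<^sub>R \<alpha> i)"
  have x: "x \<in> L" unfolding x_def by (intro lattice_sum lattice_scale lattice_simple) auto
  have rc: "root_coord \<alpha> x i = int (Poly_Mapping.lookup m i)" for i
    using root_coord_eq[OF x, of i] unfolding x_def crd_comb by simp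
  have "pcoeff \<alpha> r x = Poly_Mapping.lookup r m" for r :: "'i mpoly"
    by (simp add: pcoeff_def rc)
  then show "Poly_Mapping.lookup p m = Poly_Mapping.lookup p' m" using assms[OF x] by simp
qed

lemma FE_unique:
  assumes "pcoeff \<alpha> p 0 = pcoeff \<alpha> p' 0" "functional_equations \<alpha> q p" "functional_equations \<alpha> q p'"
  shows "p = p'"
proof (rule pcoeff_inject, rule ccontr)
  fix x assume x: "x \<in> L" "pcoeff \<alpha> p x \<noteq> pcoeff \<alpha> p' x"
  define a where "a z = pcoeff \<alpha> p z - pcoeff \<alpha> p' z" for z
  have fe: "FE \<alpha> q a" unfolding a_def using assms(2,3) unfolding functional_equations_FE by (rule FE_diff)
  have "{x \<in> L. a x \<noteq> 0} \<subseteq> {x \<in> L. pcoeff \<alpha> p x \<noteq> 0} \<union> {x \<in> L. pcoeff \<alpha> p' x \<noteq> 0}"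
    by (auto simp: a_def)
  then have fin: "finite {x \<in> L. a x \<noteq> 0}" by (rule finite_subset) (simp add: finite_pcoeff)
  moreover have "{x \<in> L. a x \<noteq> 0} \<noteq> {}" using x by (auto simp: a_def)
  ultimately obtain z where z: "z \<in> {x \<in> L. a x \<noteq> 0}" "\<And>w. w \<in> {x \<in> L. a x \<noteq> 0} \<Longrightarrow> \<rho> \<bullet> z \<le> \<rho> \<bullet> w"
    by (rule obtain_minimal[where \<xi> = \<rho>]) blast
  have "pair z k \<le> 0" for k
    by (rule FE_extremal[OF fe fin inner_rho_simple]) (use z in auto)
  moreover have "crd z i \<ge> 0" for i
  proof -
    have zL: "z \<in> L" and "pcoeff \<alpha> p z \<noteq> 0 \<or> pcoeff \<alpha> p' z \<noteq> 0" using z(1) by (auto simp: a_def)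
    then show ?thesis using pcoeff_nonneg[OF zL] by blast
  qed
  ultimately have "z = 0" by (rule antidominant_zero)
  then show False using z(1) assms(1) by (simp add: a_def)
qed

section \<open>The numerator\<close>

lemma Num_T: "Num * fac qi (- \<alpha> k) = fac qi (\<alpha> k) * T k Num"
proof -
  let ?D' = "\<Prod>\<beta>\<in>Pos - {\<alpha> k}. fac qi \<beta>"
  have D: "Dp = fac qi (\<alpha> k) * ?D'" unfolding Dprod_eq by (rule prod.remove[OF finite_Pos simple_Pos])
  have D0: "fac qi (\<alpha> k) \<noteq> 0" "fac qi (- \<alpha> k) \<noteq> 0" "?D' \<noteq> 0"
    using fac_nonzero simple_root uminus_root pos_root by (auto simp: finite_Pos)
  have ev: "E k Dp = Dp"
    unfolding Dprod_eq hom_prod[OF E_hom] by (simp add: E_fac root_lattice_root pos_root)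
  have SD: "S k Dp = fac qi (- \<alpha> k) * ?D'"
    unfolding D hom_mult[OF S_hom] S_prod_others by (simp add: S_fac lattice_simple s_self)
  have "T k Num = S k Dp * T k fav" unfolding Num_def by (rule T_mult[OF ev])
  then have TN: "T k Num = fac qi (- \<alpha> k) * ?D' * fav" unfolding SD T_averaged .
  show ?thesis unfolding TN unfolding Num_def D by (simp only: mult_ac)
qed

text \<open>The invariance of \<open>f = N/D\<close> under \<open>\<sigma>\<^sub>k\<close> for the two parts of \<open>N\<close>. Under \<open>\<sigma>\<^sub>k\<close> only the factor
  of \<open>D\<close> at \<open>\<alpha> k\<close> changes, and most of it cancels against the slash coefficients.\<close>

lemma Num_parity:
  fixes k defines "P \<equiv> (Num + E k Num) / 2" and "M \<equiv> (Num - E k Num) / 2"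
  shows "P + sF * (y k * P) = sF * (y k * S k P) + ymon (2 *\<^sub>R \<alpha> k) * S k P"
    and "const_fun (of_nat q) * (ymon (2 *\<^sub>R \<alpha> k) * M) - M =
      const_fun (of_nat q) * (y k * S k M) - ymon (3 *\<^sub>R \<alpha> k) * S k M"
proof -
  let ?a = "fac qi (\<alpha> k)" and ?b = "fac qi (- \<alpha> k)"
  let ?C = "slash_coeff sF True (y k)" and ?C' = "slash_coeff sF False (y k)"
  have y0: "y k \<noteq> 0" by (rule ymon_nonzero)
  have n: "sF - y k \<noteq> 0" "sF * y k - 1 \<noteq> 0" using sF_ne(1,2)[of k] by auto
  have 1: "Num * ?b = ?a * (?C * S k P + ?C' * S k M)"
    using Num_T[of k] unfolding T_eq P_def M_def .
  have EP: "E k P = P" unfolding P_def by (simp add: E_simps E_E add.commute)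
  have EM: "E k M = - M" unfolding M_def by (simp add: E_simps E_E field_simps)
  have ES: "E k (S k g) = S k (E k g)" for g by (simp add: E_S adjacent_irrefl)
  have Ef: "E k ?a = ?a" "E k ?b = ?b" by (simp_all add: E_fac lattice_simple lattice_minus)
  have EC: "E k (slash_coeff sF b (y k)) = slash_coeff sF b (y k)" for b
    by (simp add: hom_slash_coeff[OF E_hom] E_y)
  have 2: "E k Num * ?b = ?a * (?C * S k P + ?C' * (- S k M))"
    using arg_cong[OF 1, of "E k"]
    by (simp only: hom_mult[OF E_hom] hom_add[OF E_hom] Ef EC ES EP EM hom_minus[OF S_hom])
  have P1: "P * ?b = ?a * (?C * S k P)"
  proof -
    have "P * ?b = (Num * ?b + E k Num * ?b) / 2" by (simp add: P_def field_simps)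
    also have "\<dots> = ?a * (?C * S k P)" unfolding 1 2 by (simp add: field_simps)
    finally show ?thesis .
  qed
  have M1: "M * ?b = ?a * (?C' * S k M)"
  proof -
    have "M * ?b = (Num * ?b - E k Num * ?b) / 2" by (simp add: M_def field_simps)
    also have "\<dots> = ?a * (?C' * S k M)" unfolding 1 2 by (simp add: field_simps)
    finally show ?thesis .
  qed
  have y2: "ymon (2 *\<^sub>R \<alpha> k) = y k * y k" by (rule ymon_double_eq[OF lattice_simple])
  have y3: "ymon (3 *\<^sub>R \<alpha> k) = y k * y k * y k"
  proof -
    have "3 *\<^sub>R \<alpha> k = 2 *\<^sub>R \<alpha> k + \<alpha> k" by (metis add.commute numeral_plus_one one_plus_numeral scaleR_add_left scaleR_one semiring_norm(3,5))
    then show ?thesis using ymon_add[OF double_lattice lattice_simple] by (simp add: lattice_simple y2)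
  qed
  have q: "const_fun (of_nat q) = sF * sF" by (simp only: const_fun_of_nat sF_square)
  have gen1: "x + w * (t * x) = w * (t * z) + t * t * z"
    if "x * ((w * t - 1) * (w * t + 1) / (w * t * (w * t))) = (w - t) * (w + t) / (w * w) * ((w * t - 1) / (t * (w - t)) * z)"
      "w \<noteq> 0" "t \<noteq> 0" "w - t \<noteq> 0" "w * t - 1 \<noteq> 0" for x z w t :: "'i ratfun"
  proof -
    have "(w * t - 1) * (x * (w * t + 1)) = x * ((w * t - 1) * (w * t + 1) / (w * t * (w * t))) * (w * t * (w * t))"
      using that(2,3) by simp
    also have "\<dots> = (w * t - 1) * (t * (w + t) * z)"
      unfolding that(1) using that(2,3,4) by (simp add: field_simps)
    finally have "x * (w * t + 1) = t * (w + t) * z" using that(5) by simp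
    then show ?thesis by (simp add: algebra_simps)
  qed
  have gen2: "w * w * (t * t * x) - x = w * w * (t * z) - t * t * t * z"
    if "x * ((w * t - 1) * (w * t + 1) / (w * t * (w * t))) = (w - t) * (w + t) / (w * w) * (1 / t * z)"
      "w \<noteq> 0" "t \<noteq> 0" for x z w t :: "'i ratfun"
  proof -
    have "x * ((w * t - 1) * (w * t + 1)) = x * ((w * t - 1) * (w * t + 1) / (w * t * (w * t))) * (w * t * (w * t))"
      using that(2,3) by simp
    also have "\<dots> = (w - t) * (w + t) * t * z"
      unfolding that(1) using that(2,3) by (simp add: field_simps)
    finally show ?thesis by (simp add: algebra_simps)
  qed
  show "P + sF * (y k * P) = sF * (y k * S k P) + ymon (2 *\<^sub>R \<alpha> k) * S k P"
    unfolding y2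
    by (rule gen1[OF _ sF_nonzero y0 n]) (use P1 in \<open>simp only: fac_qi fac_qi_minus slash_coeff_def if_True\<close>)
  show "const_fun (of_nat q) * (ymon (2 *\<^sub>R \<alpha> k) * M) - M =
      const_fun (of_nat q) * (y k * S k M) - ymon (3 *\<^sub>R \<alpha> k) * S k M"
    unfolding y2 y3 q
    by (rule gen2[OF _ sF_nonzero y0]) (use M1 in \<open>simp only: fac_qi fac_qi_minus slash_coeff_def if_False\<close>)
qed

lemma Num_coef:
  assumes x: "x \<in> L" and z: "z = s k x + \<alpha> k"
  shows "chi k x = 1 \<Longrightarrow> sq * coef Num (x - \<alpha> k) + coef Num x = sq * coef Num z + coef Num (z + \<alpha> k)"
    and "chi k x = - 1 \<Longrightarrow> of_nat q * coef Num (x - 2 *\<^sub>R \<alpha> k) - coef Num x =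
      of_nat q * coef Num z - coef Num (z + 2 *\<^sub>R \<alpha> k)"
proof -
  let ?P = "(Num + E k Num) / 2" and ?M = "(Num - E k Num) / 2"
  have EN: "E k Num \<in> R" by (rule lspan_E[OF Num_R order_refl])
  have PR: "?P \<in> R" and MR: "?M \<in> R" by (intro R_half lspan_add lspan_diff Num_R EN)+
  have coef_half: "coef (g / 2) w = coef g w / 2" if "g \<in> R" for g w
    using coef_const[OF that, of "1 / 2" w] by (simp add: const_fun_divide const_fun_1 const_fun_numeral)
  have cP: "coef ?P w = (1 + chi k w) / 2 * coef Num w" for w
    unfolding coef_half[OF lspan_add[OF Num_R EN]] coef_add[OF Num_R EN] coef_E[OF Num_R] by (simp add: algebra_simps)
  have cM: "coef ?M w = (1 - chi k w) / 2 * coef Num w" for w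
    unfolding coef_half[OF lspan_diff[OF Num_R EN]] coef_diff[OF Num_R EN] coef_E[OF Num_R] by (simp add: algebra_simps)
  have a2: "2 *\<^sub>R \<alpha> k \<in> L" "3 *\<^sub>R \<alpha> k \<in> L" "\<alpha> k \<in> L"
    by (simp_all add: lattice_scale lattice_simple)
  have zL: "z \<in> L" unfolding z by (intro lattice_add s_lattice x lattice_simple)
  have ca: "chi k (w + of_int m *\<^sub>R \<alpha> k) = chi k w" if "w \<in> L" for w m
  proof -
    have "phi \<alpha> k (w + of_int m *\<^sub>R \<alpha> k) = phi \<alpha> k w + m * phi \<alpha> k (\<alpha> k)"
      using phi_add[OF that lattice_scale[OF lattice_simple Ints_of_int]] phi_scale[OF lattice_simple] by simp
    then show ?thesis by (simp add: chi_def phi_simple adjacent_irrefl)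
  qed
  have chis: "chi k (x - \<alpha> k) = chi k x" "chi k (x - 2 *\<^sub>R \<alpha> k) = chi k x" "chi k z = chi k x"
    "chi k (z + \<alpha> k) = chi k x" "chi k (z + 2 *\<^sub>R \<alpha> k) = chi k x"
  proof -
    have sx: "chi k (s k x) = chi k x" using chi_s[OF x, of k k] adjacent_irrefl[of k] by simp
    show "chi k (x - \<alpha> k) = chi k x" using ca[OF x, of "- 1"] by simp
    show "chi k (x - 2 *\<^sub>R \<alpha> k) = chi k x" using ca[OF x, of "- 2"] by simp
    show zc: "chi k z = chi k x" using ca[OF s_lattice[OF x], of k 1] sx by (simp add: z)
    show "chi k (z + \<alpha> k) = chi k x" using ca[OF zL, of 1] zc by simp
    show "chi k (z + 2 *\<^sub>R \<alpha> k) = chi k x" using ca[OF zL, of 2] zc by simp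
  qed
  have sk: "s k (x - \<alpha> k) = z" "s k (x - 2 *\<^sub>R \<alpha> k) = z + \<alpha> k" "s k (x - 3 *\<^sub>R \<alpha> k) = z + 2 *\<^sub>R \<alpha> k"
  proof -
    have three: "3 *\<^sub>R \<alpha> k = \<alpha> k + 2 *\<^sub>R \<alpha> k" using scaleR_add_left[of 1 2 "\<alpha> k"] by simp
    show "s k (x - \<alpha> k) = z" by (simp add: z s_diff s_self)
    show "s k (x - 2 *\<^sub>R \<alpha> k) = z + \<alpha> k" by (simp add: z s_diff s_self s_add scaleR_2)
    show "s k (x - 3 *\<^sub>R \<alpha> k) = z + 2 *\<^sub>R \<alpha> k" by (simp add: z s_diff s_self s_scale s_add three)
  qed
  have yR: "ymon d * g \<in> R" if "d \<in> L" "g \<in> R" for d g using that by (intro R_mult R_ymon)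
  have cy: "coef (ymon d * S k g) x = coef g (s k (x - d))" if "d \<in> L" "g \<in> R" for d g
    unfolding coef_ymon_mult[OF R_S[OF that(2)] that(1)] coef_S[OF that(2)] ..
  note e1 = arg_cong[OF Num_parity(1)[of k], of "\<lambda>f. coef f x"]
  have "coef ?P x + sq * coef ?P (x - \<alpha> k) = sq * coef ?P (s k (x - \<alpha> k)) + coef ?P (s k (x - 2 *\<^sub>R \<alpha> k))"
    using e1
    unfolding coef_add[OF PR lspan_const[OF yR[OF a2(3) PR]]]
      coef_add[OF lspan_const[OF yR[OF a2(3) R_S[OF PR]]] yR[OF a2(1) R_S[OF PR]]]
      coef_const[OF yR[OF a2(3) PR]] coef_const[OF yR[OF a2(3) R_S[OF PR]]]
      cy[OF a2(3) PR] cy[OF a2(1) PR] coef_ymon_mult[OF PR a2(3)] .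
  then show "sq * coef Num (x - \<alpha> k) + coef Num x = sq * coef Num z + coef Num (z + \<alpha> k)" if "chi k x = 1"
    unfolding cP sk chis that by (simp add: add.commute)
  note e2 = arg_cong[OF Num_parity(2)[of k], of "\<lambda>f. coef f x"]
  have "of_nat q * coef ?M (x - 2 *\<^sub>R \<alpha> k) - coef ?M x = of_nat q * coef ?M (s k (x - \<alpha> k)) - coef ?M (s k (x - 3 *\<^sub>R \<alpha> k))"
    using e2
    unfolding coef_diff[OF lspan_const[OF yR[OF a2(1) MR]] MR]
      coef_diff[OF lspan_const[OF yR[OF a2(3) R_S[OF MR]]] yR[OF a2(2) R_S[OF MR]]]
      coef_const[OF yR[OF a2(1) MR]] coef_const[OF yR[OF a2(3) R_S[OF MR]]]
      cy[OF a2(3) MR] cy[OF a2(2) MR] coef_ymon_mult[OF MR a2(1)] .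
  then show "of_nat q * coef Num (x - 2 *\<^sub>R \<alpha> k) - coef Num x = of_nat q * coef Num z - coef Num (z + 2 *\<^sub>R \<alpha> k)"
    if "chi k x = - 1"
    unfolding cM sk chis that by simp
qed

text \<open>Coefficients with respect to the monomials \<open>x\<^sup>\<nu>\<close> rather than \<open>y\<^sup>\<nu>\<close>.\<close>

definition x_coeff :: "'v \<Rightarrow> complex" where "x_coeff x = sq powi height \<alpha> x * coef Num x"

lemma FE_x_coeff: "FE \<alpha> q x_coeff"
  unfolding FE_def Let_def powr_half
proof (intro allI ballI impI conjI)
  fix k \<nu> \<mu> assume nL: "\<nu> \<in> L" and mL: "\<mu> \<in> L" and m: "\<mu> = s k \<nu> + \<alpha> k \<and> weight_ge \<alpha> \<mu> \<nu>"
  then have mu: "\<mu> = s k \<nu> + \<alpha> k" by simp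
  have aL: "\<alpha> k \<in> L" by (rule lattice_simple)
  have h2: "height \<alpha> (2 *\<^sub>R \<alpha> k) = 2" by (simp add: height_double aL height_simple)
  have hd: "height \<alpha> (x - z) = height \<alpha> x - height \<alpha> z" if "x \<in> L" "z \<in> L" for x z
    using height_add[OF lattice_diff[OF that] that(2)] by simp
  have q2: "(of_nat q :: complex) = sq powi 2" by (simp add: sq_square[symmetric] power2_eq_square)
  have ph: "phi \<alpha> k \<mu> = phi \<alpha> k \<nu>"
    using phi_add[OF s_lattice[OF nL] aL, of k k] phi_s[OF nL, of k k] unfolding mu
    by (simp add: phi_simple adjacent_irrefl)
  define h where "h = height \<alpha> \<nu>"
  define h' where "h' = height \<alpha> \<mu>"
  have hb: "height \<alpha> (\<nu> - \<mu> + \<alpha> k) = h - h' + 1"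
    by (simp add: height_add[OF lattice_diff[OF nL mL] aL] hd[OF nL mL] height_simple h_def h'_def)
  have hs: "height \<alpha> (\<nu> - \<alpha> k) = h - 1" "height \<alpha> (\<nu> - 2 *\<^sub>R \<alpha> k) = h - 2"
    "height \<alpha> (\<mu> + \<alpha> k) = h' + 1" "height \<alpha> (\<mu> + 2 *\<^sub>R \<alpha> k) = h' + 2"
    by (simp_all add: hd height_add nL mL aL double_lattice h2 height_simple h_def h'_def)
  have pw: "sq powi m * sq powi n = sq powi m' * sq powi n'" if "m + n = m' + n'" for m n m' n'
    using that by (metis power_int_add sq_nonzero)
  show "of_nat q * x_coeff (\<nu> - \<alpha> k) + x_coeff \<nu> = sq powi height \<alpha> (\<nu> - \<mu> + \<alpha> k) * (x_coeff \<mu> + x_coeff (\<mu> + \<alpha> k) / of_nat q)"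
    if "even (phi \<alpha> k \<mu>)"
  proof -
    have "chi k \<nu> = 1" using that ph by (simp add: chi_def)
    note e = Num_coef(1)[OF nL mu this]
    have "of_nat q * x_coeff (\<nu> - \<alpha> k) + x_coeff \<nu> = sq powi h * (sq * coef Num (\<nu> - \<alpha> k) + coef Num \<nu>)"
    proof -
      have "sq powi 2 * sq powi (h - 1) = sq powi h * sq" using pw[of 2 "h - 1" h 1] by simp
      then show ?thesis unfolding x_coeff_def hs h_def[symmetric] q2
        by (simp only: distrib_left mult.assoc[symmetric])
    qed
    also have "\<dots> = sq powi h * (sq * coef Num \<mu> + coef Num (\<mu> + \<alpha> k))" by (simp only: e)
    also have "\<dots> = sq powi (h - h' + 1) * (x_coeff \<mu> + x_coeff (\<mu> + \<alpha> k) / of_nat q)"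
    proof -
      have "sq powi (h - h' + 1) * x_coeff \<mu> = sq powi h * sq * coef Num \<mu>"
        unfolding x_coeff_def h'_def[symmetric] using pw[of "h - h' + 1" h' h 1]
        by (simp only: mult.assoc[symmetric]) simp
      moreover have "sq powi (h - h' + 1) * (x_coeff (\<mu> + \<alpha> k) / of_nat q) = sq powi h * coef Num (\<mu> + \<alpha> k)"
      proof -
        have "sq powi (h - h' + 1) * sq powi (h' + 1) = sq powi h * sq powi 2" by (rule pw) simp
        then show ?thesis unfolding x_coeff_def hs q2 times_divide_eq_right mult.assoc[symmetric]
          using sq_nonzero by simp
      qed
      ultimately show ?thesis by (simp only: distrib_left mult.assoc)
    qed
    finally show ?thesis by (simp only: hb)
  qed
  show "of_nat q ^ 2 * x_coeff (\<nu> - 2 *\<^sub>R \<alpha> k) - x_coeff \<nu> =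
      complex_of_real (sqrt (real q)) * sq powi height \<alpha> (\<nu> - \<mu> + \<alpha> k) * (x_coeff \<mu> - x_coeff (\<mu> + 2 *\<^sub>R \<alpha> k) / of_nat q ^ 2)"
    if "odd (phi \<alpha> k \<mu>)"
  proof -
    have q4: "(of_nat q :: complex)^2 = sq powi 4" by (simp add: q2 power_mult[symmetric])
    have "chi k \<nu> = - 1" using that ph by (simp add: chi_def)
    note e = Num_coef(2)[OF nL mu this]
    have "of_nat q ^ 2 * x_coeff (\<nu> - 2 *\<^sub>R \<alpha> k) - x_coeff \<nu> = sq powi h * (of_nat q * coef Num (\<nu> - 2 *\<^sub>R \<alpha> k) - coef Num \<nu>)"
    proof -
      have "sq powi 4 * sq powi (h - 2) = sq powi h * sq powi 2" by (rule pw) simp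
      then show ?thesis unfolding x_coeff_def hs h_def[symmetric] q4 unfolding q2
        by (simp only: right_diff_distrib mult.assoc[symmetric])
    qed
    also have "\<dots> = sq powi h * (of_nat q * coef Num \<mu> - coef Num (\<mu> + 2 *\<^sub>R \<alpha> k))" by (simp only: e)
    also have "\<dots> = sq * sq powi (h - h' + 1) * (x_coeff \<mu> - x_coeff (\<mu> + 2 *\<^sub>R \<alpha> k) / of_nat q ^ 2)"
    proof -
      have s1: "sq * sq powi (h - h' + 1) = sq powi (h - h' + 2)"
        using pw[of 1 "h - h' + 1" "h - h' + 2" 0] by simp
      have "sq powi (h - h' + 2) * x_coeff \<mu> = sq powi h * of_nat q * coef Num \<mu>"
        unfolding x_coeff_def h'_def[symmetric] q2 using pw[of "h - h' + 2" h' h 2]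
        by (simp only: mult.assoc[symmetric])
      moreover have "sq powi (h - h' + 2) * (x_coeff (\<mu> + 2 *\<^sub>R \<alpha> k) / of_nat q ^ 2) = sq powi h * coef Num (\<mu> + 2 *\<^sub>R \<alpha> k)"
      proof -
        have "sq powi (h - h' + 2) * sq powi (h' + 2) = sq powi h * sq powi 4" by (rule pw) simp
        then show ?thesis unfolding x_coeff_def hs q4 times_divide_eq_right mult.assoc[symmetric]
          using sq_nonzero by simp
      qed
      ultimately show ?thesis unfolding s1 by (simp only: right_diff_distrib mult.assoc)
    qed
    finally show ?thesis by (simp only: hb sq_def)
  qed
qed

lemma coef_Num_zero: "coef Num 0 = 1" and supp_Num: "x \<in> supp Num \<Longrightarrow> x = 0 \<or> \<rho> \<bullet> x > 0"
proof -
  have M: "supp (Num - 1) \<subseteq> open_halfspace \<rho>" using Num_leading lspan_iff[OF open_halfspace_L] by blast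
  have c: "coef Num x = (if x = 0 then 1 else 0) + coef (Num - 1) x" for x
    using coef_diff[OF Num_R R_1, of x] by (simp add: coef_one)
  have "0 \<notin> supp (Num - 1)" using M by (auto simp: open_halfspace_def)
  then show "coef Num 0 = 1" using c[of 0] by (simp add: supp_def)
  show "x = 0 \<or> \<rho> \<bullet> x > 0" if "x \<in> supp Num"
    using that M c[of x] by (cases "x = 0") (auto simp: supp_def open_halfspace_def)
qed

lemma crd_rho: "crd \<rho> i \<ge> 0"
  unfolding rho_def crd_scale crd_sum by (intro mult_nonneg_nonneg sum_nonneg) (auto simp: Pos_iff)

lemma dual_vector: "\<exists>w. \<forall>v. w \<bullet> v = crd v i"
proof (intro exI allI)
  fix v :: 'v
  have "crd v i = crd (\<Sum>b\<in>Basis. (v \<bullet> b) *\<^sub>R b) i" by (simp add: euclidean_representation)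
  also have "\<dots> = (\<Sum>b\<in>Basis. crd b i *\<^sub>R b) \<bullet> v"
    by (simp add: crd_sum crd_scale inner_sum_left inner_commute[of v] mult.commute)
  finally show "(\<Sum>b\<in>Basis. crd b i *\<^sub>R b) \<bullet> v = crd v i" ..
qed

text \<open>By \<open>FE_extremal\<close> and \<open>supp_Num\<close> each strictly dominant \<open>\<xi>\<close> is minimal on the support at \<open>0\<close>, hence
  nonnegative on it. Letting \<open>\<xi>\<close> tend to a vector that computes a coordinate gives the claim.\<close>

lemma supp_Num_nonneg:
  assumes "z \<in> supp Num" shows "crd z i \<ge> 0"
proof -
  have ac: "x_coeff x \<noteq> 0 \<longleftrightarrow> x \<in> supp Num" for x by (simp add: x_coeff_def supp_def sq_nonzero)
  have S: "{x \<in> L. x_coeff x \<noteq> 0} = supp Num" using ac supp_lattice by blast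
  obtain w where w: "\<And>v. w \<bullet> v = crd v i" using dual_vector by blast
  have key: "\<xi> \<bullet> z \<ge> 0" if xi: "\<And>k. \<xi> \<bullet> \<alpha> k > 0" for \<xi>
  proof -
    obtain x where x: "x \<in> supp Num" "\<And>v. v \<in> supp Num \<Longrightarrow> \<xi> \<bullet> x \<le> \<xi> \<bullet> v"
      using obtain_minimal[OF finite_supp, of Num \<xi>] assms by blast
    have "pair x k \<le> 0" for k
      by (rule FE_extremal[OF FE_x_coeff _ xi]) (use x ac S supp_lattice finite_supp in auto)
    then have "\<rho> \<bullet> x \<le> 0" using crd_rho by (rule antidominant_inner)
    then have "x = 0" using supp_Num[OF x(1)] by auto
    then show ?thesis using x(2)[OF assms] by simp
  qed
  have "crd z i + e * (\<rho> \<bullet> z) \<ge> 0" if "e > 0" for e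
  proof -
    have "0 < (w + e *\<^sub>R \<rho>) \<bullet> \<alpha> k" for k
      using that inner_rho_simple[of k] by (auto simp: inner_add_left w crd_simple intro: add_nonneg_pos)
    from key[OF this] show ?thesis by (simp add: inner_add_left w)
  qed
  moreover have "((\<lambda>e. crd z i + e * (\<rho> \<bullet> z)) \<longlongrightarrow> crd z i + 0 * (\<rho> \<bullet> z)) (at_right 0)"
    by (intro tendsto_intros)
  ultimately have "0 \<le> crd z i + 0 * (\<rho> \<bullet> z)"
    by (intro tendsto_lowerbound[of "\<lambda>e. crd z i + e * (\<rho> \<bullet> z)"])
       (auto simp: eventually_at_right_less intro: eventually_mono[OF eventually_at_right_less])
  then show ?thesis by simp
qed

theorem numerator_polynomial:
  "\<exists>p :: 'i mpoly. of_poly p = numerator \<Phi> \<alpha> q \<and> pcoeff \<alpha> p 0 = 1 \<and> functional_equations \<alpha> q p"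
proof -
  define e where "e x = Abs_poly_mapping (\<lambda>i. nat (root_coord \<alpha> x i))" for x
  define p where "p = (\<Sum>x\<in>supp Num. Poly_Mapping.single (e x) (x_coeff x))"
  have L: "x \<in> L" if "x \<in> supp Num" for x using that supp_lattice by blast
  have nn: "root_coord \<alpha> x i \<ge> 0" if "x \<in> supp Num" for x i
    using supp_Num_nonneg[OF that, of i] root_coord_eq[OF L[OF that], of i] by (metis of_int_0_le_iff)
  have le: "int (Poly_Mapping.lookup (e x) i) = root_coord \<alpha> x i" if "\<And>i. root_coord \<alpha> x i \<ge> 0" for x i
    using that by (simp add: e_def)
  have "of_poly p = (\<Sum>x\<in>supp Num. const_fun (coef Num x) * ymon x)"
    unfolding p_def of_poly_sum
  proof (rule sum.cong[OF refl])
    fix x assume x: "x \<in> supp Num"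
    have "Poly_Mapping.single (e x) (x_coeff x) = Poly_Mapping.single 0 (x_coeff x) * Poly_Mapping.single (e x) 1"
      by (simp add: mult_single)
    then have "of_poly (Poly_Mapping.single (e x) (x_coeff x)) = const_fun (x_coeff x) * xmon (\<lambda>i. int (Poly_Mapping.lookup (e x) i))"
      by (simp only: of_poly_mult const_fun_def xmon_of_nat)
    also have "(\<lambda>i. int (Poly_Mapping.lookup (e x) i)) = root_coord \<alpha> x" using le[OF nn[OF x]] by blast
    finally show "of_poly (Poly_Mapping.single (e x) (x_coeff x)) = const_fun (coef Num x) * ymon x"
      by (simp only: x_coeff_def const_fun_mult const_fun_powi ymon_def monomial_xmon mult_ac)
  qed
  then have p: "of_poly p = Num" using coef_expand[OF Num_R] by simp
  have pc: "pcoeff \<alpha> p z = x_coeff z" if z: "z \<in> L" for z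
  proof (cases "\<forall>i. root_coord \<alpha> z i \<ge> 0")
    case True
    have inj: "e x = e z \<longleftrightarrow> x = z" if "x \<in> supp Num" for x
    proof
      assume "e x = e z"
      then have "root_coord \<alpha> x i = root_coord \<alpha> z i" for i
        using le[OF nn[OF that], of i] le[of z i] True by simp
      then show "x = z" using root_coord_inj[OF L[OF that] z] by blast
    qed simp
    have "pcoeff \<alpha> p z = Poly_Mapping.lookup p (e z)" using True by (simp add: pcoeff_def e_def)
    also have "\<dots> = (\<Sum>x\<in>supp Num. if x = z then x_coeff x else 0)"
      unfolding p_def lookup_sum by (rule sum.cong) (auto simp: lookup_single when_def inj)
    also have "\<dots> = x_coeff z" by (simp add: finite_supp) (simp add: x_coeff_def supp_def)
    finally show ?thesis .
  next
    case False
    then have "z \<notin> supp Num" using nn by blast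
    then show ?thesis using False by (auto simp: pcoeff_def x_coeff_def supp_def)
  qed
  have "pcoeff \<alpha> p 0 = 1"
    using pc[OF lattice_zero] by (simp add: x_coeff_def height_zero coef_Num_zero)
  moreover have "functional_equations \<alpha> q p"
    unfolding functional_equations_FE FE_def Let_def
  proof (intro allI ballI impI conjI)
    fix k \<nu> \<mu> assume m: "\<nu> \<in> L" "\<mu> \<in> L" "\<mu> = s k \<nu> + \<alpha> k \<and> weight_ge \<alpha> \<mu> \<nu>"
    have l: "\<nu> - \<alpha> k \<in> L" "\<nu> - 2 *\<^sub>R \<alpha> k \<in> L" "\<mu> + \<alpha> k \<in> L" "\<mu> + 2 *\<^sub>R \<alpha> k \<in> L"
      using m lattice_simple[of k] by (simp_all add: lattice_diff lattice_add double_lattice)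
    note A = FE_x_coeff[unfolded FE_def Let_def, rule_format, OF m]
    show "of_nat q * pcoeff \<alpha> p (\<nu> - \<alpha> k) + pcoeff \<alpha> p \<nu> =
        complex_of_real (real q powr (real_of_int (height \<alpha> (\<nu> - \<mu> + \<alpha> k)) / 2)) *
        (pcoeff \<alpha> p \<mu> + pcoeff \<alpha> p (\<mu> + \<alpha> k) / of_nat q)" if "even (phi \<alpha> k \<mu>)"
      unfolding pc[OF l(1)] pc[OF l(3)] pc[OF m(1)] pc[OF m(2)] using A that by blast
    show "of_nat q ^ 2 * pcoeff \<alpha> p (\<nu> - 2 *\<^sub>R \<alpha> k) - pcoeff \<alpha> p \<nu> =
        complex_of_real (sqrt (real q)) * complex_of_real (real q powr (real_of_int (height \<alpha> (\<nu> - \<mu> + \<alpha> k)) / 2)) *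
        (pcoeff \<alpha> p \<mu> - pcoeff \<alpha> p (\<mu> + 2 *\<^sub>R \<alpha> k) / of_nat q ^ 2)" if "odd (phi \<alpha> k \<mu>)"
      unfolding pc[OF l(2)] pc[OF l(4)] pc[OF m(1)] pc[OF m(2)] using A that by blast
  qed
  ultimately show ?thesis using p by (auto simp: Num_def numerator_def)
qed

end

section \<open>Weights of a highest weight representation\<close>

context vector_space
begin

text \<open>Weight vectors of distinct weights are independent: an operator \<open>A x\<close> that separates \<open>l'\<close> from one of
  the weights \<open>l j\<close> removes the \<open>j\<close>-th summand when \<open>l j x\<close> is subtracted from it.\<close>

lemma weight_vectors_independent:
  assumes add: "\<And>x u v. A x (u + v) = A x u + A x v" and sc: "\<And>x c u. A x (scale c u) = scale c (A x u)"
    and "finite I" "\<And>i x. i \<in> I \<Longrightarrow> x \<in> X \<Longrightarrow> A x (u i) = scale (l i x) (u i)"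
    "\<And>i. i \<in> I \<Longrightarrow> \<exists>x\<in>X. l' x \<noteq> l i x" "\<And>x. x \<in> X \<Longrightarrow> A x v = scale (l' x) v" "v = (\<Sum>i\<in>I. u i)"
  shows "v = 0"
  using assms(3-)
proof (induction I arbitrary: v u rule: finite_induct)
  case (insert j I)
  obtain x where x: "x \<in> X" "l' x \<noteq> l j x" using insert.prems(2)[of j] by auto
  have A0: "A x 0 = 0" for x using sc[of x 0 0] by simp
  have Asum: "A x (sum f J) = (\<Sum>i\<in>J. A x (f i))" for x f and J :: "'d set"
    by (induction J rule: infinite_finite_induct) (auto simp: A0 add)
  have "scale (l' x - l j x) v = A x v - scale (l j x) v"
    using insert.prems(3)[OF x(1)] by (simp add: scale_left_diff_distrib)
  also have "\<dots> = (\<Sum>i\<in>insert j I. scale (l i x - l j x) (u i))"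
    unfolding insert.prems(4) Asum scale_sum_right sum_subtractf[symmetric]
    using insert.prems(1) x(1) by (intro sum.cong) (auto simp: scale_left_diff_distrib)
  also have "\<dots> = (\<Sum>i\<in>I. scale (l i x - l j x) (u i))" using insert.hyps by simp
  finally have e: "scale (l' x - l j x) v = (\<Sum>i\<in>I. scale (l i x - l j x) (u i))" .
  have "scale (l' x - l j x) v = 0"
  proof (rule insert.IH[OF _ _ _ e])
    fix i z assume "i \<in> I" "z \<in> X"
    then show "A z (scale (l i x - l j x) (u i)) = scale (l i z) (scale (l i x - l j x) (u i))"
      using insert.prems(1)[of i z] by (simp add: sc mult.commute)
  next
    fix z assume "z \<in> X"
    then show "A z (scale (l' x - l j x) v) = scale (l' z) (scale (l' x - l j x) (v))"
      using insert.prems(3)[of z] by (simp add: sc mult.commute)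
  qed (use insert.prems(2) in auto)
  then show ?case using x(2) by simp
qed simp

lemma eigenvector_decomposition:
  assumes add: "\<And>u v. f (u + v) = f u + f v" and sc: "\<And>c u. f (scale c u) = scale c (f u)"
    and "v \<in> span {w. \<exists>c. f w = scale c w}"
  shows "\<exists>D u. finite D \<and> (\<forall>d\<in>D. f (u d) = scale d (u d)) \<and> v = (\<Sum>d\<in>D. u d)"
  using assms(3)
proof (induction rule: span_induct_alt)
  case base then show ?case by (intro exI[of _ "{}"]) simp
next
  case (step c w v)
  then obtain D u d where D: "finite D" "\<forall>d\<in>D. f (u d) = scale d (u d)" "v = (\<Sum>d\<in>D. u d)" and w: "f w = scale d w"
    by blast
  (* add the new vector to the component of its own eigenvalue *)
  define u' where "u' e = (if e \<in> D then u e else 0) + (if e = d then scale c w else 0)" for e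
  have f0: "f 0 = 0" using sc[of 0 0] by simp
  have "f (u' e) = scale e (u' e)" if "e \<in> insert d D" for e
    using that D(2) w by (auto simp: u'_def add sc f0 scale_right_distrib mult.commute)
  moreover have "scale c w + v = (\<Sum>e\<in>insert d D. u' e)"
  proof -
    have "(\<Sum>e\<in>insert d D. if e \<in> D then u e else 0) = v"
      unfolding D(3) using D(1) by (intro sum.mono_neutral_cong_right) auto
    moreover have "(\<Sum>e\<in>insert d D. if e = d then scale c w else 0) = scale c w" using D(1) by simp
    ultimately show ?thesis unfolding u'_def sum.distrib by simp
  qed
  ultimately show ?case using D(1) by (intro exI[of _ "insert d D"] exI[of _ u']) auto
qed

end

context complex_lie_algebra
begin

lemma bracket_add_left: "bracket (x + y) z = bracket x z + bracket y z"
  and bracket_scale_left: "bracket (scale c x) z = scale c (bracket x z)"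
  and bracket_add_right: "bracket z (x + y) = bracket z x + bracket z y"
  and bracket_scale_right: "bracket z (scale c x) = scale c (bracket z x)"
  using linear_bracket_left[of z] linear_bracket_right[of z]
  by (auto simp: Vector_Spaces.linear_iff)

lemma bracket_antisym: "bracket x y = - bracket y x"
proof -
  have "bracket (x + y) (x + y) = bracket x y + bracket y x"
    by (simp only: bracket_add_left bracket_add_right) (simp add: bracket_self add.commute)
  then show ?thesis using bracket_self[of "x + y"] by (metis eq_neg_iff_add_eq_0)
qed

lemma bracket_zero_left: "bracket 0 z = 0" using bracket_scale_left[of 0 0 z] by simp
lemma bracket_zero_right: "bracket z 0 = 0" using bracket_scale_right[of z 0 0] by simp

lemma jacobi_left: "bracket x (bracket y z) = bracket (bracket x y) z + bracket y (bracket x z)"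
proof -
  have 1: "bracket (bracket x y) z = - bracket z (bracket x y)" by (rule bracket_antisym)
  have 2: "bracket y (bracket x z) = - bracket y (bracket z x)"
    using bracket_antisym[of x z] bracket_scale_right[of y "- 1" "bracket z x"] by simp
  have "bracket x (bracket y z) = - (bracket y (bracket z x) + bracket z (bracket x y))"
    unfolding eq_neg_iff_add_eq_0 using jacobi[of x y z] by (simp only: add.assoc)
  then show ?thesis by (simp only: 1 2 minus_add_distrib add.commute)
qed

lemma root_space_bracket:
  assumes "x \<in> root_space H l" "y \<in> root_space H m" shows "bracket x y \<in> root_space H (\<lambda>h. l h + m h)"
  using assms
  by (auto simp: root_space_def jacobi_left[of _ x y] bracket_scale_left bracket_scale_right scale_left_distrib)

text \<open>If \<open>y\<close> is a simultaneous eigenvector for \<open>C\<close>, so are its components in the eigenspaces of a further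
  element \<open>x\<close>, because the operators commute and the eigenspaces of \<open>x\<close> are independent.\<close>

lemma abelian_simultaneous_eigenvectors:
  assumes ab: "\<And>x y. x \<in> H \<Longrightarrow> y \<in> H \<Longrightarrow> bracket x y = 0" and ss: "\<And>x. x \<in> H \<Longrightarrow> ad_semisimple x"
    and C: "finite C" "C \<subseteq> H"
  shows "span {y. \<forall>x\<in>C. \<exists>c. bracket x y = scale c y} = UNIV"
  using C
proof (induction C rule: finite_induct)
  case empty then show ?case by (simp add: span_UNIV)
next
  case (insert x C)
  let ?E = "\<lambda>C. {y. \<forall>x\<in>C. \<exists>c. bracket x y = scale c y}"
  have "y \<in> span (?E (insert x C))" if y: "y \<in> ?E C" for y
  proof -
    have "y \<in> span {w. \<exists>c. bracket x w = scale c w}" using ss[of x] insert.prems by (simp add: ad_semisimple_def)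
    from eigenvector_decomposition[OF bracket_add_right bracket_scale_right this]
    obtain D u where D: "finite D" "\<forall>d\<in>D. bracket x (u d) = scale d (u d)" "y = (\<Sum>d\<in>D. u d)" by blast
    have "u d \<in> ?E (insert x C)" if d: "d \<in> D" for d
    proof -
      have "\<exists>c. bracket z (u d) = scale c (u d)" if z: "z \<in> C" for z
      proof -
        obtain c where c: "bracket z y = scale c y" using y z by blast
        define w where "w e = bracket z (u e) - scale c (u e)" for e
        have neg: "bracket x (a - b) = bracket x a - bracket x b" for a b
          using bracket_add_right[of x "a - b" b] by simp
        have we: "bracket x (w e) = scale e (w e)" if "e \<in> D" for e
        proof -
          have "bracket x (bracket z (u e)) = scale e (bracket z (u e))"
            using ab[of x z] insert.prems z D(2) that
            by (simp add: jacobi_left[of x z] bracket_zero_left bracket_scale_right subset_iff)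
          then show ?thesis using D(2) that
            by (simp add: w_def neg bracket_scale_right scale_right_diff_distrib mult.commute)
        qed
        have bs: "bracket z (sum f J) = (\<Sum>i\<in>J. bracket z (f i))" for f and J :: "complex set"
          by (induction J rule: infinite_finite_induct) (auto simp: bracket_zero_right bracket_add_right)
        have "(\<Sum>e\<in>D. w e) = bracket z y - scale c y"
          unfolding w_def sum_subtractf D(3) bs scale_sum_right ..
        then have "(\<Sum>e\<in>D. w e) = 0" using c by simp
        then have s: "- w d = (\<Sum>e\<in>D - {d}. w e)" using sum.remove[OF D(1) d, of w] by (intro minus_unique) simp
        have "- w d = 0"
        proof (rule weight_vectors_independent[where A = bracket and I = "D - {d}" and X = "{x}" and u = w and l = "\<lambda>e _. e" and l' = "\<lambda>_. d"])
          show "bracket x' (- w d) = scale d (- w d)" if "x' \<in> {x}" for x'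
            using we[OF d] that bracket_scale_right[of x "- 1" "w d"] by simp
        qed (use D(1) we s in \<open>auto simp: bracket_add_right bracket_scale_right\<close>)
        then have "bracket z (u d) = scale c (u d)" by (simp add: w_def)
        then show ?thesis by blast
      qed
      then show ?thesis using D(2) d by blast
    qed
    then show ?thesis unfolding D(3) by (intro span_sum span_base) blast
  qed
  then have "span (?E C) \<subseteq> span (?E (insert x C))" by (intro span_minimal) (auto simp: subspace_span)
  then show ?case using insert by auto
qed

lemma cartan_root_decomposition:
  assumes H: "cartan_subalgebra H"
  shows "span (\<Union>l. root_space H l) = UNIV"
proof -
  have ab: "\<And>x y. x \<in> H \<Longrightarrow> y \<in> H \<Longrightarrow> bracket x y = 0" and ss: "\<And>x. x \<in> H \<Longrightarrow> ad_semisimple x"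
    and sub: "subspace H"
    using H by (auto simp: cartan_subalgebra_def abelian_subalgebra_def)
  obtain G where G: "finite G" "span G = UNIV" using finite_dim by blast
  obtain C where C: "C \<subseteq> H" "independent C" "H \<subseteq> span C" by (rule basis_exists[of H])
  have finC: "finite C" using independent_span_bound[OF G(1) C(2)] G(2) by simp
  have "y \<in> (\<Union>l. root_space H l)" if y: "\<forall>x\<in>C. \<exists>c. bracket x y = scale c y" for y
  proof -
    have "subspace {x. \<exists>c. bracket x y = scale c y}"
      by (rule subspaceI)
         (auto simp: bracket_zero_left bracket_add_left bracket_scale_left simp flip: scale_left_distrib intro: exI[of _ 0])
    then have "span C \<subseteq> {x. \<exists>c. bracket x y = scale c y}" using y by (intro span_minimal) auto
    then have "\<forall>x\<in>H. \<exists>c. bracket x y = scale c y" using C(3) by blast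
    then obtain l where "\<forall>x\<in>H. bracket x y = scale (l x) y" by metis
    then show ?thesis by (auto simp: root_space_def)
  qed
  then have "span {y. \<forall>x\<in>C. \<exists>c. bracket x y = scale c y} \<subseteq> span (\<Union>l. root_space H l)"
    by (intro span_mono) blast
  then show ?thesis using abelian_simultaneous_eigenvectors[OF ab ss finC C(1)] by blast
qed

text \<open>An element that commutes with \<open>H\<close> spans with \<open>H\<close> an abelian subalgebra, and \<open>H\<close> is maximal.\<close>

lemma cartan_centralizer:
  assumes H: "cartan_subalgebra H" and y: "\<And>x. x \<in> H \<Longrightarrow> bracket x y = 0"
  shows "y \<in> H"
proof -
  have ab: "\<And>x y. x \<in> H \<Longrightarrow> y \<in> H \<Longrightarrow> bracket x y = 0"
    and max: "\<And>H'. abelian_subalgebra H' \<Longrightarrow> H \<subseteq> H' \<Longrightarrow> H' = H"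
    using H by (auto simp: cartan_subalgebra_def abelian_subalgebra_def)
  let ?G = "insert y H"
  have yx: "bracket y x = 0" if "x \<in> H" for x using y[OF that] bracket_antisym[of y x] by simp
  have g: "bracket a b = 0" if "a \<in> ?G" "b \<in> ?G" for a b
    using that ab y yx bracket_self by auto
  have 1: "bracket a b = 0" if "a \<in> span ?G" "b \<in> ?G" for a b
    using that(1)
    by (induction rule: span_induct_alt) (auto simp: bracket_zero_left bracket_add_left bracket_scale_left g[OF _ that(2)])
  have "bracket a b = 0" if "a \<in> span ?G" "b \<in> span ?G" for a b
    using that(2)
    by (induction rule: span_induct_alt) (auto simp: bracket_zero_right bracket_add_right bracket_scale_right 1[OF that(1)])
  then have "abelian_subalgebra (span ?G)" by (simp add: abelian_subalgebra_def subspace_span)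
  then have "span ?G = H" by (rule max) (auto intro: span_base)
  then show ?thesis using span_base[of y ?G] by simp
qed

lemma cartan_root_cases:
  assumes H: "cartan_subalgebra H" and rs: "has_root_system H \<Phi> \<iota>" and y: "y \<in> root_space H l" "y \<noteq> 0"
  shows "y \<in> H \<or> (\<exists>\<beta>\<in>\<Phi>. y \<in> root_space H (\<iota> \<beta>) \<and> (\<forall>x\<in>H. l x = \<iota> \<beta> x))"
proof (cases "\<exists>x\<in>H. l x \<noteq> 0")
  case True
  then have "is_root H l" using y by (auto simp: is_root_def)
  then obtain \<beta> where b: "\<beta> \<in> \<Phi>" "\<forall>x\<in>H. l x = \<iota> \<beta> x" using rs by (auto simp: has_root_system_def)
  then have "y \<in> root_space H (\<iota> \<beta>)" using y(1) by (simp add: root_space_def)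
  then show ?thesis using b by blast
next
  case False
  then show ?thesis using cartan_centralizer[OF H] y(1) by (auto simp: root_space_def)
qed

end

context lie_representation
begin

lemma act_add_left: "act (x + y) v = act x v + act y v"
  and act_scale_left: "act (scale c x) v = vscale c (act x v)"
  and act_add_right: "act x (u + v) = act x u + act x v"
  and act_scale_right: "act x (vscale c v) = vscale c (act x v)"
  using linear_act_left[of v] linear_act_right[of x]
  by (auto simp: Vector_Spaces.linear_iff)

lemma act_zero_left: "act 0 v = 0" using act_scale_left[of 0 0 v] by simp
lemma act_zero_right: "act x 0 = 0" using act_scale_right[of x 0 0] by simp

lemma act_commute: "act x (act y v) = act y (act x v) + act (bracket x y) v"
  by (simp add: act_bracket)

lemma weight_space_act:
  assumes "y \<in> root_space H m" "v \<in> weight_space H l"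
  shows "act y v \<in> weight_space H (\<lambda>h. l h + m h)"
  using assms
  by (auto simp: weight_space_def root_space_def act_commute[of _ y] act_scale_left act_scale_right V.scale_left_distrib)

text \<open>The vectors obtained from \<open>v\<close> by lowering operators; \<open>N\<close> stands for the negative roots.\<close>

inductive_set lowered :: "'g set \<Rightarrow> ('g \<Rightarrow> complex) set \<Rightarrow> 'm \<Rightarrow> 'm set"
  for H N v where
  top: "v \<in> lowered H N v"
| lower: "u \<in> lowered H N v \<Longrightarrow> l \<in> N \<Longrightarrow> y \<in> root_space H l \<Longrightarrow> act y u \<in> lowered H N v"

text \<open>The span of the lowered vectors is stable under the Cartan subalgebra and under raising operators
  \<open>x\<close>: in \<open>x y u = y x u + [x,y] u\<close> the bracket is again a Cartan element or a root vector, so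
  both terms are covered by the induction hypothesis for \<open>u\<close>. Being stable under the whole algebra,
  the span is everything by irreducibility.\<close>

lemma highest_weight_generates:
  assumes H: "cartan_subalgebra H" and rs: "has_root_system H \<Phi> \<iota>"
    and P: "\<And>\<beta>. \<beta> \<in> \<Phi> \<Longrightarrow> \<beta> \<in> P \<or> - \<beta> \<in> P"
    and irr: irreducible_rep
    and v: "v \<noteq> 0" "v \<in> weight_space H l" "\<And>\<beta> x. \<beta> \<in> P \<Longrightarrow> x \<in> root_space H (\<iota> \<beta>) \<Longrightarrow> act x v = 0"
  shows "V.span (lowered H ((\<lambda>\<beta>. \<iota> (- \<beta>)) ` P) v) = UNIV"
proof -
  let ?N = "(\<lambda>\<beta>. \<iota> (- \<beta>)) ` P"
  let ?M = "lowered H ?N v"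
  have low: "act y u \<in> V.span ?M" if "u \<in> V.span ?M" "\<gamma> \<in> P" "y \<in> root_space H (\<iota> (- \<gamma>))" for u y \<gamma>
    using that(1)
  proof (induction rule: V.span_induct_alt)
    case base then show ?case by (simp add: act_zero_right V.span_zero)
  next
    case (step c w z)
    have "act y w \<in> ?M" using that step by (auto intro: lowered.lower)
    then show ?case using step
      by (simp add: act_add_right act_scale_right V.span_add V.span_scale V.span_base)
  qed
  have up: "\<forall>x. x \<in> H \<or> (\<exists>\<beta>\<in>P. x \<in> root_space H (\<iota> \<beta>)) \<longrightarrow> act x u \<in> V.span ?M" if "u \<in> ?M" for u
    using that
  proof induction
    case top
    have "v \<in> V.span ?M" by (intro V.span_base lowered.top)
    then show ?case using v by (auto simp: weight_space_def V.span_scale V.span_zero)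
  next
    case (lower u l y)
    then obtain \<gamma> where g: "\<gamma> \<in> P" "l = \<iota> (- \<gamma>)" by blast
    have uM: "u \<in> V.span ?M" using lower V.span_base by blast
    show ?case
    proof (intro allI impI)
      fix x assume x: "x \<in> H \<or> (\<exists>\<beta>\<in>P. x \<in> root_space H (\<iota> \<beta>))"
      have "act x u \<in> V.span ?M" using lower.IH x by blast
      then have 1: "act y (act x u) \<in> V.span ?M" using low g lower by blast
      have 2: "act (bracket x y) u \<in> V.span ?M"
        using x
      proof
        assume "x \<in> H"
        then have "bracket x y = scale (\<iota> (- \<gamma>) x) y" using lower g by (simp add: root_space_def)
        then show ?thesis using low[OF uM g(1), of y] lower g by (simp add: act_scale_left V.span_scale)
      next
        assume "\<exists>\<beta>\<in>P. x \<in> root_space H (\<iota> \<beta>)"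
        then obtain \<beta> where b: "\<beta> \<in> P" "x \<in> root_space H (\<iota> \<beta>)" by blast
        show ?thesis
        proof (cases "bracket x y = 0")
          case True then show ?thesis by (simp add: act_zero_left V.span_zero)
        next
          case False
          have "y \<in> root_space H (\<iota> (- \<gamma>))" using lower g by simp
          from cartan_root_cases[OF H rs root_space_bracket[OF b(2) this] False]
          consider (h) "bracket x y \<in> H" | (r) \<delta> where "\<delta> \<in> \<Phi>" "bracket x y \<in> root_space H (\<iota> \<delta>)" by blast
          then show ?thesis
          proof cases
            case h then show ?thesis using lower.IH by blast
          next
            case r
            from P[OF r(1)] show ?thesis
            proof
              assume "\<delta> \<in> P" then show ?thesis using r lower.IH by blast
            next
              assume "- \<delta> \<in> P" then show ?thesis using low[OF uM, of "- \<delta>" "bracket x y"] r by simp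
            qed
          qed
        qed
      qed
      show "act x (act y u) \<in> V.span ?M" unfolding act_commute[of x y] by (rule V.span_add[OF 1 2])
    qed
  qed
  have gen: "act x u \<in> V.span ?M" if u: "u \<in> V.span ?M" for x u
  proof -
    have good: "act x u \<in> V.span ?M" if x: "x \<in> H \<or> (\<exists>\<beta>\<in>P. x \<in> root_space H (\<iota> \<beta>))" for x
      using u
    proof (induction rule: V.span_induct_alt)
      case base then show ?case by (simp add: act_zero_right V.span_zero)
    next
      case (step c w z)
      then have "act x w \<in> V.span ?M" using up x by blast
      then show ?case using step by (simp add: act_add_right act_scale_right V.span_add V.span_scale)
    qed
    have root: "act x u \<in> V.span ?M" if x: "x \<in> root_space H l" for x l
    proof (cases "x = 0")
      case True then show ?thesis by (simp add: act_zero_left V.span_zero)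
    next
      case False
      from cartan_root_cases[OF H rs x False]
      consider (h) "x \<in> H" | (r) \<delta> where "\<delta> \<in> \<Phi>" "x \<in> root_space H (\<iota> \<delta>)" by blast
      then show ?thesis
      proof cases
        case h then show ?thesis using good by blast
      next
        case r
        from P[OF r(1)] show ?thesis
        proof
          assume "\<delta> \<in> P" then show ?thesis using r good by blast
        next
          assume "- \<delta> \<in> P" then show ?thesis using low[OF u, of "- \<delta>" x] r by simp
        qed
      qed
    qed
    have "x \<in> span (\<Union>l. root_space H l)" using cartan_root_decomposition[OF H] by simp
    then show ?thesis
    proof (induction rule: span_induct_alt)
      case base then show ?case by (simp add: act_zero_left V.span_zero)
    next
      case (step c x z)
      then have "act x u \<in> V.span ?M" using root by blast
      then show ?case using step by (simp add: act_add_left act_scale_left V.span_add V.span_scale)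
    qed
  qed
  have "v \<in> V.span ?M" by (intro V.span_base lowered.top)
  then have "V.span ?M \<noteq> {0}" using v(1) by blast
  then show ?thesis using irr gen V.subspace_span[of ?M] unfolding irreducible_rep_def by blast
qed

text \<open>The lowered vectors span the representation, and each of them is a weight vector whose weight is
  \<open>\<omega>\<close> minus an element of \<open>Q\<close>. By the independence of weight vectors there is no room for
  another weight.\<close>

lemma weights_below_highest:
  fixes \<Phi> P Q :: "'v::euclidean_space set"
  assumes H: "cartan_subalgebra H" and rs: "has_root_system H \<Phi> \<iota>"
    and P: "\<And>\<beta>. \<beta> \<in> \<Phi> \<Longrightarrow> \<beta> \<in> P \<or> - \<beta> \<in> P"
    and irr: irreducible_rep and hw: "is_highest_weight H (\<iota> ` P) (\<iota> \<omega>)"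
    and Q: "0 \<in> Q" "\<And>x \<beta>. x \<in> Q \<Longrightarrow> \<beta> \<in> P \<Longrightarrow> x + \<beta> \<in> Q"
    and mu: "is_weight H (\<iota> \<mu>)"
  shows "\<omega> - \<mu> \<in> Q"
proof -
  obtain v where v: "v \<in> weight_space H (\<iota> \<omega>)" "v \<noteq> 0" "\<And>\<beta> x. \<beta> \<in> P \<Longrightarrow> x \<in> root_space H (\<iota> \<beta>) \<Longrightarrow> act x v = 0"
    using hw unfolding is_highest_weight_def by blast
  let ?M = "lowered H ((\<lambda>\<beta>. \<iota> (- \<beta>)) ` P) v"
  have lin: "\<And>x. x \<in> H \<Longrightarrow> Real_Vector_Spaces.linear (\<lambda>v. \<iota> v x)"
    and inj: "\<And>v. (\<And>x. x \<in> H \<Longrightarrow> \<iota> v x = 0) \<Longrightarrow> v = 0"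
    using rs by (auto simp: has_root_system_def)
  have Mw: "\<exists>x\<in>Q. u \<in> weight_space H (\<iota> (\<omega> - x))" if "u \<in> ?M" for u
    using that
  proof induction
    case top then show ?case using v Q(1) by (intro bexI[of _ 0]) auto
  next
    case (lower u l y)
    then obtain x \<gamma> where x: "x \<in> Q" "u \<in> weight_space H (\<iota> (\<omega> - x))" and g: "\<gamma> \<in> P" "l = \<iota> (- \<gamma>)" by blast
    have "\<iota> (\<omega> - x) h + \<iota> (- \<gamma>) h = \<iota> (\<omega> - (x + \<gamma>)) h" if "h \<in> H" for h
      using linear_add[OF lin[OF that], of "\<omega> - x" "- \<gamma>"] by (simp add: algebra_simps)
    then have "act y u \<in> weight_space H (\<iota> (\<omega> - (x + \<gamma>)))"
      using weight_space_act[OF lower(3) x(2)] g by (simp add: weight_space_def)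
    then show ?case using Q(2)[OF x(1) g(1)] by blast
  qed
  obtain w where w: "w \<in> weight_space H (\<iota> \<mu>)" "w \<noteq> 0" using mu by (auto simp: is_weight_def)
  have "V.span ?M = UNIV"
    by (rule highest_weight_generates[OF H rs P irr v(2,1)]) (assumption, rule v(3))
  then have "w \<in> V.span ?M" by simp
  then obtain t r where t: "finite t" "t \<subseteq> ?M" "w = (\<Sum>u\<in>t. vscale (r u) u)"
    unfolding V.span_explicit by blast
  have "\<forall>u\<in>t. \<exists>x\<in>Q. u \<in> weight_space H (\<iota> (\<omega> - x))" using t(2) Mw by blast
  then obtain f where f: "\<And>u. u \<in> t \<Longrightarrow> f u \<in> Q" "\<And>u. u \<in> t \<Longrightarrow> u \<in> weight_space H (\<iota> (\<omega> - f u))" by metis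
  have "\<exists>u\<in>t. \<forall>h\<in>H. \<iota> \<mu> h = \<iota> (\<omega> - f u) h"
  proof (rule ccontr)
    assume n: "\<not> ?thesis"
    have "w = 0"
    proof (rule V.weight_vectors_independent[where A = act and I = t and X = H and u = "\<lambda>u. vscale (r u) u" and l = "\<lambda>u. \<iota> (\<omega> - f u)" and l' = "\<iota> \<mu>"])
      show "act x (vscale (r i) i) = vscale (\<iota> (\<omega> - f i) x) (vscale (r i) i)" if "i \<in> t" "x \<in> H" for i x
        using f(2)[OF that(1)] that(2) by (simp add: weight_space_def act_scale_right mult.commute)
    qed (use t w n in \<open>auto simp: act_add_right act_scale_right weight_space_def\<close>)
    then show False using w by simp
  qed
  then obtain u where u: "u \<in> t" "\<And>h. h \<in> H \<Longrightarrow> \<iota> \<mu> h = \<iota> (\<omega> - f u) h" by blast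
  have "\<mu> - (\<omega> - f u) = 0"
    by (rule inj) (use u(2) linear_diff[OF lin] in simp)
  then have "\<omega> - \<mu> = f u" by (simp add: algebra_simps)
  then show ?thesis using f(1)[OF u(1)] by simp
qed

end

context laurent_system
begin

lemma regular_dominant_weights:
  fixes scale :: "complex \<Rightarrow> 'g::ab_group_add \<Rightarrow> 'g" and bracket H
    and \<iota> :: "'v \<Rightarrow> 'g \<Rightarrow> complex"
    and vscale :: "complex \<Rightarrow> 'm::ab_group_add \<Rightarrow> 'm" and act
  assumes "lie_representation scale bracket vscale act"
    and H: "complex_lie_algebra.cartan_subalgebra scale bracket H"
    and rs: "complex_lie_algebra.has_root_system scale bracket H \<Phi> \<iota>"
    and irr: "lie_representation.irreducible_rep vscale act"
    and hw: "lie_representation.is_highest_weight scale bracket vscale act H (\<iota> ` Pos) (\<iota> \<rho>)"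
  shows "{\<mu>. lie_representation.is_weight vscale act H (\<iota> \<mu>) \<and> dominant \<alpha> \<mu> \<and> regular \<Phi> \<mu>} = {\<rho>}"
proof -
  interpret rep: lie_representation scale bracket vscale act by fact
  have dom: "dominant \<alpha> \<mu> \<longleftrightarrow> (\<forall>k. pair \<mu> k \<ge> 0)" for \<mu> by (simp add: dominant_def pair_def)
  have "\<mu> = \<rho>" if m: "rep.is_weight H (\<iota> \<mu>)" "dominant \<alpha> \<mu>" "regular \<Phi> \<mu>" for \<mu>
  proof -
    define x where "x = \<rho> - \<mu>"
    have "x \<in> {x \<in> L. \<forall>i. crd x i \<ge> 0}"
      unfolding x_def
      by (rule rep.weights_below_highest[OF H rs pos_or_neg irr hw _ _ m(1)])
         (auto simp: lattice_zero crd_zero lattice_add root_lattice_root pos_root crd_add Pos_iff)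
    then have x: "x \<in> L" "\<And>i. crd x i \<ge> 0" by auto
    have "pair x k \<le> 0" for k
    proof -
      have e: "pair \<mu> k = 1 - pair x k" by (simp add: x_def pair_diff pair_rho)
      have "pair \<mu> k \<noteq> 0"
      proof
        assume "pair \<mu> k = 0"
        then have "s k \<mu> = \<mu>" by (simp add: s_eq)
        moreover have "s k \<in> W" using W_comp[OF weyl_id, of k] by simp
        ultimately have "s k = id" using m(3) by (auto simp: regular_def)
        then have "s k (\<alpha> k) = \<alpha> k" by simp
        then have "\<alpha> k = - \<alpha> k" by (simp add: s_self)
        then show False using simple_Pos minus_simple_not_Pos by metis
      qed
      moreover have "pair \<mu> k \<ge> 0" using m(2) dom by blast
      moreover obtain n where "pair x k = of_int n" using pair_Ints[OF x(1)] by (auto elim: Ints_cases)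
      ultimately show ?thesis using e by auto
    qed
    then have "x = 0" using x(2) by (rule antidominant_zero)
    then show ?thesis by (simp add: x_def)
  qed
  moreover have "rep.is_weight H (\<iota> \<rho>)"
    using hw unfolding rep.is_highest_weight_def rep.is_weight_def by blast
  moreover have "dominant \<alpha> \<rho>" by (simp add: dom pair_rho)
  moreover have "regular \<Phi> \<rho>" unfolding regular_def using regular_rho weyl_id by auto
  ultimately show ?thesis by blast
qed

end

section \<open>The regular dominant weight and the uniqueness of the numerator\<close>

theorem corollary5p8:
  fixes \<Phi> :: "'v::euclidean_space set"
    and \<alpha> :: "'i::{finite,linorder} \<Rightarrow> 'v"
    and q :: nat
  assumes "reduced_root_system \<Phi>"
    and "simple_roots \<Phi> \<alpha>"
    and "simply_laced \<alpha>"
    and "primepow q"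
  shows "(\<forall>(scale :: complex \<Rightarrow> 'g::ab_group_add \<Rightarrow> 'g) bracket H (\<iota> :: 'v \<Rightarrow> 'g \<Rightarrow> complex)
            (vscale :: complex \<Rightarrow> 'm::ab_group_add \<Rightarrow> 'm) act.
            semisimple_lie_algebra scale bracket \<and>
            complex_lie_algebra.cartan_subalgebra scale bracket H \<and>
            complex_lie_algebra.has_root_system scale bracket H \<Phi> \<iota> \<and>
            lie_representation scale bracket vscale act \<and>
            lie_representation.irreducible_rep vscale act \<and>
            lie_representation.is_highest_weight scale bracket vscale act H
              (\<iota> ` positive_roots \<Phi> \<alpha>) (\<iota> (rho \<Phi> \<alpha>)) \<longrightarrow>
            {\<mu>. lie_representation.is_weight vscale act H (\<iota> \<mu>) \<and> dominant \<alpha> \<mu> \<and> regular \<Phi> \<mu>}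
              = {rho \<Phi> \<alpha>}) \<and>
         (\<exists>p :: 'i mpoly.
            of_poly p = numerator \<Phi> \<alpha> q \<and>
            pcoeff \<alpha> p 0 = 1 \<and> functional_equations \<alpha> q p \<and>
            (\<forall>p' :: 'i mpoly. pcoeff \<alpha> p' 0 = 1 \<and> functional_equations \<alpha> q p' \<longrightarrow> p' = p))"
proof -
  interpret laurent_system \<Phi> \<alpha> q
    using assms by unfold_locales (auto dest: primepow_gt_Suc_0)
  obtain p :: "'i mpoly" where p: "of_poly p = numerator \<Phi> \<alpha> q" "pcoeff \<alpha> p 0 = 1" "functional_equations \<alpha> q p"
    using numerator_polynomial by blast
  show ?thesis
  proof (intro conjI allI impI)
    show "\<exists>p :: 'i mpoly. of_poly p = numerator \<Phi> \<alpha> q \<and> pcoeff \<alpha> p 0 = 1 \<and> functional_equations \<alpha> q p \<and>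
        (\<forall>p' :: 'i mpoly. pcoeff \<alpha> p' 0 = 1 \<and> functional_equations \<alpha> q p' \<longrightarrow> p' = p)"
      using p FE_unique by (intro exI[of _ p]) auto
  qed (rule regular_dominant_weights, blast+)
qed

end
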